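(* Let $\Gamma$ be a proper NEC group with signature $(0;+;[m_1,\ldots,m_r];\{\mathcal{C}_1,\ldots,\mathcal{C}_k\})$. Let $k_0$ be the number of empty period cycles among $\mathcal{C}_1,\ldots,\mathcal{C}_k$, and let $k_3$ be the number of period cycles among $\mathcal{C}_1,\ldots,\mathcal{C}_k$ having three or more link periods. If $k_0+k_3\ge 2$, then $\Gamma$ has a torsion-free normal subgroup of finite index that contains orientation-reversing elements.
   Context: $\mathcal{H}$ is the hyperbolic plane. An NEC (non-Euclidean crystallographic) group is a discrete subgroup $\Gamma$ of the group $\mathrm{Isom}^{\pm}(\mathcal{H})$ of all isometries of $\mathcal{H}$ (orientation-preserving or orientation-reversing) such that the orbit space $\mathcal{H}/\Gamma$ is compact. It is proper if it contains an element reversing the orientation of $\mathcal{H}$, i.e. it is not a Fuchsian group. "Torsion-free" means having no non-identity element of finite order. An NEC group with signature $(0;+;[m_1,\ldots,m_r];\{\mathcal{C}_1,\ldots,\mathcal{C}_k\})$, where the period cycles are $\mathcal{C}_i=(n_{i1},\ldots,n_{is_i})$ and all $m_i,n_{ij}\ge 2$, has a presentation with generators $x_i$ ($1\le i\le r$), $e_i$ ($1\le i\le k$) and $c_{ij}$ ($1\le i\le k$, $0\le j\le s_i$), subject to the defining relations $x_i^{m_i}=1$; $c_{i,j-1}^2=c_{ij}^2=(c_{i,j-1}c_{ij})^{n_{ij}}=1$ for $1\le j\le s_i$ (and $c_{i0}^2=1$ if $s_i=0$); $c_{is_i}=e_ic_{i0}e_i^{-1}$ for $1\le i\le k$; and $x_1\cdots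 x_re_1\cdots e_k=1$. Here the $x_i$ are elliptic, the $e_i$ preserve orientation, and the $c_{ij}$ are reflections (reversing orientation). The integers $m_i$ are called proper periods (possibly none, $r=0$), and the integers $n_{ij}$ are called link periods. A period cycle with $s_i=0$ is called empty and written $(-)$. Such an NEC group exists if and only if $$\mu(\Gamma)=k-2+\sum_{i=1}^r\Bigl(1-\frac1{m_i}\Bigr)+\frac12\sum_{i=1}^k\sum_{j=1}^{s_i}\Bigl(1-\frac1{n_{ij}}\Bigr)>0.$$ *)

theory Defs
  imports "HOL-Analysis.Analysis" "HOL-Algebra.Group_Action" "HOL-Algebra.Generated_Groups"
begin

section \<open>The hyperbolic plane and its isometries\<close>

text \<open>Upper half-plane model, with the distance of curvature \<open>-1\<close>.\<close>

definition hyp_plane :: "complex set" where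
  "hyp_plane = {z. Im z > 0}"

definition hyp_dist :: "complex \<Rightarrow> complex \<Rightarrow> real" where
  "hyp_dist z w = arcosh (1 + (cmod (z - w))\<^sup>2 / (2 * Im z * Im w))"

text \<open>The group of all isometries of the hyperbolic plane, as a subgroup of the group of all
  bijections. Its elements are extensional, i.e. \<open>undefined\<close> outside the plane.\<close>

definition hyp_isom :: "(complex \<Rightarrow> complex) monoid" where
  "hyp_isom = BijGroup hyp_plane
     \<lparr>carrier := {f \<in> Bij hyp_plane.
        \<forall>z\<in>hyp_plane. \<forall>w\<in>hyp_plane. hyp_dist (f z) (f w) = hyp_dist z w}\<rparr>"

lemma subgroup_hyp_isom: "subgroup (carrier hyp_isom) (BijGroup hyp_plane)"
proof (rule group.subgroupI[OF group_BijGroup])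
  show "carrier hyp_isom \<subseteq> carrier (BijGroup hyp_plane)"
    by (auto simp: hyp_isom_def BijGroup_def)
  have "(\<lambda>z\<in>hyp_plane. z) \<in> carrier hyp_isom"
    using id_Bij[of hyp_plane] by (simp add: hyp_isom_def)
  then show "carrier hyp_isom \<noteq> {}" by blast
next
  fix f assume f: "f \<in> carrier hyp_isom"
  then have fB: "f \<in> Bij hyp_plane" and
    iso: "\<And>z w. \<lbrakk>z \<in> hyp_plane; w \<in> hyp_plane\<rbrakk> \<Longrightarrow> hyp_dist (f z) (f w) = hyp_dist z w"
    by (auto simp: hyp_isom_def)
  let ?g = "inv_into hyp_plane f"
  from fB have bij: "bij_betw f hyp_plane hyp_plane" by (simp add: Bij_def)
  have "hyp_dist (?g z) (?g w) = hyp_dist z w" if "z \<in> hyp_plane" "w \<in> hyp_plane" for z w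
    using iso[of "?g z" "?g w"] that bij
    by (metis Bij_inv_into_mem fB bij_betw_inv_into_right)
  then show "inv\<^bsub>BijGroup hyp_plane\<^esub> f \<in> carrier hyp_isom"
    using fB restrict_inv_into_Bij[OF fB] by (simp add: hyp_isom_def inv_BijGroup)
next
  fix f g assume f: "f \<in> carrier hyp_isom" and g: "g \<in> carrier hyp_isom"
  then have B: "f \<in> Bij hyp_plane" "g \<in> Bij hyp_plane" by (auto simp: hyp_isom_def)
  have "g z \<in> hyp_plane" if "z \<in> hyp_plane" for z
    using Bij_imp_funcset[OF B(2)] that by blast
  then have "\<forall>z\<in>hyp_plane. \<forall>w\<in>hyp_plane.
      hyp_dist (compose hyp_plane f g z) (compose hyp_plane f g w) = hyp_dist z w"
    using f g by (simp add: hyp_isom_def compose_eq)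
  then show "f \<otimes>\<^bsub>BijGroup hyp_plane\<^esub> g \<in> carrier hyp_isom"
    using B compose_Bij[OF B] by (simp add: hyp_isom_def BijGroup_def)
qed

lemma group_hyp_isom: "group hyp_isom"
  using subgroup.subgroup_is_group[OF subgroup_hyp_isom group_BijGroup]
  by (simp add: hyp_isom_def)

text \<open>Jacobian determinant of a real-linear map of the plane, in the basis \<open>1, \<i>\<close>.\<close>

definition jacobian :: "(complex \<Rightarrow> complex) \<Rightarrow> real" where
  "jacobian D = Re (D 1) * Im (D \<i>) - Re (D \<i>) * Im (D 1)"

definition orientation_preserving :: "(complex \<Rightarrow> complex) \<Rightarrow> bool" where
  "orientation_preserving f \<longleftrightarrow>
     (\<forall>z\<in>hyp_plane. \<exists>D. (f has_derivative D) (at z) \<and> jacobian D > 0)"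

definition orientation_reversing :: "(complex \<Rightarrow> complex) \<Rightarrow> bool" where
  "orientation_reversing f \<longleftrightarrow>
     (\<forall>z\<in>hyp_plane. \<exists>D. (f has_derivative D) (at z) \<and> jacobian D < 0)"

definition hyp_line :: "complex set \<Rightarrow> bool" where
  "hyp_line L \<longleftrightarrow>
     (\<exists>\<gamma> :: real \<Rightarrow> complex. range \<gamma> = L \<and> L \<subseteq> hyp_plane \<and>
        (\<forall>s t. hyp_dist (\<gamma> s) (\<gamma> t) = \<bar>s - t\<bar>))"

definition elliptic :: "(complex \<Rightarrow> complex) \<Rightarrow> bool" where
  "elliptic f \<longleftrightarrow> f \<in> carrier hyp_isom \<and> orientation_preserving f \<and>
     (\<exists>!z. z \<in> hyp_plane \<and> f z = z)"

definition reflection :: "(complex \<Rightarrow> complex) \<Rightarrow> bool" where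
  "reflection f \<longleftrightarrow> f \<in> carrier hyp_isom \<and> orientation_reversing f \<and>
     hyp_line {z \<in> hyp_plane. f z = z}"


section \<open>NEC groups\<close>

text \<open>The topology on the isometry group is that of pointwise convergence, which on the
  isometry group of a proper metric space is the compact-open topology. The Euclidean and the
  hyperbolic topology on the upper half-plane agree.\<close>

definition discrete_isom :: "(complex \<Rightarrow> complex) set \<Rightarrow> bool" where
  "discrete_isom \<Gamma> \<longleftrightarrow>
     subtopology (product_topology (\<lambda>_. top_of_set hyp_plane) hyp_plane) \<Gamma> = discrete_topology \<Gamma>"

definition hyp_orbit :: "(complex \<Rightarrow> complex) set \<Rightarrow> complex \<Rightarrow> complex set" where
  "hyp_orbit \<Gamma> = orbit (hyp_isom\<lparr>carrier := \<Gamma>\<rparr>) (\<lambda>f. f)"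

definition orbit_space :: "(complex \<Rightarrow> complex) set \<Rightarrow> complex set topology" where
  "orbit_space \<Gamma> = topology (\<lambda>U. U \<subseteq> hyp_orbit \<Gamma> ` hyp_plane \<and>
     openin (top_of_set hyp_plane) {z \<in> hyp_plane. hyp_orbit \<Gamma> z \<in> U})"

lemma openin_orbit_space:
  "openin (orbit_space \<Gamma>) U \<longleftrightarrow> U \<subseteq> hyp_orbit \<Gamma> ` hyp_plane \<and>
     openin (top_of_set hyp_plane) {z \<in> hyp_plane. hyp_orbit \<Gamma> z \<in> U}"
proof -
  let ?P = "\<lambda>U. U \<subseteq> hyp_orbit \<Gamma> ` hyp_plane \<and>
     openin (top_of_set hyp_plane) {z \<in> hyp_plane. hyp_orbit \<Gamma> z \<in> U}"
  have "istopology ?P"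
    unfolding istopology_def
  proof (intro conjI allI impI)
    fix S T assume S: "?P S" and T: "?P T"
    from S show "S \<inter> T \<subseteq> hyp_orbit \<Gamma> ` hyp_plane" by blast
    have "{z \<in> hyp_plane. hyp_orbit \<Gamma> z \<in> S \<inter> T} =
        {z \<in> hyp_plane. hyp_orbit \<Gamma> z \<in> S} \<inter> {z \<in> hyp_plane. hyp_orbit \<Gamma> z \<in> T}" by blast
    with S T show "openin (top_of_set hyp_plane) {z \<in> hyp_plane. hyp_orbit \<Gamma> z \<in> S \<inter> T}"
      by (simp only: openin_Int)
  next
    fix K assume K: "\<forall>S\<in>K. ?P S"
    then show "\<Union>K \<subseteq> hyp_orbit \<Gamma> ` hyp_plane" by blast
    have eq: "{z \<in> hyp_plane. hyp_orbit \<Gamma> z \<in> \<Union>K} =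
        \<Union>((\<lambda>S. {z \<in> hyp_plane. hyp_orbit \<Gamma> z \<in> S}) ` K)" by blast
    show "openin (top_of_set hyp_plane) {z \<in> hyp_plane. hyp_orbit \<Gamma> z \<in> \<Union>K}"
      unfolding eq by (rule openin_Union) (use K in blast)
  qed
  then show ?thesis
    unfolding orbit_space_def by (simp only: topology_inverse')
qed

lemma topspace_orbit_space: "topspace (orbit_space \<Gamma>) = hyp_orbit \<Gamma> ` hyp_plane"
proof
  show "topspace (orbit_space \<Gamma>) \<subseteq> hyp_orbit \<Gamma> ` hyp_plane"
    using openin_topspace openin_orbit_space by blast
  have "{z \<in> hyp_plane. hyp_orbit \<Gamma> z \<in> hyp_orbit \<Gamma> ` hyp_plane} = hyp_plane" by blast
  then have "openin (orbit_space \<Gamma>) (hyp_orbit \<Gamma> ` hyp_plane)"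
    by (simp add: openin_orbit_space)
  then show "hyp_orbit \<Gamma> ` hyp_plane \<subseteq> topspace (orbit_space \<Gamma>)"
    by (rule openin_subset)
qed

lemma quotient_map_orbit_space:
  "quotient_map (top_of_set hyp_plane) (orbit_space \<Gamma>) (hyp_orbit \<Gamma>)"
  unfolding quotient_map_def topspace_orbit_space openin_orbit_space
  by simp

definition NEC_group :: "(complex \<Rightarrow> complex) set \<Rightarrow> bool" where
  "NEC_group \<Gamma> \<longleftrightarrow>
     subgroup \<Gamma> hyp_isom \<and> discrete_isom \<Gamma> \<and> compact_space (orbit_space \<Gamma>)"

definition proper_NEC_group :: "(complex \<Rightarrow> complex) set \<Rightarrow> bool" where
  "proper_NEC_group \<Gamma> \<longleftrightarrow> NEC_group \<Gamma> \<and> (\<exists>f\<in>\<Gamma>. orientation_reversing f)"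

definition torsion_free :: "('a, 'b) monoid_scheme \<Rightarrow> bool" where
  "torsion_free G \<longleftrightarrow>
     (\<forall>g\<in>carrier G. g \<noteq> \<one>\<^bsub>G\<^esub> \<longrightarrow> \<not> (\<exists>n::nat. n > 0 \<and> g [^]\<^bsub>G\<^esub> n = \<one>\<^bsub>G\<^esub>))"


section \<open>Group presentations\<close>

text \<open>A letter \<open>(x, True)\<close> stands for the generator \<open>x\<close>, and \<open>(x, False)\<close> for its inverse.\<close>

type_synonym 'x word = "('x \<times> bool) list"

definition word_value :: "('a, 'b) monoid_scheme \<Rightarrow> ('x \<Rightarrow> 'a) \<Rightarrow> 'x word \<Rightarrow> 'a" where
  "word_value G \<phi> w =
     foldr (\<lambda>(x, b) g. (if b then \<phi> x else inv\<^bsub>G\<^esub> \<phi> x) \<otimes>\<^bsub>G\<^esub> g) w \<one>\<^bsub>G\<^esub>"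

text \<open>Equality of words in the abstract group \<open>\<langle>X | R\<rangle>\<close>.\<close>

inductive word_eq :: "'x set \<Rightarrow> 'x word set \<Rightarrow> 'x word \<Rightarrow> 'x word \<Rightarrow> bool"
  for X R where
  refl: "word_eq X R w w"
| sym: "word_eq X R v w \<Longrightarrow> word_eq X R w v"
| trans: "word_eq X R u v \<Longrightarrow> word_eq X R v w \<Longrightarrow> word_eq X R u w"
| cancel: "x \<in> X \<Longrightarrow> word_eq X R (u @ [(x, b), (x, \<not> b)] @ v) (u @ v)"
| relator: "r \<in> R \<Longrightarrow> word_eq X R (u @ r @ v) (u @ v)"

text \<open>The assignment \<open>\<phi>\<close> of the generators induces an isomorphism from \<open>\<langle>X | R\<rangle>\<close> onto \<open>G\<close>.\<close>

definition presentation ::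
  "('a, 'b) monoid_scheme \<Rightarrow> 'x set \<Rightarrow> 'x word set \<Rightarrow> ('x \<Rightarrow> 'a) \<Rightarrow> bool" where
  "presentation G X R \<phi> \<longleftrightarrow>
     \<phi> ` X \<subseteq> carrier G \<and> generate G (\<phi> ` X) = carrier G \<and>
     R \<subseteq> lists (X \<times> UNIV) \<and>
     (\<forall>w\<in>lists (X \<times> UNIV). word_value G \<phi> w = \<one>\<^bsub>G\<^esub> \<longleftrightarrow> word_eq X R w [])"


section \<open>Signatures of genus 0 and sign +\<close>

text \<open>The signature \<open>(0; +; [m\<^sub>1, \<dots>, m\<^sub>r]; {C\<^sub>1, \<dots>, C\<^sub>k})\<close> is given by the list \<open>ms\<close> of proper
  periods and the list \<open>Cs\<close> of period cycles. All outer indices start from 0, so that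
  \<open>X_gen i\<close>, \<open>E_gen i\<close>, \<open>C_gen i j\<close> are the canonical generators \<open>x\<^sub>i\<^sub>+\<^sub>1\<close>, \<open>e\<^sub>i\<^sub>+\<^sub>1\<close>, \<open>c\<^sub>i\<^sub>+\<^sub>1\<^sub>,\<^sub>j\<close>
  and \<open>Cs ! i ! j\<close> is the link period \<open>n\<^sub>i\<^sub>+\<^sub>1\<^sub>,\<^sub>j\<^sub>+\<^sub>1\<close>.\<close>

datatype nec_gen = X_gen nat | E_gen nat | C_gen nat nat

definition nec_gens :: "nat list \<Rightarrow> nat list list \<Rightarrow> nec_gen set" where
  "nec_gens ms Cs =
     {X_gen i | i. i < length ms} \<union> {E_gen i | i. i < length Cs} \<union>
     {C_gen i j | i j. i < length Cs \<and> j \<le> length (Cs ! i)}"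

definition word_power :: "'x word \<Rightarrow> nat \<Rightarrow> 'x word" where
  "word_power w n = concat (replicate n w)"

definition nec_relators :: "nat list \<Rightarrow> nat list list \<Rightarrow> nec_gen word set" where
  "nec_relators ms Cs =
     {word_power [(X_gen i, True)] (ms ! i) | i. i < length ms} \<union>
     {word_power [(C_gen i j, True)] 2 | i j. i < length Cs \<and> j \<le> length (Cs ! i)} \<union>
     {word_power [(C_gen i j, True), (C_gen i (Suc j), True)] (Cs ! i ! j) | i j.
        i < length Cs \<and> j < length (Cs ! i)} \<union>
     {[(E_gen i, True), (C_gen i 0, True), (E_gen i, False), (C_gen i (length (Cs ! i)), False)] | i.
        i < length Cs} \<union>
     {map (\<lambda>i. (X_gen i, True)) [0..<length ms] @ map (\<lambda>i. (E_gen i, True)) [0..<length Cs]}"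

text \<open>The signature is expressed through a system of canonical generators. For NEC groups this
  determines it up to the usual equivalence, since abstract isomorphisms of NEC groups are
  geometric.\<close>

definition has_signature ::
  "(complex \<Rightarrow> complex) set \<Rightarrow> nat list \<Rightarrow> nat list list \<Rightarrow> bool" where
  "has_signature \<Gamma> ms Cs \<longleftrightarrow>
     (\<forall>m\<in>set ms. m \<ge> 2) \<and> (\<forall>C\<in>set Cs. \<forall>n\<in>set C. n \<ge> 2) \<and>
     (\<exists>\<phi>. presentation (hyp_isom\<lparr>carrier := \<Gamma>\<rparr>) (nec_gens ms Cs) (nec_relators ms Cs) \<phi> \<and>
        (\<forall>i<length ms. elliptic (\<phi> (X_gen i))) \<and>
        (\<forall>i<length Cs. orientation_preserving (\<phi> (E_gen i))) \<and>
        (\<forall>i<length Cs. \<forall>j\<le>length (Cs ! i). reflection (\<phi> (C_gen i j))))"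

end

theory Submission
  imports Defs "HOL-Computational_Algebra.Polynomial" "HOL-Computational_Algebra.Primes"
begin

text \<open>Lift the group to \<open>SL\<^sub>2(\<complex>)\<close> up to sign: an isometry becomes a real matrix, or a purely
  imaginary one if it reverses orientation. Only the relations are kept when this lift is
  deformed along a path of assignments of matrices to the generators. Along such a path the
  trace of an element of finite order takes values in a finite set, so it is constant; therefore an
  element of finite order that dies at the end of the path was trivial already at its start, where
  the assignment is faithful.

  The end of the path is chosen such that some orientation-reversing word becomes \<open>\<plusminus>1\<close> there.
  The entries of the end assignment generate a finitely generated ring; as in Selberg's lemma, the
  elements congruent to \<open>\<plusminus>1\<close> modulo two ideals of finite index, of different residue
  characteristics, form a normal subgroup of finite index. Its torsion dies at the end of the path,
  and it contains the reversing word.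

  With two empty period cycles, the elements \<open>e\<^sub>2\<close> and \<open>e\<^sub>1\<close> lie in the tori through \<open>c\<^sub>2\<close> and \<open>c\<^sub>1\<close>.
  Move \<open>e\<^sub>2\<close> in its torus to an element whose \<open>m\<close>-th power is \<open>c\<^sub>2\<close>; the long relation determines
  \<open>e\<^sub>1\<close>, and \<open>c\<^sub>1\<close> is the half-turn in the torus of \<open>e\<^sub>1\<close>. The reversing word is \<open>e\<^sub>2\<^sup>m c\<^sub>2\<close>.
  With a period cycle having at least three links, move only \<open>c\<^sub>1\<close> and \<open>c\<^sub>2\<close>: rotate \<open>c\<^sub>1\<close> about \<open>c\<^sub>0\<close>,
  and \<open>c\<^sub>2\<close> about \<open>c\<^sub>3\<close> in such a way that the trace of \<open>c\<^sub>1 c\<^sub>2\<close> is preserved, until \<open>c\<^sub>0 c\<^sub>1 c\<^sub>3\<close> has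
  odd finite order \<open>n\<close>. The reversing word is \<open>(c\<^sub>0 c\<^sub>1 c\<^sub>3)\<^sup>n\<close>.
  In both cases the second cycle balances the long relation in monomial test assignments, which show
  that \<open>e\<^sub>1\<^sup>2\<close>, respectively \<open>c\<^sub>a c\<^sub>b\<close> for \<open>a < b \<le> 3\<close>, is not trivial.\<close>

section \<open>Two-by-two matrices and rigidity of torsion\<close>

text \<open>A faithful lift sends no reversing word to \<plusminus>1, because such words have purely
  imaginary matrices. So the end of the path has to leave the real form and lose faithfulness, and
  the construction must do so without losing torsion. Relations hold only up to sign, so every
  condition along the path is projective, and orders are examined on squares. Along the path, square
  roots and quotients have to be continued. Everything that must not vanish is a Laurent polynomial
  in one parameter, so once a single good parameter is known, the bad ones form a finite set. The
  admissible end parameters are infinite in number (roots of \<i> in the first case, traces of roots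
  of unity of odd order in the second), so one of them is good. In the second case the start itself
  may be bad; the path then avoids bad parameters only at positive times. The order \<open>n\<close>
  of the second case is odd so that the \<open>n\<close>-th power of a reversing word still
  reverses. Two residue characteristics are used because congruence modulo an ideal containing the
  prime \<open>p\<close> does not control elements of order \<open>p\<close>.\<close>

datatype m2 = M2 (m11: complex) (m12: complex) (m21: complex) (m22: complex)

instantiation m2 :: ring_1
begin

definition "0 = M2 0 0 0 0"
definition "1 = M2 1 0 0 1"
definition "A + B = M2 (m11 A + m11 B) (m12 A + m12 B) (m21 A + m21 B) (m22 A + m22 B)"
definition "- A = M2 (- m11 A) (- m12 A) (- m21 A) (- m22 A)"
definition "A - B = M2 (m11 A - m11 B) (m12 A - m12 B) (m21 A - m21 B) (m22 A - m22 B)"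
definition "A * B = M2 (m11 A * m11 B + m12 A * m21 B) (m11 A * m12 B + m12 A * m22 B)
                       (m21 A * m11 B + m22 A * m21 B) (m21 A * m12 B + m22 A * m22 B)"

instance
  by standard
    (auto simp: zero_m2_def one_m2_def plus_m2_def uminus_m2_def minus_m2_def times_m2_def
      algebra_simps m2.expand)

end

lemma m2_sel [simp]:
  "m11 0 = 0" "m12 0 = 0" "m21 0 = 0" "m22 0 = 0"
  "m11 1 = 1" "m12 1 = 0" "m21 1 = 0" "m22 1 = 1"
  "m11 (A + B) = m11 A + m11 B" "m12 (A + B) = m12 A + m12 B"
  "m21 (A + B) = m21 A + m21 B" "m22 (A + B) = m22 A + m22 B"
  "m11 (- A) = - m11 A" "m12 (- A) = - m12 A" "m21 (- A) = - m21 A" "m22 (- A) = - m22 A"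
  "m11 (A - B) = m11 A - m11 B" "m12 (A - B) = m12 A - m12 B"
  "m21 (A - B) = m21 A - m21 B" "m22 (A - B) = m22 A - m22 B"
  "m11 (A * B) = m11 A * m11 B + m12 A * m21 B" "m12 (A * B) = m11 A * m12 B + m12 A * m22 B"
  "m21 (A * B) = m21 A * m11 B + m22 A * m21 B" "m22 (A * B) = m21 A * m12 B + m22 A * m22 B"
  by (simp_all add: zero_m2_def one_m2_def plus_m2_def uminus_m2_def minus_m2_def times_m2_def)

lemma m2_eq_iff: "A = B \<longleftrightarrow> m11 A = m11 B \<and> m12 A = m12 B \<and> m21 A = m21 B \<and> m22 A = m22 B"
  by (auto intro: m2.expand)

definition sc :: "complex \<Rightarrow> m2" where "sc z = M2 z 0 0 z"
definition det2 :: "m2 \<Rightarrow> complex" where "det2 A = m11 A * m22 A - m12 A * m21 A"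
definition tr2 :: "m2 \<Rightarrow> complex" where "tr2 A = m11 A + m22 A"
text \<open>It serves as the inverse on determinant 1. Being linear in the entries, it needs no
  division and preserves subrings, continuity and Laurent families.\<close>

definition adj2 :: "m2 \<Rightarrow> m2" where "adj2 A = M2 (m22 A) (- m12 A) (- m21 A) (m11 A)"

lemma sc_sel [simp]: "m11 (sc z) = z" "m12 (sc z) = 0" "m21 (sc z) = 0" "m22 (sc z) = z"
  by (simp_all add: sc_def)

lemma adj2_sel [simp]:
  "m11 (adj2 A) = m22 A" "m12 (adj2 A) = - m12 A" "m21 (adj2 A) = - m21 A" "m22 (adj2 A) = m11 A"
  by (simp_all add: adj2_def)

lemma sc_1 [simp]: "sc 1 = 1" and sc_0 [simp]: "sc 0 = 0"
  and sc_add: "sc (x + y) = sc x + sc y" and sc_mult: "sc (x * y) = sc x * sc y"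
  and sc_uminus: "sc (- x) = - sc x" and sc_diff: "sc (x - y) = sc x - sc y"
  by (simp_all add: m2_eq_iff)

lemma sc_power: "sc (x ^ n) = sc x ^ n"
  by (induction n) (simp_all add: sc_mult)

lemma sc_commute: "A * sc z = sc z * A"
  by (simp add: m2_eq_iff)

lemma sc_eq_0_iff [simp]: "sc z = 0 \<longleftrightarrow> z = 0"
  by (simp add: m2_eq_iff)

lemma sc_inj [simp]: "sc z = sc w \<longleftrightarrow> z = w"
  by (simp add: m2_eq_iff)

lemma det2_simps [simp]: "det2 1 = 1" "det2 (A * B) = det2 A * det2 B" "det2 (- A) = det2 A"
  "det2 (adj2 A) = det2 A" "det2 (sc z) = z\<^sup>2"
  by (simp_all add: det2_def algebra_simps power2_eq_square)

lemma tr2_simps [simp]: "tr2 1 = 2" "tr2 0 = 0" "tr2 (A + B) = tr2 A + tr2 B" "tr2 (A - B) = tr2 A - tr2 B"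
  "tr2 (- A) = - tr2 A" "tr2 (adj2 A) = tr2 A" "tr2 (sc z) = 2 * z" "tr2 (sc z * A) = z * tr2 A"
  by (simp_all add: tr2_def algebra_simps)

lemma tr2_commute: "tr2 (A * B) = tr2 (B * A)"
  by (simp add: tr2_def)

lemma adj2_mult: "adj2 (A * B) = adj2 B * adj2 A"
  and adj2_1 [simp]: "adj2 1 = 1"
  and adj2_adj2 [simp]: "adj2 (adj2 A) = A"
  and mult_adj2: "A * adj2 A = sc (det2 A)" and adj2_mult_self: "adj2 A * A = sc (det2 A)"
  and add_adj2: "A + adj2 A = sc (tr2 A)"
  by (simp_all add: m2_eq_iff det2_def tr2_def algebra_simps)

lemma cayley_hamilton2: "A * A = sc (tr2 A) * A - sc (det2 A)"
  by (simp add: m2_eq_iff det2_def tr2_def algebra_simps)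

abbreviation pm1 :: "m2 \<Rightarrow> bool" where "pm1 A \<equiv> A = 1 \<or> A = - 1"

lemma pm1_square: "pm1 A \<Longrightarrow> A * A = 1"
  by auto

section \<open>Evaluation of words up to sign\<close>

definition ev :: "('x \<Rightarrow> m2) \<Rightarrow> 'x word \<Rightarrow> m2" where
  "ev M w = prod_list (map (\<lambda>(x, b). if b then M x else adj2 (M x)) w)"

lemma ev_Nil [simp]: "ev M [] = 1"
  and ev_Cons [simp]: "ev M ((x, b) # w) = (if b then M x else adj2 (M x)) * ev M w"
  and ev_append [simp]: "ev M (v @ w) = ev M v * ev M w"
  by (simp_all add: ev_def)

lemma ev_word_power: "ev M (word_power w n) = ev M w ^ n"
  by (induction n) (simp_all add: word_power_def)

lemma ev_cong: "(\<And>x b. (x, b) \<in> set w \<Longrightarrow> M x = M' x) \<Longrightarrow> ev M w = ev M' w"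
  unfolding ev_def by (rule arg_cong[of _ _ prod_list], rule map_cong) auto

lemma det2_ev: "w \<in> lists (X \<times> UNIV) \<Longrightarrow> (\<And>x. x \<in> X \<Longrightarrow> det2 (M x) = 1) \<Longrightarrow> det2 (ev M w) = 1"
  by (induction w rule: lists.induct) auto

lemma ev_continuous:
  assumes "w \<in> lists (X \<times> UNIV)"
    and "\<And>x. x \<in> X \<Longrightarrow> continuous_on S (\<lambda>t. m11 (M t x)) \<and> continuous_on S (\<lambda>t. m12 (M t x)) \<and>
      continuous_on S (\<lambda>t. m21 (M t x)) \<and> continuous_on S (\<lambda>t. m22 (M t x))"
  shows "continuous_on S (\<lambda>t. m11 (ev (M t) w)) \<and> continuous_on S (\<lambda>t. m12 (ev (M t) w)) \<and>
      continuous_on S (\<lambda>t. m21 (ev (M t) w)) \<and> continuous_on S (\<lambda>t. m22 (ev (M t) w))"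
  using assms(1)
proof (induction w rule: lists.induct)
  case (Cons l w)
  obtain x b where l: "l = (x, b)" "x \<in> X" using Cons by auto
  show ?case
    using assms(2)[OF l(2)] Cons.IH unfolding l
    by (cases b) (auto intro!: continuous_intros)
qed auto

text \<open>Von Dyck's argument up to sign: cancelling a letter against its inverse is exact, as
  \<open>adj2\<close> inverts matrices of determinant 1, while deleting a relator can change the
  sign.\<close>

lemma word_eq_ev:
  assumes "word_eq X R v w" and "\<And>x. x \<in> X \<Longrightarrow> det2 (M x) = 1" and "\<And>r. r \<in> R \<Longrightarrow> pm1 (ev M r)"
  shows "ev M v = ev M w \<or> ev M v = - ev M w"
  using assms(1)
proof (induction rule: word_eq.induct)
  case (cancel x u b v)
  then have "det2 (M x) = 1" using assms(2) by blast
  then have "M x * (adj2 (M x) * C) = C" "adj2 (M x) * (M x * C) = C" for C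
    by (metis mult.assoc mult_adj2 adj2_mult_self sc_1 mult_1)+
  then show ?case by (cases b) simp_all
next
  case (relator r u v)
  then show ?case using assms(3)[of r] by auto
qed auto

section \<open>Eigenvalues and matrices of finite order\<close>

lemma root_pair_exists: obtains z :: complex where "z \<noteq> 0" "z + inverse z = s"
proof -
  define r where "r = csqrt (s\<^sup>2 / 4 - 1)"
  define z where "z = s / 2 + r"
  have r: "r * r = s\<^sup>2 / 4 - 1" unfolding r_def using power2_csqrt by (simp add: power2_eq_square)
  have m: "z * (s / 2 - r) = 1"
    unfolding z_def using r by (simp add: algebra_simps power2_eq_square)
  then have "z \<noteq> 0" by auto
  moreover have "inverse z = s / 2 - r" using m by (metis inverse_unique)
  then have "z + inverse z = s" by (simp add: z_def)
  ultimately show thesis by (rule that)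
qed

text \<open>Cayley-Hamilton in factored form: the columns of \<open>A - sc z\<close> are
  eigenvectors for the other eigenvalue \<open>inverse z\<close>.\<close>

lemma eigen_split:
  assumes "det2 A = 1" "z \<noteq> 0" "z + inverse z = tr2 A"
  shows "A * (A - sc z) = sc (inverse z) * (A - sc z)"
proof -
  have "A * (A - sc z) = sc (tr2 A) * A - 1 - sc z * A"
    using cayley_hamilton2[of A] assms(1) by (simp add: right_diff_distrib sc_commute[of A])
  also have "\<dots> = sc (inverse z) * A - 1"
    unfolding assms(3)[symmetric] sc_add by (simp add: distrib_right)
  also have "\<dots> = sc (inverse z) * (A - sc z)"
    using assms(2) by (simp add: right_diff_distrib flip: sc_mult)
  finally show ?thesis .
qed

lemma eigen_power:
  assumes "A * K = sc z * K"
  shows "A ^ n * K = sc (z ^ n) * K"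
proof (induction n)
  case (Suc n)
  have "A ^ Suc n * K = A ^ n * (sc z * K)" using assms by (simp only: power_Suc2 mult.assoc)
  also have "\<dots> = sc z * (A ^ n * K)" by (metis mult.assoc sc_commute)
  also have "\<dots> = sc (z ^ Suc n) * K" by (simp add: Suc sc_mult mult.assoc)
  finally show ?case .
qed simp

text \<open>If \<open>A\<close> is not the scalar \<open>z\<close>, a nonzero column of
  \<open>A - sc z\<close> is an eigenvector for \<open>inverse z\<close>, and
  \<open>A ^ n = 1\<close> makes this eigenvalue an \<open>n\<close>-th root of unity.\<close>

lemma torsion_trace:
  assumes "det2 A = 1" "A ^ n = 1"
  shows "\<exists>z. z ^ n = 1 \<and> tr2 A = z + inverse z"
proof -
  obtain z where z: "z \<noteq> 0" "z + inverse z = tr2 A" using root_pair_exists by blast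
  have "z ^ n = 1"
  proof (cases "A - sc z = 0")
    case True
    then have "sc (z ^ n) = sc 1" using assms(2) by (simp add: sc_power)
    then show ?thesis unfolding sc_inj .
  next
    case False
    have "(A - sc z) = sc (inverse z ^ n) * (A - sc z)"
      using eigen_power[OF eigen_split[OF assms(1) z], of n] assms(2) by simp
    then have "sc (inverse z ^ n - 1) * (A - sc z) = 0"
      by (simp add: sc_diff algebra_simps)
    then have "inverse z ^ n - 1 = 0" using False by (auto simp: m2_eq_iff)
    then show ?thesis by (simp add: power_inverse)
  qed
  then show ?thesis using z(2) by metis
qed

lemma torsion_trace_finite:
  assumes "n > 0"
  shows "finite {tr2 A | A. det2 A = 1 \<and> A ^ n = 1}"
proof (rule finite_subset)
  show "{tr2 A | A. det2 A = 1 \<and> A ^ n = 1} \<subseteq> (\<lambda>z. z + inverse z) ` {z. z ^ n = 1}"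
    using torsion_trace by blast
  show "finite ((\<lambda>z::complex. z + inverse z) ` {z. z ^ n = 1})"
    using assms finite_roots_unity[of n] by auto
qed

text \<open>By Cayley-Hamilton \<open>A - 1\<close> squares to zero, so \<open>A ^ n\<close> is
  \<open>1 + n (A - 1)\<close>, and \<open>n\<close> is invertible in \<complex>.\<close>

lemma unipotent_torsion:
  assumes "det2 A = 1" "tr2 A = 2" "A ^ n = 1" "n > 0"
  shows "A = 1"
proof -
  define N where "N = A - 1"
  have N2: "N * N = 0"
  proof -
    have "sc 2 * A = A + A" by (simp add: m2_eq_iff)
    then show ?thesis unfolding N_def using cayley_hamilton2[of A] assms by (simp add: algebra_simps)
  qed
  have "A ^ k = 1 + sc (of_nat k) * N" for k
  proof (induction k)
    case (Suc k)
    have "A ^ Suc k = (1 + N) * (1 + sc (of_nat k) * N)" using Suc by (simp add: N_def)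
    also have "\<dots> = 1 + sc (of_nat (Suc k)) * N + N * sc (of_nat k) * N"
      by (simp add: distrib_left distrib_right sc_add mult.assoc)
    also have "N * sc (of_nat k) * N = sc (of_nat k) * (N * N)" by (simp only: sc_commute mult.assoc)
    finally show ?case by (simp add: N2)
  qed simp
  then have "sc (of_nat n) * N = 0" using assms(3) by simp
  then have "N = 0" using assms(4) by (auto simp: m2_eq_iff)
  then show ?thesis by (simp add: N_def)
qed

text \<open>Doubling \<open>n\<close> removes the sign. The traces form a connected subset of a
  finite set, hence one point, which is \<open>2\<close> or \<open>- 2\<close> because of the end of
  the path. With finite order this leaves only \<plusminus>1 at the start.\<close>

lemma torsion_rigidity:
  fixes A :: "real \<Rightarrow> m2"
  assumes cont: "continuous_on {0..1} (\<lambda>t. tr2 (A t))"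
    and det: "\<And>t. t \<in> {0..1} \<Longrightarrow> det2 (A t) = 1"
    and tors: "\<And>t. t \<in> {0..1} \<Longrightarrow> pm1 (A t ^ n)" and n: "n > 0"
    and end1: "pm1 (A 1)"
  shows "pm1 (A 0)"
proof -
  have tors2: "A t ^ (2 * n) = 1" if "t \<in> {0..1}" for t
    using tors[OF that] by (auto simp: mult.commute[of 2] power_mult power2_eq_square)
  have "finite ((\<lambda>t. tr2 (A t)) ` {0..1})"
  proof (rule finite_subset)
    show "(\<lambda>t. tr2 (A t)) ` {0..1} \<subseteq> {tr2 A | A. det2 A = 1 \<and> A ^ (2 * n) = 1}"
      using tors2 det by blast
  qed (use n in \<open>simp add: torsion_trace_finite\<close>)
  moreover have "connected ((\<lambda>t. tr2 (A t)) ` {0..1})"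
    using cont by (rule connected_continuous_image) simp
  ultimately have "(\<lambda>t. tr2 (A t)) ` {0..1} = {} \<or> (\<exists>c. (\<lambda>t. tr2 (A t)) ` {0..1} = {c})"
    using connected_finite_iff_sing by blast
  then obtain c where c: "(\<lambda>t. tr2 (A t)) ` {0..1} = {c}" by auto
  have "tr2 (A 0) \<in> (\<lambda>t. tr2 (A t)) ` {0..1}" "tr2 (A 1) \<in> (\<lambda>t. tr2 (A t)) ` {0..1}" by auto
  then have "tr2 (A 0) = tr2 (A 1)" unfolding c by simp
  then have "tr2 (A 0) = 2 \<or> tr2 (A 0) = - 2" using end1 by auto
  then show ?thesis
  proof
    assume "tr2 (A 0) = 2"
    then show ?thesis using unipotent_torsion[of "A 0" "2 * n"] det tors2 n by auto
  next
    assume "tr2 (A 0) = - 2"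
    then have "- A 0 = 1" using unipotent_torsion[of "- A 0" "2 * n"] det tors2 n by auto
    then show ?thesis by (metis minus_minus)
  qed
qed

section \<open>Finite quotients of finitely generated domains\<close>

definition csubring :: "complex set \<Rightarrow> bool" where
  "csubring A \<longleftrightarrow> 1 \<in> A \<and> (\<forall>x\<in>A. \<forall>y\<in>A. x - y \<in> A \<and> x * y \<in> A)"

definition polys_over :: "complex set \<Rightarrow> complex poly set" where
  "polys_over A = {h. \<forall>i. coeff h i \<in> A}"

definition adjoin :: "complex set \<Rightarrow> complex \<Rightarrow> complex set" where
  "adjoin A b = (\<lambda>h. poly h b) ` polys_over A"

text \<open>No quotient ring is formed: finite index is recorded by a finite set \<open>T\<close>
  that meets every residue class.\<close>

definition fin_ideal :: "complex set \<Rightarrow> complex set \<Rightarrow> bool" where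
  "fin_ideal A I \<longleftrightarrow> I \<subseteq> A \<and> 0 \<in> I \<and> (\<forall>x\<in>I. \<forall>y\<in>I. x - y \<in> I) \<and>
     (\<forall>a\<in>A. \<forall>x\<in>I. a * x \<in> I) \<and> 1 \<notin> I \<and>
     (\<exists>T. finite T \<and> T \<subseteq> A \<and> (\<forall>a\<in>A. \<exists>t\<in>T. a - t \<in> I))"

text \<open>Adjoining one element preserves this property, so it holds for some ring containing any given
  finite set. The unit \<open>u\<close> is what the induction needs: a leading coefficient must become invertible
  modulo the ideal.\<close>

definition finitely_residual :: "complex set \<Rightarrow> bool" where
  "finitely_residual A \<longleftrightarrow> csubring A \<and>
     (\<forall>t\<in>A - {0}. \<exists>n. \<forall>p>n. prime p \<longrightarrow>
        (\<exists>I. fin_ideal A I \<and> of_nat p \<in> I \<and> (\<exists>u\<in>A. t * u - 1 \<in> I)))"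

lemma csubring_props:
  assumes "csubring A"
  shows csubring_1: "1 \<in> A" and csubring_0: "0 \<in> A"
    and csubring_diff: "x \<in> A \<Longrightarrow> y \<in> A \<Longrightarrow> x - y \<in> A"
    and csubring_mult: "x \<in> A \<Longrightarrow> y \<in> A \<Longrightarrow> x * y \<in> A"
    and csubring_uminus: "x \<in> A \<Longrightarrow> - x \<in> A"
    and csubring_add: "x \<in> A \<Longrightarrow> y \<in> A \<Longrightarrow> x + y \<in> A"
proof -
  show one: "1 \<in> A" using assms by (simp add: csubring_def)
  show d: "x - y \<in> A" and "x * y \<in> A" if "x \<in> A" "y \<in> A" for x y
    using assms that by (auto simp: csubring_def)
  have z: "0 \<in> A" using d[OF one one] by simp
  then show "0 \<in> A" .
  show u: "- x \<in> A" if "x \<in> A" for x using d[OF z that] by simp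
  show "x + y \<in> A" if "x \<in> A" "y \<in> A" for x y using d[OF that(1) u[OF that(2)]] by simp
qed

lemma csubring_sum: "csubring A \<Longrightarrow> (\<And>i. i \<in> S \<Longrightarrow> f i \<in> A) \<Longrightarrow> sum f S \<in> A"
  by (induction S rule: infinite_finite_induct) (auto simp: csubring_0 csubring_add)

lemma csubring_power: "csubring A \<Longrightarrow> x \<in> A \<Longrightarrow> x ^ n \<in> A"
  by (induction n) (auto simp: csubring_1 csubring_mult)

lemma polys_over_closed:
  assumes "csubring A"
  shows "0 \<in> polys_over A" "1 \<in> polys_over A"
    "g \<in> polys_over A \<Longrightarrow> h \<in> polys_over A \<Longrightarrow> g - h \<in> polys_over A"
    "g \<in> polys_over A \<Longrightarrow> h \<in> polys_over A \<Longrightarrow> g + h \<in> polys_over A"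
    "g \<in> polys_over A \<Longrightarrow> - g \<in> polys_over A"
    "g \<in> polys_over A \<Longrightarrow> h \<in> polys_over A \<Longrightarrow> g * h \<in> polys_over A"
    "c \<in> A \<Longrightarrow> monom c n \<in> polys_over A" "c \<in> A \<Longrightarrow> [:c:] \<in> polys_over A"
    "c \<in> A \<Longrightarrow> g \<in> polys_over A \<Longrightarrow> smult c g \<in> polys_over A"
  using assms
  by (auto simp: polys_over_def csubring_0 csubring_1 csubring_diff csubring_add csubring_mult
      csubring_uminus coeff_mult csubring_sum coeff_pCons split: nat.split)

lemma csubring_adjoin: "csubring A \<Longrightarrow> csubring (adjoin A b)"
  unfolding adjoin_def
proof (subst csubring_def, intro conjI ballI)
  assume A: "csubring A"
  show "1 \<in> (\<lambda>h. poly h b) ` polys_over A" using polys_over_closed(2)[OF A] by force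
  fix x y assume "x \<in> (\<lambda>h. poly h b) ` polys_over A" "y \<in> (\<lambda>h. poly h b) ` polys_over A"
  then obtain g h where "g \<in> polys_over A" "h \<in> polys_over A" "x = poly g b" "y = poly h b" by auto
  then show "x - y \<in> (\<lambda>h. poly h b) ` polys_over A" "x * y \<in> (\<lambda>h. poly h b) ` polys_over A"
    using polys_over_closed(3,6)[OF A, of g h] by (metis image_eqI poly_diff poly_mult)+
qed

lemma subset_adjoin: "csubring A \<Longrightarrow> A \<subseteq> adjoin A b"
  unfolding adjoin_def by (auto intro!: image_eqI[of _ _ "[:_:]"] simp: polys_over_closed)

lemma adjoin_generator: "csubring A \<Longrightarrow> b \<in> adjoin A b"
  unfolding adjoin_def
  by (rule image_eqI[of _ _ "monom 1 1"]) (simp_all add: polys_over_closed csubring_1 poly_monom)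

section \<open>Division by a polynomial over a ring and over its quotients\<close>

lemma coeff_monom_mult_lead:
  fixes f :: "complex poly"
  assumes "degree f \<le> n" "i \<ge> n"
  shows "coeff (monom c (n - degree f) * f) i = (if i = n then c * lead_coeff f else 0)"
proof (cases "i = n")
  case False
  then have "coeff f (i - (n - degree f)) = 0" using assms by (intro coeff_eq_0) auto
  then show ?thesis using False by (simp add: coeff_monom_mult)
qed (use assms in \<open>simp add: coeff_monom_mult\<close>)

text \<open>\<open>A\<close> need not be a field, so each division step multiplies by the leading
  coefficient of \<open>f\<close> instead of dividing by it; \<open>N\<close> counts the steps.
  Bounding the remainder through its coefficients also covers constant \<open>f\<close>, where it
  has to vanish.\<close>

lemma pseudo_division:
  assumes A: "csubring A" and f: "f \<in> polys_over A" "f \<noteq> 0"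
  shows "h \<in> polys_over A \<Longrightarrow> \<exists>N. \<exists>q\<in>polys_over A. \<exists>r\<in>polys_over A.
    smult (lead_coeff f ^ N) h = q * f + r \<and> (\<forall>i\<ge>degree f. coeff r i = 0)"
proof -
  have s: "lead_coeff f \<in> A" using f by (simp add: polys_over_def)
  have "\<exists>N. \<exists>q\<in>polys_over A. \<exists>r\<in>polys_over A.
      smult (lead_coeff f ^ N) h = q * f + r \<and> (\<forall>i\<ge>degree f. coeff r i = 0)"
    if "h \<in> polys_over A" "\<forall>i\<ge>n. coeff h i = 0" for n h
    using that
  proof (induction n arbitrary: h)
    case 0
    then have "h = 0" by (simp add: poly_eq_iff)
    then show ?case using polys_over_closed(1)[OF A] by force
  next
    case (Suc n)
    show ?case
    proof (cases "degree f \<le> n")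
      case False
      show ?thesis
      proof (intro exI[of _ 0] bexI conjI)
        show "smult (lead_coeff f ^ 0) h = 0 * f + h" by simp
      qed (use Suc.prems False in \<open>auto simp: polys_over_closed[OF A]\<close>)
    next
      case True
      define m where "m = monom (coeff h n) (n - degree f)"
      have m: "m \<in> polys_over A"
        using Suc.prems(1) polys_over_closed(7)[OF A] by (simp add: m_def polys_over_def)
      define h2 where "h2 = smult (lead_coeff f) h - m * f"
      have "h2 \<in> polys_over A"
        unfolding h2_def by (intro polys_over_closed[OF A] Suc.prems f m s)
      moreover have "\<forall>i\<ge>n. coeff h2 i = 0"
        using Suc.prems(2) coeff_monom_mult_lead[OF True, of _ "coeff h n"] by (auto simp: h2_def m_def)
      ultimately obtain N q r where q: "q \<in> polys_over A" and r: "r \<in> polys_over A"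
        and eq: "smult (lead_coeff f ^ N) h2 = q * f + r" "\<forall>i\<ge>degree f. coeff r i = 0"
        using Suc.IH by blast
      have "smult (lead_coeff f ^ Suc N) h = smult (lead_coeff f ^ N) h2 + smult (lead_coeff f ^ N) m * f"
        by (simp add: h2_def smult_diff_right mult.commute)
      also have "\<dots> = (q + smult (lead_coeff f ^ N) m) * f + r"
        unfolding eq by (simp add: algebra_simps)
      finally have "smult (lead_coeff f ^ Suc N) h = (q + smult (lead_coeff f ^ N) m) * f + r" .
      moreover have "q + smult (lead_coeff f ^ N) m \<in> polys_over A"
        by (intro polys_over_closed[OF A] q m csubring_power[OF A] s)
      ultimately show ?thesis using r eq(2) by blast
    qed
  qed
  from this[of h "Suc (degree h)"] show "h \<in> polys_over A \<Longrightarrow> ?thesis"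
    by (simp add: coeff_eq_0)
qed

lemma fin_ideal_props:
  assumes "fin_ideal A I"
  shows "x \<in> I \<Longrightarrow> x \<in> A" "0 \<in> I" "x \<in> I \<Longrightarrow> y \<in> I \<Longrightarrow> x - y \<in> I"
    "a \<in> A \<Longrightarrow> x \<in> I \<Longrightarrow> a * x \<in> I" "1 \<notin> I"
    "x \<in> I \<Longrightarrow> - x \<in> I" "x \<in> I \<Longrightarrow> y \<in> I \<Longrightarrow> x + y \<in> I"
proof -
  show i: "x \<in> I \<Longrightarrow> x \<in> A" and z: "0 \<in> I" and "1 \<notin> I" and "a \<in> A \<Longrightarrow> x \<in> I \<Longrightarrow> a * x \<in> I" for x a
    using assms by (auto simp: fin_ideal_def)
  show d: "x - y \<in> I" if "x \<in> I" "y \<in> I" for x y using assms that by (auto simp: fin_ideal_def)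
  show u: "- x \<in> I" if "x \<in> I" for x using d[OF z that] by simp
  show "x + y \<in> I" if "x \<in> I" "y \<in> I" for x y using d[OF that(1) u[OF that(2)]] by simp
qed

lemma fin_ideal_sum: "fin_ideal A I \<Longrightarrow> (\<And>i. i \<in> S \<Longrightarrow> f i \<in> I) \<Longrightarrow> sum f S \<in> I"
  by (induction S rule: infinite_finite_induct) (auto simp: fin_ideal_props)

lemma fin_ideal_unit_cancel:
  assumes A: "csubring A" "fin_ideal A I" and "s \<in> A" "v \<in> A" "s * v - 1 \<in> I" "x \<in> A" "s * x \<in> I"
  shows "x \<in> I"
proof -
  have "v * (s * x) - x * (s * v - 1) \<in> I"
    using assms(4-7) by (intro fin_ideal_props(3)[OF A(2)]) (auto intro: fin_ideal_props(4)[OF A(2)])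
  then show ?thesis by (simp add: algebra_simps)
qed

text \<open>Modulo \<open>I\<close> the leading coefficient \<open>s\<close> of \<open>f\<close> is
  a unit. If some coefficient of \<open>u\<close> survived modulo \<open>I\<close>, the highest such
  would give \<open>u * f\<close> a nonzero coefficient in positive degree, although it is congruent
  to the constant \<open>s ^ N\<close>. So \<open>u\<close> vanishes, \<open>s ^ N\<close> lies in
  \<open>I\<close>, and then so does 1.\<close>

lemma no_unit_remainder:
  assumes A: "csubring A" and I: "fin_ideal A I"
    and f: "f \<in> polys_over A" "degree f \<ge> 1" and v: "v \<in> A" "lead_coeff f * v - 1 \<in> I"
    and u: "u \<in> polys_over A" and eq: "[:lead_coeff f ^ N:] - u * f \<in> polys_over I"
  shows False
proof -
  let ?s = "lead_coeff f"
  have s: "?s \<in> A" using f by (simp add: polys_over_def)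
  have uA: "coeff u i \<in> A" and fA: "coeff f i \<in> A" for i using u f by (auto simp: polys_over_def)
  have uI: "\<forall>i. coeff u i \<in> I"
  proof (rule ccontr)
    assume "\<not> ?thesis"
    then have ne: "{i. coeff u i \<notin> I} \<noteq> {}" by auto
    have "{i. coeff u i \<notin> I} \<subseteq> {..degree u}"
      using fin_ideal_props(2)[OF I] by (metis (mono_tags, lifting) atMost_iff le_degree mem_Collect_eq subsetI)
    then have fin: "finite {i. coeff u i \<notin> I}" using finite_subset by blast
    define m where "m = Max {i. coeff u i \<notin> I}"
    have m: "coeff u m \<notin> I" and above: "\<And>i. i > m \<Longrightarrow> coeff u i \<in> I"
      using Max_in[OF fin ne] Max_ge[OF fin] unfolding m_def by (auto simp: not_less[symmetric])
    let ?n = "m + degree f"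
    have "coeff ([:?s ^ N:] - u * f) ?n = - coeff (u * f) ?n"
      using f(2) by (simp add: coeff_pCons split: nat.split)
    then have "- coeff (u * f) ?n \<in> I" using eq by (metis (mono_tags, lifting) mem_Collect_eq polys_over_def)
    then have c: "coeff (u * f) ?n \<in> I" using fin_ideal_props(6)[OF I] by fastforce
    have "coeff (u * f) ?n = coeff u m * ?s + (\<Sum>i\<in>{..?n} - {m}. coeff u i * coeff f (?n - i))"
      unfolding coeff_mult by (subst sum.remove[of _ m]) auto
    moreover have "(\<Sum>i\<in>{..?n} - {m}. coeff u i * coeff f (?n - i)) \<in> I"
    proof (rule fin_ideal_sum[OF I])
      fix i assume i: "i \<in> {..?n} - {m}"
      show "coeff u i * coeff f (?n - i) \<in> I"
      proof (cases "i > m")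
        case True
        then show ?thesis using fin_ideal_props(4)[OF I fA[of "?n - i"] above] by (simp add: mult.commute)
      next
        case False
        then have "coeff f (?n - i) = 0" using i by (intro coeff_eq_0) auto
        then show ?thesis using fin_ideal_props(2)[OF I] by simp
      qed
    qed
    ultimately have "?s * coeff u m \<in> I"
      using fin_ideal_props(3)[OF I c, of "\<Sum>i\<in>{..?n} - {m}. coeff u i * coeff f (?n - i)"]
      by (simp add: mult.commute[of "lead_coeff f"])
    then show False using fin_ideal_unit_cancel[OF A I s v uA] m by blast
  qed
  have "coeff (u * f) 0 \<in> I"
    using fin_ideal_props(4)[OF I fA[of 0]] uI by (simp add: coeff_mult mult.commute[of "coeff u 0"])
  moreover have "?s ^ N - coeff (u * f) 0 \<in> I"
    using eq by (auto simp: polys_over_def dest: spec[of _ 0])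
  ultimately have "?s ^ N \<in> I" using fin_ideal_props(7)[OF I] by fastforce
  then have "1 \<in> I"
  proof (induction N)
    case (Suc N)
    then show ?case using fin_ideal_unit_cancel[OF A I s v csubring_power[OF A s]] by simp
  qed simp
  then show False using fin_ideal_props(5)[OF I] by simp
qed

text \<open>Modulo \<open>I\<close> the leading coefficient of \<open>f\<close> has the inverse
  \<open>v\<close>, so ordinary division with remainder works there. The remainders of degree below
  \<open>degree f\<close> will bound the index of the new ideal.\<close>

lemma reduction_mod_ideal:
  assumes A: "csubring A" and I: "fin_ideal A I"
    and f: "f \<in> polys_over A" and v: "v \<in> A" "lead_coeff f * v - 1 \<in> I"
    and h: "h \<in> polys_over A"
  shows "\<exists>u\<in>polys_over A. \<forall>i\<ge>degree f. coeff (h - u * f) i \<in> I"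
proof -
  have "\<exists>u\<in>polys_over A. \<forall>i\<ge>degree f. coeff (h - u * f) i \<in> I"
    if "h \<in> polys_over A" "\<forall>i\<ge>n. coeff h i \<in> I" for n h
    using that
  proof (induction n arbitrary: h)
    case 0
    then show ?case using polys_over_closed(1)[OF A] by (intro bexI[of _ 0]) auto
  next
    case (Suc n)
    show ?case
    proof (cases "degree f \<le> n")
      case False
      then show ?thesis using Suc.prems polys_over_closed(1)[OF A] by (intro bexI[of _ 0]) auto
    next
      case True
      have hn: "coeff h n \<in> A" using Suc.prems(1) by (simp add: polys_over_def)
      define m where "m = monom (v * coeff h n) (n - degree f)"
      have m: "m \<in> polys_over A"
        unfolding m_def by (intro polys_over_closed[OF A] csubring_mult[OF A] v hn)
      have "coeff (h - m * f) i \<in> I" if "i \<ge> n" for i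
      proof (cases "i = n")
        case True
        have "coeff h n * - (lead_coeff f * v - 1) \<in> I"
          by (intro fin_ideal_props(4)[OF I] hn fin_ideal_props(6)[OF I] v)
        then show ?thesis using True coeff_monom_mult_lead[OF \<open>degree f \<le> n\<close> that, of "v * coeff h n"]
          by (simp add: m_def algebra_simps)
      next
        case False
        then show ?thesis using Suc.prems(2) that coeff_monom_mult_lead[OF True that, of "v * coeff h n"]
          by (simp add: m_def)
      qed
      moreover have "h - m * f \<in> polys_over A" by (intro polys_over_closed[OF A] Suc.prems m f)
      ultimately obtain u where u: "u \<in> polys_over A" "\<forall>i\<ge>degree f. coeff (h - m * f - u * f) i \<in> I"
        using Suc.IH by blast
      have "h - m * f - u * f = h - (m + u) * f" by (simp add: algebra_simps)
      then show ?thesis using u polys_over_closed(4)[OF A m u(1)] by metis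
    qed
  qed
  from this[of h "Suc (degree h)"] show ?thesis
    using h fin_ideal_props(2)[OF I] by (simp add: coeff_eq_0)
qed

text \<open>\<open>J\<close> is the image in \<open>A[b]\<close> of the ideal \<open>(I, f)\<close>
  of \<open>A[X]\<close>. The hypothesis \<open>ker\<close> says that, up to powers of the leading
  coefficient, only multiples of \<open>f\<close> vanish at \<open>b\<close>. It holds for an
  annihilator \<open>f\<close> of least degree, and for every \<open>f\<close> if \<open>b\<close>
  is transcendental.\<close>

lemma fin_ideal_adjoin:
  assumes A: "csubring A" and I: "fin_ideal A I"
    and f: "f \<in> polys_over A" "degree f \<ge> 1" and v: "v \<in> A" "lead_coeff f * v - 1 \<in> I"
    and ker: "\<And>h. h \<in> polys_over A \<Longrightarrow> poly h b = 0 \<Longrightarrow>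
      \<exists>N. \<exists>q\<in>polys_over A. smult (lead_coeff f ^ N) h = q * f"
  shows "\<exists>J. fin_ideal (adjoin A b) J \<and> I \<subseteq> J \<and> poly f b \<in> J"
proof -
  have IA: "I \<subseteq> A" using fin_ideal_props(1)[OF I] by blast
  have PI: "g - h \<in> polys_over I" if "g \<in> polys_over I" "h \<in> polys_over I" for g h
    using that fin_ideal_props(3)[OF I] by (simp add: polys_over_def)
  have PM: "g * h \<in> polys_over I" if "g \<in> polys_over A" "h \<in> polys_over I" for g h
    using that by (auto simp: polys_over_def coeff_mult intro!: fin_ideal_sum[OF I] fin_ideal_props(4)[OF I])
  have s: "lead_coeff f \<in> A" using f by (simp add: polys_over_def)
  define K where "K = {h \<in> polys_over A. \<exists>u\<in>polys_over A. h - u * f \<in> polys_over I}"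
  have KA: "K \<subseteq> polys_over A" by (auto simp: K_def)
  have Kd: "g - h \<in> K" if "g \<in> K" "h \<in> K" for g h
  proof -
    from that have "\<exists>u\<in>polys_over A. g - u * f \<in> polys_over I" "\<exists>w\<in>polys_over A. h - w * f \<in> polys_over I"
      by (simp_all add: K_def)
    then obtain u w where *: "u \<in> polys_over A" "w \<in> polys_over A"
      "g - u * f \<in> polys_over I" "h - w * f \<in> polys_over I" by blast
    have "(g - u * f) - (h - w * f) = (g - h) - (u - w) * f" by (simp add: algebra_simps)
    then have "(g - h) - (u - w) * f \<in> polys_over I" using PI[OF *(3,4)] by metis
    then show ?thesis using that * polys_over_closed[OF A] by (auto simp: K_def)
  qed
  have Km: "g * h \<in> K" if "g \<in> polys_over A" "h \<in> K" for g h
  proof -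
    from that have "\<exists>u\<in>polys_over A. h - u * f \<in> polys_over I" by (simp add: K_def)
    then obtain u where *: "u \<in> polys_over A" "h - u * f \<in> polys_over I" by blast
    have "g * (h - u * f) = g * h - (g * u) * f" by (simp add: algebra_simps)
    then have "g * h - (g * u) * f \<in> polys_over I" using PM[OF that(1) *(2)] by metis
    then show ?thesis using that * polys_over_closed[OF A] by (auto simp: K_def)
  qed
  have IK: "polys_over I \<subseteq> K"
  proof
    fix h assume h: "h \<in> polys_over I"
    then have "h \<in> polys_over A" using IA by (auto simp: polys_over_def)
    then show "h \<in> K" using h polys_over_closed(1)[OF A] unfolding K_def by force
  qed
  have fK: "f \<in> K"
  proof -
    have "f - 1 * f \<in> polys_over I" using fin_ideal_props(2)[OF I] by (simp add: polys_over_def)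
    then show ?thesis using f polys_over_closed(2)[OF A] unfolding K_def by blast
  qed
  define J where "J = (\<lambda>h. poly h b) ` K"
  \<comment> \<open>If \<open>h\<close> in \<open>(I, f)\<close> takes the value 1 at
    \<open>b\<close>, then \<open>ker\<close> applied to \<open>1 - h\<close> puts a power of the
    leading coefficient into \<open>(I, f)\<close>, which \<open>no_unit_remainder\<close>
    forbids.\<close>
  have "1 \<notin> J"
  proof
    assume "1 \<in> J"
    then obtain h u where h: "h \<in> polys_over A" "poly h b = 1"
      and u: "u \<in> polys_over A" "h - u * f \<in> polys_over I" by (auto simp: J_def K_def)
    have "1 - h \<in> polys_over A" "poly (1 - h) b = 0" using h polys_over_closed[OF A] by auto
    then obtain N q where q: "q \<in> polys_over A" "smult (lead_coeff f ^ N) (1 - h) = q * f"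
      using ker by blast
    let ?S = "[:lead_coeff f ^ N:]"
    have S: "?S \<in> polys_over A" by (intro polys_over_closed[OF A] csubring_power[OF A] s)
    have "q * f = ?S - ?S * h" using q(2) by (simp add: smult_diff_right)
    then have "?S - (q + ?S * u) * f = ?S * h - ?S * u * f" by (simp add: distrib_right)
    then have "?S - (q + ?S * u) * f = ?S * (h - u * f)" by (simp only: right_diff_distrib mult.assoc)
    moreover have "?S * (h - u * f) \<in> polys_over I" by (rule PM[OF S u(2)])
    ultimately show False
      using no_unit_remainder[OF A I f v, of "q + ?S * u" N] polys_over_closed[OF A] q u S by metis
  qed
  moreover obtain T where T: "finite T" "T \<subseteq> A" "\<And>a. a \<in> A \<Longrightarrow> \<exists>t\<in>T. a - t \<in> I"
    using I unfolding fin_ideal_def by blast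
  \<comment> \<open>Representatives are the finitely many remainders whose coefficients are taken
    from \<open>T\<close>.\<close>
  define rep where "rep \<tau> = (\<Sum>i<degree f. monom (\<tau> i) i)" for \<tau> :: "nat \<Rightarrow> complex"
  define TB where "TB = (\<lambda>\<tau>. poly (rep \<tau>) b) ` (PiE {..<degree f} (\<lambda>_. T))"
  have coeff_rep: "coeff (rep \<tau>) i = (if i < degree f then \<tau> i else 0)" for \<tau> i
  proof -
    have "coeff (rep \<tau>) i = (\<Sum>j<degree f. if j = i then \<tau> j else 0)"
      by (simp add: rep_def coeff_sum)
    then show ?thesis by simp
  qed
  have rep_in: "rep \<tau> \<in> polys_over A" if "\<tau> \<in> PiE {..<degree f} (\<lambda>_. T)" for \<tau>
    using that T(2) csubring_0[OF A] by (auto simp: polys_over_def coeff_rep PiE_def)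
  have "\<exists>t\<in>TB. a - t \<in> J" if "a \<in> adjoin A b" for a
  proof -
    from that have "\<exists>h\<in>polys_over A. a = poly h b" by (simp add: adjoin_def image_iff)
    then obtain h where h: "h \<in> polys_over A" "a = poly h b" by blast
    obtain u where u: "u \<in> polys_over A" "\<And>i. i \<ge> degree f \<Longrightarrow> coeff (h - u * f) i \<in> I"
      using reduction_mod_ideal[OF A I f(1) v h(1)] by blast
    have "h - u * f \<in> polys_over A" by (intro polys_over_closed[OF A] h u f)
    then have "\<forall>i. \<exists>t\<in>T. coeff (h - u * f) i - t \<in> I" using T(3) by (simp add: polys_over_def)
    then obtain \<tau> where \<tau>: "\<And>i. \<tau> i \<in> T" "\<And>i. coeff (h - u * f) i - \<tau> i \<in> I" by metis
    define \<tau>' where "\<tau>' = restrict \<tau> {..<degree f}"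
    have \<tau>': "\<tau>' \<in> PiE {..<degree f} (\<lambda>_. T)" using \<tau> by (auto simp: \<tau>'_def)
    have "coeff (h - u * f - rep \<tau>') i \<in> I" for i
      using \<tau>(2)[of i] u(2)[of i] coeff_rep[of \<tau>' i] by (cases "i < degree f") (auto simp: \<tau>'_def)
    then have "h - u * f - rep \<tau>' \<in> polys_over I" by (simp add: polys_over_def)
    moreover have "h - u * f - rep \<tau>' = (h - rep \<tau>') - u * f" by simp
    ultimately have "h - rep \<tau>' \<in> K"
      using u(1) h(1) rep_in[OF \<tau>'] polys_over_closed(3)[OF A] unfolding K_def by auto
    then have "a - poly (rep \<tau>') b \<in> J" unfolding J_def h(2) by (auto intro!: image_eqI[of _ _ "h - rep \<tau>'"])
    then show ?thesis using \<tau>' unfolding TB_def by blast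
  qed
  moreover have "finite TB" unfolding TB_def by (intro finite_imageI finite_PiE) (use T in auto)
  moreover have "TB \<subseteq> adjoin A b" unfolding TB_def adjoin_def using rep_in by blast
  moreover have "J \<subseteq> adjoin A b" using KA by (auto simp: J_def adjoin_def)
  moreover have "0 \<in> J"
    unfolding J_def using Kd[OF fK fK] by (intro image_eqI[of _ _ 0]) auto
  moreover have "x - y \<in> J" if "x \<in> J" "y \<in> J" for x y
    using that Kd unfolding J_def by (auto intro!: image_eqI[of _ _ "_ - _"] simp flip: poly_diff)
  moreover have "a * x \<in> J" if "a \<in> adjoin A b" "x \<in> J" for a x
    using that Km unfolding J_def adjoin_def by (auto intro!: image_eqI[of _ _ "_ * _"] simp flip: poly_mult)
  ultimately have "fin_ideal (adjoin A b) J" unfolding fin_ideal_def by blast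
  moreover have "I \<subseteq> J"
  proof
    fix x assume "x \<in> I"
    then have "[:x:] \<in> polys_over I"
      using fin_ideal_props(2)[OF I] by (auto simp: polys_over_def coeff_pCons split: nat.split)
    then show "x \<in> J" using IK unfolding J_def by (auto intro!: image_eqI[of _ _ "[:x:]"])
  qed
  moreover have "poly f b \<in> J" using fK unfolding J_def by blast
  ultimately show ?thesis by blast
qed

section \<open>The integers, and adjoining an algebraic or a transcendental element\<close>

lemma finitely_residual_Ints: "finitely_residual \<int>"
proof -
  have A: "csubring \<int>" by (simp add: csubring_def)
  have "\<exists>I. fin_ideal \<int> I \<and> of_nat p \<in> I \<and> (\<exists>u\<in>\<int>. t * u - 1 \<in> I)"
    if t: "t = of_int z" "z \<noteq> 0" and p: "p > nat \<bar>z\<bar>" "prime p" for t :: complex and z p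
  proof -
    define I where "I = range (\<lambda>k::int. of_int (int p * k) :: complex)"
    have "1 \<notin> I"
    proof
      assume "1 \<in> I"
      then obtain k where "of_int 1 = (of_int (int p * k) :: complex)" by (auto simp: I_def)
      then have "1 = int p * k" by (simp only: of_int_eq_iff)
      then have "int p dvd 1" by (metis dvd_triv_left)
      then show False using p(2) by simp
    qed
    moreover have "\<exists>t\<in>of_int ` {0..<int p}. a - t \<in> I" if "a \<in> \<int>" for a :: complex
    proof -
      from that obtain y where y: "a = of_int y" by (rule Ints_cases)
      have "a - of_int (y mod int p) = of_int (int p * (y div int p))"
        unfolding y of_int_diff[symmetric] by (metis minus_mod_eq_mult_div)
      then show ?thesis using p(2) prime_gt_0_nat unfolding I_def by (intro bexI[of _ "of_int (y mod int p)"]) auto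
    qed
    moreover have "x - y \<in> I" if xy: "x \<in> I" "y \<in> I" for x y
    proof -
      obtain k l where "x = of_int (int p * k)" "y = of_int (int p * l)" using xy by (auto simp: I_def)
      then have "x - y = of_int (int p * (k - l))" by (simp add: algebra_simps)
      then show ?thesis unfolding I_def by blast
    qed
    moreover have "a * x \<in> I" if ax: "a \<in> \<int>" "x \<in> I" for a x
    proof -
      from ax(1) obtain k where "a = of_int k" by (rule Ints_cases)
      moreover obtain l where "x = of_int (int p * l)" using ax(2) by (auto simp: I_def)
      ultimately have "a * x = of_int (int p * (k * l))" by (simp add: algebra_simps)
      then show ?thesis unfolding I_def by blast
    qed
    moreover have "0 \<in> I" unfolding I_def by (rule range_eqI[of _ _ 0]) simp
    moreover have "I \<subseteq> \<int>" by (auto simp: I_def)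
    ultimately have "fin_ideal \<int> I"
      unfolding fin_ideal_def by (intro conjI exI[of _ "of_int ` {0..<int p}"]) auto
    moreover have "of_nat p \<in> I" unfolding I_def by (rule range_eqI[of _ _ 1]) simp
    moreover have "\<exists>u\<in>\<int>. t * u - 1 \<in> I"
    proof -
      have "\<not> int p dvd z" using p(1) t(2) zdvd_imp_le[of "int p" "\<bar>z\<bar>"] by auto
      then have "coprime (int p) z" using p(2) by (simp add: prime_imp_coprime)
      then have "gcd z (int p) = 1" by (simp add: coprime_iff_gcd_eq_1 gcd.commute)
      then obtain u v where "u * z + v * int p = 1" using bezout_int by metis
      then have "z * u - 1 = int p * (- v)" by (simp add: algebra_simps)
      then have "t * of_int u - 1 = of_int (int p * (- v))" unfolding t(1) by (metis of_int_1 of_int_diff of_int_mult)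
      then show ?thesis unfolding I_def by (intro bexI[of _ "of_int u"] image_eqI[of _ _ "- v"]) simp_all
    qed
    ultimately show ?thesis by blast
  qed
  then show ?thesis
    unfolding finitely_residual_def using A by (metis DiffE Ints_cases insertI1 of_int_0)
qed

text \<open>This reduces inverting \<open>t\<close> modulo an ideal to inverting an element of
  \<open>A\<close>. Among the polynomials whose value at \<open>b\<close> is a nonzero multiple of
  \<open>t\<close>, let \<open>r\<close> have least degree. Division of \<open>r\<close> by
  \<open>f\<close> shows that \<open>r\<close> has smaller degree than \<open>f\<close>. Division of
  \<open>f\<close> by a nonconstant \<open>r\<close> would leave a smaller such polynomial, or else
  a nonzero polynomial of degree below that of \<open>f\<close> vanishing at
  \<open>b\<close>.\<close>

lemma algebraic_multiple:
  assumes A: "csubring A" and f: "f \<in> polys_over A" "f \<noteq> 0" "poly f b = 0"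
    and min: "\<And>g. g \<in> polys_over A \<Longrightarrow> g \<noteq> 0 \<Longrightarrow> poly g b = 0 \<Longrightarrow> degree f \<le> degree g"
    and t: "t \<in> adjoin A b" "t \<noteq> 0"
  shows "\<exists>a\<in>A. \<exists>w\<in>adjoin A b. a \<noteq> 0 \<and> t * w = a"
proof -
  note B = csubring_adjoin[OF A, of b]
  define P where "P r \<longleftrightarrow> r \<in> polys_over A \<and> poly r b \<noteq> 0 \<and> (\<exists>w\<in>adjoin A b. t * w = poly r b)" for r
  obtain g where "g \<in> polys_over A" "t = poly g b" using t by (auto simp: adjoin_def)
  then have "P g" using t csubring_1[OF B] unfolding P_def by (auto intro!: bexI[of _ 1])
  then have "\<exists>r. P r" by blast
  then obtain r where r: "P r" and rmin: "\<And>r'. P r' \<Longrightarrow> degree r \<le> degree r'"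
    using ex_has_least_nat[of P _ degree] by blast
  obtain w where w: "w \<in> adjoin A b" "t * w = poly r b" using r unfolding P_def by blast
  have r0: "r \<in> polys_over A" "r \<noteq> 0" using r unfolding P_def by auto
  have "degree r = 0"
  proof (rule ccontr)
    assume dr: "degree r \<noteq> 0"
    obtain N q r' where q: "q \<in> polys_over A" and r': "r' \<in> polys_over A"
      and eq: "smult (lead_coeff r ^ N) f = q * r + r'" and small: "\<forall>i\<ge>degree r. coeff r' i = 0"
      using pseudo_division[OF A r0 f(1)] by blast
    have deg: "r' = 0 \<or> degree r' < degree r"
      using small by (metis leading_coeff_0_iff not_le)
    have ev: "poly r' b = t * (w * - poly q b)"
    proof -
      have "poly q b * poly r b + poly r' b = 0"
        using arg_cong[OF eq, of "\<lambda>h. poly h b"] f(3) by simp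
      then have "poly r' b = - (poly q b * (t * w))" unfolding w(2) by (simp add: add_eq_0_iff)
      then show ?thesis by (simp add: algebra_simps)
    qed
    have "w * - poly q b \<in> adjoin A b"
      using q w by (intro csubring_mult[OF B] csubring_uminus[OF B]) (auto simp: adjoin_def)
    then have "poly r' b = 0"
      using rmin[of r'] deg ev r' unfolding P_def by (metis leD poly_0)
    then have qb: "poly q b = 0" using ev t(2) w(2) r unfolding P_def by auto
    show False
    proof (cases "r' = 0")
      case True
      have sf: "smult (lead_coeff r ^ N) f \<noteq> 0" using f(2) r0(2) by simp
      then have "q \<noteq> 0" using eq True by auto
      then have "degree f = degree q + degree r"
        using eq True r0(2) degree_mult_eq[of q r] by (metis add.right_neutral degree_smult_eq sf smult_eq_0_iff)
      then show False using min[OF q \<open>q \<noteq> 0\<close> qb] dr by simp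
    next
      case False
      then have "degree f \<le> degree r'" using min[OF r' False \<open>poly r' b = 0\<close>] by simp
      moreover have "degree r < degree f"
      proof -
        let ?s = "lead_coeff f"
        obtain N q r2 where "q \<in> polys_over A" and r2: "r2 \<in> polys_over A"
          and eq2: "smult (?s ^ N) r = q * f + r2" and small2: "\<forall>i\<ge>degree f. coeff r2 i = 0"
          using pseudo_division[OF A f(1,2) r0(1)] by blast
        have ev2: "poly r2 b = t * (?s ^ N * w)"
          using arg_cong[OF eq2, of "\<lambda>h. poly h b"] f(3) by (simp add: w(2)[symmetric] ac_simps)
        have "?s ^ N * w \<in> adjoin A b"
          using f(1) w(1) subset_adjoin[OF A]
          by (intro csubring_mult[OF B] csubring_power[OF B]) (auto simp: polys_over_def)
        moreover have nz: "poly r2 b \<noteq> 0" using ev2 w(2) r f(2) t(2) unfolding P_def by auto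
        ultimately have "P r2" using r2 ev2 unfolding P_def by metis
        then have "degree r \<le> degree r2" by (rule rmin)
        also have "degree r2 < degree f"
          using small2 nz by (metis leading_coeff_0_iff not_le poly_0)
        finally show ?thesis .
      qed
      ultimately show False using deg False by simp
    qed
  qed
  then obtain a where "r = [:a:]" by (rule degree_eq_zeroE)
  moreover from this have "a \<in> A" using r0(1) unfolding polys_over_def by (metis (mono_tags) coeff_pCons_0 mem_Collect_eq)
  ultimately show ?thesis using w r unfolding P_def by (intro bexI[of _ a] bexI[of _ w]) auto
qed

lemma finitely_residual_adjoin:
  assumes fr: "finitely_residual A"
  shows "finitely_residual (adjoin A b)"
proof -
  have A: "csubring A" using fr by (simp add: finitely_residual_def)
  note B = csubring_adjoin[OF A, of b]
  have get: "\<exists>n. \<forall>p>n. prime p \<longrightarrow> (\<exists>I. fin_ideal A I \<and> of_nat p \<in> I \<and> (\<exists>u\<in>A. s * u - 1 \<in> I))"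
    if "s \<in> A" "s \<noteq> 0" for s using fr that unfolding finitely_residual_def by blast
  have "\<exists>n. \<forall>p>n. prime p \<longrightarrow>
      (\<exists>J. fin_ideal (adjoin A b) J \<and> of_nat p \<in> J \<and> (\<exists>u\<in>adjoin A b. t * u - 1 \<in> J))"
    if t: "t \<in> adjoin A b" "t \<noteq> 0" for t
  proof (cases "\<exists>f\<in>polys_over A. f \<noteq> 0 \<and> poly f b = 0")
    case True
    then have "\<exists>f. f \<in> polys_over A \<and> f \<noteq> 0 \<and> poly f b = 0" by blast
    then obtain f where f: "f \<in> polys_over A" "f \<noteq> 0" "poly f b = 0"
      and min: "\<And>g. g \<in> polys_over A \<Longrightarrow> g \<noteq> 0 \<Longrightarrow> poly g b = 0 \<Longrightarrow> degree f \<le> degree g"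
      using ex_has_least_nat[of "\<lambda>f. f \<in> polys_over A \<and> f \<noteq> 0 \<and> poly f b = 0" _ degree] by blast
    let ?s = "lead_coeff f"
    have deg: "degree f \<ge> 1"
    proof (rule ccontr)
      assume "\<not> ?thesis"
      then obtain c where "f = [:c:]" using degree_eq_zeroE[of f] by auto
      then show False using f by simp
    qed
    obtain a w where a: "a \<in> A" "w \<in> adjoin A b" "a \<noteq> 0" "t * w = a"
      using algebraic_multiple[OF A f min t] by blast
    have s: "?s \<in> A" using f by (simp add: polys_over_def)
    \<comment> \<open>One inverse of the product serves twice: it makes the leading coefficient of
      \<open>f\<close> invertible, as \<open>fin_ideal_adjoin\<close> demands, and it inverts
      \<open>a\<close>, hence \<open>t\<close>.\<close>
    obtain n where n: "\<And>p. p > n \<Longrightarrow> prime p \<Longrightarrow>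
        \<exists>I. fin_ideal A I \<and> of_nat p \<in> I \<and> (\<exists>u\<in>A. ?s * a * u - 1 \<in> I)"
      using get[of "?s * a"] f(2) a csubring_mult[OF A s] by auto
    have ker: "\<exists>N. \<exists>q\<in>polys_over A. smult (?s ^ N) h = q * f" if h: "h \<in> polys_over A" "poly h b = 0" for h
    proof -
      obtain N q r where q: "q \<in> polys_over A" and r: "r \<in> polys_over A"
        and eq: "smult (?s ^ N) h = q * f + r" and small: "\<forall>i\<ge>degree f. coeff r i = 0"
        using pseudo_division[OF A f(1,2) h(1)] by blast
      have "poly r b = 0" using arg_cong[OF eq, of "\<lambda>h. poly h b"] f(3) h(2) by simp
      then have "r = 0" using min[OF r] small by (metis leading_coeff_0_iff)
      then show ?thesis using eq q by auto
    qed
    show ?thesis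
    proof (intro exI[of _ n] allI impI)
      fix p assume p: "n < p" "prime p"
      obtain I u where I: "fin_ideal A I" "of_nat p \<in> I" and u: "u \<in> A" "?s * a * u - 1 \<in> I"
        using n[OF p] by blast
      have "a * u \<in> A" "?s * (a * u) - 1 \<in> I" using a u csubring_mult[OF A] by (auto simp: mult.assoc)
      then obtain J where J: "fin_ideal (adjoin A b) J" "I \<subseteq> J"
        using fin_ideal_adjoin[OF A I(1) f(1) deg _ _ ker] by blast
      have "t * (w * (?s * u)) - 1 \<in> J"
        using u(2) J(2) a(4) by (metis (no_types, lifting) mult.assoc mult.commute subsetD)
      moreover have "w * (?s * u) \<in> adjoin A b"
        using subset_adjoin[OF A] a u s by (intro csubring_mult[OF B]) auto
      ultimately show "\<exists>J. fin_ideal (adjoin A b) J \<and> of_nat p \<in> J \<and> (\<exists>u\<in>adjoin A b. t * u - 1 \<in> J)"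
        using J I(2) by blast
    qed
  next
    case False
    obtain g where g: "g \<in> polys_over A" "t = poly g b" using t by (auto simp: adjoin_def)
    then have g0: "g \<noteq> 0" using t by auto
    \<comment> \<open>As \<open>t\<close> is the value of \<open>g\<close> at \<open>b\<close>, the
      relation \<open>X * g = 1\<close> turns \<open>b\<close> into an inverse of \<open>t\<close>
      in the quotient. Only the leading coefficient of \<open>g\<close> has to be made a
      unit.\<close>
    define f where "f = monom 1 1 * g - 1"
    have f: "f \<in> polys_over A"
      unfolding f_def by (intro polys_over_closed[OF A] g csubring_1[OF A])
    have "degree (monom 1 1 * g) = Suc (degree g)"
      using g0 by (simp add: degree_mult_eq degree_monom_eq)
    then have deg: "degree f = Suc (degree g)"
      unfolding f_def diff_conv_add_uminus by (subst degree_add_eq_left) simp_all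
    have lc: "lead_coeff f = lead_coeff g"
      unfolding deg by (simp add: f_def coeff_monom_mult)
    have lg: "lead_coeff g \<in> A" "lead_coeff g \<noteq> 0" using g g0 by (auto simp: polys_over_def)
    obtain n where n: "\<And>p. p > n \<Longrightarrow> prime p \<Longrightarrow>
        \<exists>I. fin_ideal A I \<and> of_nat p \<in> I \<and> (\<exists>u\<in>A. lead_coeff g * u - 1 \<in> I)"
      using get[OF lg] by blast
    have ker: "\<exists>N. \<exists>q\<in>polys_over A. smult (lead_coeff f ^ N) h = q * f"
      if "h \<in> polys_over A" "poly h b = 0" for h
    proof -
      have "h = 0" using that False by blast
      then show ?thesis using polys_over_closed(1)[OF A] by (intro exI[of _ 0] bexI[of _ 0]) auto
    qed
    show ?thesis
    proof (intro exI[of _ n] allI impI)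
      fix p assume p: "n < p" "prime p"
      obtain I u where I: "fin_ideal A I" "of_nat p \<in> I" and u: "u \<in> A" "lead_coeff g * u - 1 \<in> I"
        using n[OF p] by blast
      obtain J where J: "fin_ideal (adjoin A b) J" "I \<subseteq> J" "poly f b \<in> J"
        using fin_ideal_adjoin[OF A I(1) f _ u(1) _ ker] u(2) deg lc by auto
      have "t * b - 1 \<in> J" using J(3) by (simp add: f_def g(2) poly_monom mult.commute)
      then show "\<exists>J. fin_ideal (adjoin A b) J \<and> of_nat p \<in> J \<and> (\<exists>u\<in>adjoin A b. t * u - 1 \<in> J)"
        using J I(2) adjoin_generator[OF A] by blast
    qed
  qed
  then show ?thesis unfolding finitely_residual_def using B by blast
qed

lemma finitely_residual_exists:
  assumes "finite S"
  shows "\<exists>A. finitely_residual A \<and> S \<subseteq> A"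
  using assms
proof (induction S rule: finite_induct)
  case empty
  then show ?case using finitely_residual_Ints by auto
next
  case (insert b S)
  then obtain A where A: "finitely_residual A" "S \<subseteq> A" by blast
  then have "csubring A" by (simp add: finitely_residual_def)
  then have "S \<subseteq> adjoin A b" "b \<in> adjoin A b" using A subset_adjoin adjoin_generator by blast+
  then show ?case using finitely_residual_adjoin[OF A(1)] by (intro exI[of _ "adjoin A b"]) auto
qed

section \<open>Lifting isometries to matrices\<close>

definition real2 :: "m2 \<Rightarrow> bool" where
  "real2 A \<longleftrightarrow> Im (m11 A) = 0 \<and> Im (m12 A) = 0 \<and> Im (m21 A) = 0 \<and> Im (m22 A) = 0"

definition imag2 :: "m2 \<Rightarrow> bool" where
  "imag2 A \<longleftrightarrow> Re (m11 A) = 0 \<and> Re (m12 A) = 0 \<and> Re (m21 A) = 0 \<and> Re (m22 A) = 0"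

definition mob :: "m2 \<Rightarrow> complex \<Rightarrow> complex" where
  "mob A z = (m11 A * z + m12 A) / (m21 A * z + m22 A)"

text \<open>An orientation-reversing isometry \<open>z \<mapsto> (a cnj z + b) / (c cnj z + d)\<close> has a real matrix of
  determinant \<open>-1\<close>; multiplying it by \<open>\<i>\<close> gives determinant \<open>1\<close>, and then composition of isometries
  is multiplication of matrices up to sign.\<close>

definition lifts :: "bool \<Rightarrow> (complex \<Rightarrow> complex) \<Rightarrow> m2 \<Rightarrow> bool" where
  "lifts b f A \<longleftrightarrow> det2 A = 1 \<and>
     (if b then real2 A \<and> (\<forall>z\<in>hyp_plane. f z = mob A z)
      else imag2 A \<and> (\<forall>z\<in>hyp_plane. f z = mob A (cnj z)))"

lemma real2_mult: "real2 A \<Longrightarrow> real2 B \<Longrightarrow> real2 (A * B)"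
  and real2_imag2_mult: "real2 A \<Longrightarrow> imag2 B \<Longrightarrow> imag2 (A * B)"
  and imag2_real2_mult: "imag2 A \<Longrightarrow> real2 B \<Longrightarrow> imag2 (A * B)"
  and imag2_mult: "imag2 A \<Longrightarrow> imag2 B \<Longrightarrow> real2 (A * B)"
  and real2_adj2: "real2 A \<Longrightarrow> real2 (adj2 A)" and imag2_adj2: "imag2 A \<Longrightarrow> imag2 (adj2 A)"
  by (simp_all add: real2_def imag2_def)

lemma mob_denominator_nonzero:
  assumes "real2 A \<or> imag2 A" "det2 A = 1" "Im z \<noteq> 0"
  shows "m21 A * z + m22 A \<noteq> 0"
proof
  assume *: "m21 A * z + m22 A = 0"
  have "m21 A = 0"
    using assms(1)
  proof
    assume "real2 A"
    then show ?thesis using arg_cong[OF *, of Im] assms(3) by (simp add: real2_def complex_eq_iff)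
  next
    assume "imag2 A"
    then show ?thesis using arg_cong[OF *, of Re] assms(3) by (simp add: imag2_def complex_eq_iff)
  qed
  then show False using * assms(2) by (simp add: det2_def)
qed

lemma mob_mob:
  assumes "m21 B * z + m22 B \<noteq> 0"
  shows "mob A (mob B z) = mob (A * B) z"
proof -
  let ?q = "m21 B * z + m22 B"
  have "mob A (mob B z) = (?q * (m11 A * mob B z + m12 A)) / (?q * (m21 A * mob B z + m22 A))"
    unfolding mob_def using assms by (subst mult_divide_mult_cancel_left) auto
  also have "?q * (m11 A * mob B z + m12 A) = m11 A * (m11 B * z + m12 B) + m12 A * ?q"
    using assms by (simp add: mob_def field_simps)
  also have "?q * (m21 A * mob B z + m22 A) = m21 A * (m11 B * z + m12 B) + m22 A * ?q"
    using assms by (simp add: mob_def field_simps)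
  finally show ?thesis by (simp add: mob_def algebra_simps)
qed

text \<open>Conjugation negates every entry of a purely imaginary matrix, and a common sign cancels
  in the quotient. Hence conjugations can be moved past lifts of either kind.\<close>

lemma cnj_mob:
  assumes "real2 A \<or> imag2 A"
  shows "cnj (mob A z) = mob A (cnj z)"
  using assms
proof
  assume "real2 A"
  then have "cnj (m11 A) = m11 A" "cnj (m12 A) = m12 A" "cnj (m21 A) = m21 A" "cnj (m22 A) = m22 A"
    by (simp_all add: real2_def complex_eq_iff)
  then show ?thesis by (simp add: mob_def)
next
  assume "imag2 A"
  then have *: "cnj (m11 A) = - m11 A" "cnj (m12 A) = - m12 A" "cnj (m21 A) = - m21 A" "cnj (m22 A) = - m22 A"
    by (simp_all add: imag2_def complex_eq_iff)
  have "cnj (mob A z) = (- (m11 A * cnj z + m12 A)) / (- (m21 A * cnj z + m22 A))"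
    unfolding mob_def by (simp add: *)
  then show ?thesis by (simp only: minus_divide_divide mob_def)
qed

lemma lifts_compose:
  assumes "lifts b f A" "lifts b' g B" "g \<in> hyp_plane \<rightarrow> hyp_plane"
  shows "lifts (b = b') (compose hyp_plane f g) (A * B)"
proof -
  have A: "det2 A = 1" "real2 A \<or> imag2 A" and B: "det2 B = 1" "real2 B \<or> imag2 B"
    using assms(1,2) by (auto simp: lifts_def split: if_splits)
  have m: "mob A (mob B z) = mob (A * B) z" "mob A (cnj (mob B z)) = mob (A * B) (cnj z)"
    "mob A (mob B (cnj z)) = mob (A * B) (cnj z)" "mob A (cnj (mob B (cnj z))) = mob (A * B) z"
    if "z \<in> hyp_plane" for z
    using mob_mob mob_denominator_nonzero[OF B(2,1)] cnj_mob[OF B(2)] that by (simp_all add: hyp_plane_def)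
  have g: "g z \<in> hyp_plane" if "z \<in> hyp_plane" for z using assms(3) that by auto
  show ?thesis
  proof (cases b; cases b')
    assume "b" "b'"
    then show ?thesis using assms(1,2) g m(1) unfolding lifts_def by (simp add: compose_eq real2_mult)
  next
    assume "b" "\<not> b'"
    then show ?thesis using assms(1,2) g m(3) unfolding lifts_def by (simp add: compose_eq real2_imag2_mult)
  next
    assume "\<not> b" "b'"
    then show ?thesis using assms(1,2) g m(2) unfolding lifts_def by (simp add: compose_eq imag2_real2_mult)
  next
    assume "\<not> b" "\<not> b'"
    then show ?thesis using assms(1,2) g m(4) unfolding lifts_def by (simp add: compose_eq imag2_mult)
  qed
qed

lemma mob_1 [simp]: "mob 1 z = z"
  by (simp add: mob_def)

lemma lifts_one: "lifts True (\<lambda>z\<in>hyp_plane. z) 1"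
  by (simp add: lifts_def real2_def)

lemma lifts_inverse:
  assumes "lifts b f A" "f \<in> Bij hyp_plane"
  shows "lifts b (restrict (inv_into hyp_plane f) hyp_plane) (adj2 A)"
proof -
  let ?g = "inv_into hyp_plane f"
  have A: "det2 A = 1" "real2 A \<or> imag2 A" using assms(1) by (auto simp: lifts_def split: if_splits)
  have g: "?g z \<in> hyp_plane" "f (?g z) = z" if "z \<in> hyp_plane" for z
    using that assms(2) by (auto simp: Bij_def bij_betw_def inv_into_into f_inv_into_f)
  have m: "mob (adj2 A) (mob A z) = z" if "Im z \<noteq> 0" for z
    using mob_mob[OF mob_denominator_nonzero[OF A(2,1) that]] A(1) by (simp add: adj2_mult_self)
  show ?thesis
  proof (cases b)
    case True
    have "?g z = mob (adj2 A) z" if "z \<in> hyp_plane" for z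
      using g[OF that] m[of "?g z"] assms(1) True by (auto simp: lifts_def hyp_plane_def)
    then show ?thesis using assms(1) True by (simp add: lifts_def real2_adj2)
  next
    case False
    have "?g z = mob (adj2 A) (cnj z)" if "z \<in> hyp_plane" for z
    proof -
      have "f (?g z) = mob A (cnj (?g z))" using assms(1) False g[OF that] by (simp add: lifts_def)
      then have "z = mob A (cnj (?g z))" using g[OF that] by simp
      then have "cnj z = mob A (?g z)" using cnj_mob[OF A(2), of "cnj (?g z)"] by simp
      then show ?thesis using m[of "?g z"] g[OF that] by (simp add: hyp_plane_def)
    qed
    then show ?thesis using assms(1) False by (simp add: lifts_def imag2_adj2)
  qed
qed

lemma lifts_identity:
  assumes "lifts b f A" "\<And>z. z \<in> hyp_plane \<Longrightarrow> f z = z"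
  shows "b \<and> pm1 A"
proof -
  have A: "det2 A = 1" "real2 A \<or> imag2 A" using assms(1) by (auto simp: lifts_def split: if_splits)
  have fx: "m11 A * w + m12 A = z * (m21 A * w + m22 A)"
    if "z \<in> hyp_plane" "w = (if b then z else cnj z)" for z w
  proof -
    have "z = mob A w" using assms that unfolding lifts_def by (metis (full_types))
    moreover have "Im w \<noteq> 0" using that by (auto simp: hyp_plane_def)
    ultimately show ?thesis using mob_denominator_nonzero[OF A(2,1)] by (simp add: mob_def field_simps)
  qed
  \<comment> \<open>The first two points are also fixed by \<open>z \<mapsto> - cnj z\<close>; the
    third, off the imaginary axis, rules that map out.\<close>
  have H: "\<i> \<in> hyp_plane" "2 * \<i> \<in> hyp_plane" "1 + \<i> \<in> hyp_plane" by (simp_all add: hyp_plane_def)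
  show ?thesis
  proof (cases b)
    case True
    then have r: "real2 A" using assms(1) by (simp add: lifts_def)
    have "m11 A = m22 A" "m12 A = 0" "m21 A = 0"
      using fx[OF H(1) HOL.refl] fx[OF H(2) HOL.refl] r True by (simp_all add: complex_eq_iff real2_def)
    moreover from this have "m22 A * m22 A = 1" using A(1) by (simp add: det2_def)
    then have "m22 A = 1 \<or> m22 A = - 1" by (metis power2_eq_1_iff power2_eq_square)
    ultimately show ?thesis using True by (auto simp: m2_eq_iff)
  next
    case False
    then have r: "imag2 A" using assms(1) by (simp add: lifts_def)
    have "m11 A = - m22 A" "m12 A = 0" "m21 A = 0"
      using fx[OF H(1) HOL.refl] fx[OF H(2) HOL.refl] r False by (simp_all add: complex_eq_iff imag2_def)
    then have "m22 A = 0" using fx[OF H(3) HOL.refl] r False by (simp add: complex_eq_iff imag2_def)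
    then show ?thesis using A(1) \<open>m21 A = 0\<close> by (simp add: det2_def)
  qed
qed

section \<open>Isometries are fractional linear maps, up to complex conjugation\<close>

definition hdelta :: "complex \<Rightarrow> complex \<Rightarrow> real" where
  "hdelta z w = (cmod (z - w))\<^sup>2 / (Im z * Im w)"

text \<open>\<open>hdelta\<close> is twice \<open>cosh - 1\<close> of the distance, so this rational
  expression can replace the distance in all comparisons.\<close>

lemma hyp_dist_eq_iff:
  assumes "z \<in> hyp_plane" "w \<in> hyp_plane" "z' \<in> hyp_plane" "w' \<in> hyp_plane"
  shows "hyp_dist z w = hyp_dist z' w' \<longleftrightarrow> hdelta z w = hdelta z' w'"
proof -
  have *: "hyp_dist z w = arcosh (1 + hdelta z w / 2)" for z w
    by (simp add: hyp_dist_def hdelta_def ac_simps)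
  have "hdelta z w \<ge> 0" "hdelta z' w' \<ge> 0" using assms by (simp_all add: hdelta_def hyp_plane_def)
  then show ?thesis unfolding *
    by (metis add_left_cancel add_increasing2 cosh_arcosh_real divide_cancel_right divide_nonneg_pos
        order_refl zero_less_numeral zero_neq_numeral)
qed

lemma Im_mob:
  assumes "real2 A" "det2 A = 1"
  shows "Im (mob A z) = Im z / (cmod (m21 A * z + m22 A))\<^sup>2"
proof -
  have d: "Re (m11 A) * Re (m22 A) - Re (m12 A) * Re (m21 A) = 1"
    using arg_cong[OF assms(2), of Re] assms(1) by (simp add: det2_def real2_def)
  have "Im ((m11 A * z + m12 A) * cnj (m21 A * z + m22 A)) =
      (Re (m11 A) * Re (m22 A) - Re (m12 A) * Re (m21 A)) * Im z"
    using assms(1) by (simp add: real2_def algebra_simps)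
  then show ?thesis
    unfolding mob_def complex_div_cnj[of "m11 A * z + m12 A"] d
    by (simp only: Im_divide_of_real of_real_power[symmetric] d mult_1)
qed

lemma mob_in_hyp_plane:
  assumes "real2 A" "det2 A = 1" "z \<in> hyp_plane"
  shows "mob A z \<in> hyp_plane"
  using Im_mob[OF assms(1,2), of z] mob_denominator_nonzero[of A z] assms by (simp add: hyp_plane_def)

lemma hdelta_mob:
  assumes "real2 A" "det2 A = 1" "z \<in> hyp_plane" "w \<in> hyp_plane"
  shows "hdelta (mob A z) (mob A w) = hdelta z w"
proof -
  let ?p = "m21 A * z + m22 A" and ?q = "m21 A * w + m22 A"
  have nz: "?p \<noteq> 0" "?q \<noteq> 0"
    using mob_denominator_nonzero[of A] assms by (auto simp: hyp_plane_def)
  have "mob A z - mob A w = (z - w) * det2 A / (?p * ?q)"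
    unfolding mob_def det2_def using nz by (simp add: diff_frac_eq) (simp add: algebra_simps)
  then have "cmod (mob A z - mob A w) = cmod (z - w) / (cmod ?p * cmod ?q)"
    using assms(2) by (simp add: norm_divide norm_mult)
  then show ?thesis
    unfolding hdelta_def Im_mob[OF assms(1,2)] using nz by (simp add: power_divide power_mult_distrib)
qed

text \<open>\<open>1 / 2\<close> is the value of \<open>hdelta\<close> at \<i> and
  \<open>2 * \<i>\<close>. \<open>T\<close> moves the first point to \<i>, the rotation
  \<open>R\<close> about \<i> moves the second to the imaginary axis, and there only
  \<open>2 * \<i>\<close> and \<open>\<i> / 2\<close> have the right distance from \<i>;
  \<open>S\<close> exchanges these two if necessary.\<close>

lemma two_point_normalization:
  assumes H: "w0 \<in> hyp_plane" "w1 \<in> hyp_plane" and d: "hdelta w0 w1 = 1 / 2"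
  obtains A where "real2 A" "det2 A = 1" "mob A w0 = \<i>" "mob A w1 = 2 * \<i>"
proof -
  define v where "v = Im w0"
  have v: "v > 0" using H(1) by (simp add: v_def hyp_plane_def)
  define T where "T = M2 (of_real (1 / sqrt v)) (of_real (- Re w0 / sqrt v)) 0 (of_real (sqrt v))"
  have T: "real2 T" "det2 T = 1" using v by (simp_all add: T_def real2_def det2_def flip: of_real_mult)
  have "mob T w0 = \<i>"
  proof -
    have "mob T w0 = (w0 - of_real (Re w0)) / (of_real (sqrt v) * of_real (sqrt v))"
      using v by (simp add: T_def mob_def field_simps)
    also have "\<dots> = \<i> * of_real v / of_real v"
      using v by (simp add: v_def complex_eq_iff flip: of_real_mult)
    finally show ?thesis using v by simp
  qed
  define w where "w = mob T w1"
  have w: "w \<in> hyp_plane" using mob_in_hyp_plane[OF T H(2)] by (simp add: w_def)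
  have dw: "hdelta \<i> w = 1 / 2" using hdelta_mob[OF T H] d \<open>mob T w0 = \<i>\<close> by (simp add: w_def)
  define P where "P = 1 - (cmod w)\<^sup>2"
  \<comment> \<open>The second equation makes the real part of the rotated point vanish. For
    \<open>a = cos \<theta>\<close>, \<open>b = sin \<theta>\<close> it is linear in cosine and sine
    of the double angle, so \<open>a + \<i> * b\<close> can be taken as a square root of the
    normalized number \<open>P - 2 * \<i> * Re w\<close>.\<close>
  obtain a b :: real where ab: "a\<^sup>2 + b\<^sup>2 = 1" "a * b * P + (a\<^sup>2 - b\<^sup>2) * Re w = 0"
  proof (cases "P = 0 \<and> Re w = 0")
    case True
    then show ?thesis using that[of 1 0] by simp
  next
    case False
    define n where "n = cmod (Complex P (- 2 * Re w))"
    have n: "n > 0" using False by (auto simp: n_def complex_eq_iff)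
    define g where "g = csqrt (Complex P (- 2 * Re w) / of_real n)"
    have g2: "g\<^sup>2 = Complex P (- 2 * Re w) / of_real n" by (simp add: g_def)
    have "cmod (g\<^sup>2) = 1" unfolding g2 using n by (simp add: n_def norm_divide)
    then have "(cmod g)\<^sup>2 = 1" by (simp add: norm_power)
    then have 1: "(Re g)\<^sup>2 + (Im g)\<^sup>2 = 1" by (simp add: cmod_power2)
    have 2: "(Re g)\<^sup>2 - (Im g)\<^sup>2 = P / n" "2 * (Re g * Im g) = - 2 * Re w / n"
      using arg_cong[OF g2, of Re] arg_cong[OF g2, of Im] by (simp_all add: power2_eq_square ac_simps)
    have "Re g * Im g = - Re w / n" using 2(2) by simp
    then have "Re g * Im g * P + ((Re g)\<^sup>2 - (Im g)\<^sup>2) * Re w = 0" unfolding 2(1) by simp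
    then show ?thesis using that 1 by blast
  qed
  define R where "R = M2 (of_real a) (of_real b) (of_real (- b)) (of_real a)"
  have R: "real2 R" "det2 R = 1"
    using ab(1) by (simp_all add: R_def real2_def det2_def power2_eq_square flip: of_real_mult of_real_add)
  have Ri: "mob R \<i> = \<i>"
    using mob_denominator_nonzero[of R \<i>] R by (simp add: mob_def R_def field_simps)
  define y where "y = Im (mob R w)"
  have Rw: "mob R w \<in> hyp_plane" using mob_in_hyp_plane[OF R w] .
  have "Re (mob R w) = 0"
  proof -
    have "Re ((of_real a * w + of_real b) * cnj (of_real (- b) * w + of_real a)) =
        a * b * P + (a\<^sup>2 - b\<^sup>2) * Re w"
      unfolding P_def cmod_power2 by (simp add: algebra_simps power2_eq_square)
    then have "Re ((m11 R * w + m12 R) * cnj (m21 R * w + m22 R)) = 0" using ab(2) by (simp add: R_def)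
    then show ?thesis unfolding mob_def Re_complex_div_eq_0 by simp
  qed
  then have wy: "mob R w = \<i> * of_real y" by (simp add: complex_eq_iff y_def)
  have y0: "y > 0" using Rw by (simp add: y_def hyp_plane_def)
  have "hdelta \<i> (\<i> * of_real y) = 1 / 2"
    using hdelta_mob[OF R _ w, of \<i>] dw Ri wy by (simp add: hyp_plane_def)
  moreover have "(cmod (\<i> - \<i> * of_real y))\<^sup>2 = (1 - y)\<^sup>2" by (simp add: cmod_power2)
  ultimately have "(1 - y)\<^sup>2 / y = 1 / 2" by (simp add: hdelta_def)
  then have "(y - 2) * (2 * y - 1) = 0" using y0 by (simp add: field_simps power2_eq_square)
  then consider "y = 2" | "y = 1 / 2" by fastforce
  then obtain S where S: "real2 S" "det2 S = 1" "mob S \<i> = \<i>" "mob S (\<i> * of_real y) = 2 * \<i>"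
  proof cases
    case 1
    then show ?thesis using that[of 1] by (simp add: real2_def)
  next
    case 2
    have "mob (M2 0 1 (- 1) 0) (\<i> * of_real y) = 2 * \<i>" unfolding 2 by (simp add: mob_def complex_eq_iff)
    then show ?thesis using that[of "M2 0 1 (- 1) 0"] by (simp add: real2_def det2_def mob_def field_simps)
  qed
  have comp: "mob (S * R * T) z = mob S (mob R (mob T z))" if "z \<in> hyp_plane" for z
  proof -
    have "m21 T * z + m22 T \<noteq> 0" "m21 (R * T) * z + m22 (R * T) \<noteq> 0"
      using mob_denominator_nonzero[of T z] mob_denominator_nonzero[of "R * T" z] T R that
      by (simp_all del: m2_sel add: hyp_plane_def real2_mult)
    then show ?thesis using mob_mob by (metis mult.assoc)
  qed
  show thesis
  proof (rule that[of "S * R * T"])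
    show "real2 (S * R * T)" "det2 (S * R * T) = 1" using S R T by (simp_all add: real2_mult)
    show "mob (S * R * T) w0 = \<i>" using comp[OF H(1)] S Ri \<open>mob T w0 = \<i>\<close> by simp
    show "mob (S * R * T) w1 = 2 * \<i>" using comp[OF H(2)] S wy by (simp add: w_def)
  qed
qed

text \<open>The distances from \<i> and \<open>2 * \<i>\<close> determine \<open>Im z\<close> and
  \<open>\<bar>Re z\<bar>\<close>. The remaining sign is uniform: a point whose sign differs from
  that chosen at \<open>1 + \<i>\<close> must have real part 0.\<close>

lemma hdelta_fixes_two_points:
  assumes h: "\<And>z. z \<in> hyp_plane \<Longrightarrow> h z \<in> hyp_plane"
    and iso: "\<And>z w. z \<in> hyp_plane \<Longrightarrow> w \<in> hyp_plane \<Longrightarrow> hdelta (h z) (h w) = hdelta z w"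
    and fixed: "h \<i> = \<i>" "h (2 * \<i>) = 2 * \<i>"
  shows "(\<forall>z\<in>hyp_plane. h z = z) \<or> (\<forall>z\<in>hyp_plane. h z = - cnj z)"
proof -
  have pw: "Im (h z) = Im z \<and> \<bar>Re (h z)\<bar> = \<bar>Re z\<bar>" if z: "z \<in> hyp_plane" for z
  proof -
    define u v x y where "u = Re (h z)" and "v = Im (h z)" and "x = Re z" and "y = Im z"
    have pos: "v > 0" "y > 0" using h[OF z] z by (simp_all add: v_def y_def hyp_plane_def)
    have "hdelta (h z) \<i> = hdelta z \<i>" "hdelta (h z) (2 * \<i>) = hdelta z (2 * \<i>)"
      using iso[OF z, of \<i>] iso[OF z, of "2 * \<i>"] fixed by (simp_all add: hyp_plane_def)
    then have "(u\<^sup>2 + (v - 1)\<^sup>2) / v = (x\<^sup>2 + (y - 1)\<^sup>2) / y"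
      "(u\<^sup>2 + (v - 2)\<^sup>2) / (v * 2) = (x\<^sup>2 + (y - 2)\<^sup>2) / (y * 2)"
      by (simp_all add: hdelta_def cmod_power2 u_def v_def x_def y_def)
    then have 1: "(u\<^sup>2 + (v - 1)\<^sup>2) * y = (x\<^sup>2 + (y - 1)\<^sup>2) * v"
      and 2: "(u\<^sup>2 + (v - 2)\<^sup>2) * y = (x\<^sup>2 + (y - 2)\<^sup>2) * v"
      using pos by (simp_all add: frac_eq_eq)
    have "(u\<^sup>2 + (v - 2)\<^sup>2) * y - (u\<^sup>2 + (v - 1)\<^sup>2) * y = 3 * y - 2 * (v * y)"
      "(x\<^sup>2 + (y - 2)\<^sup>2) * v - (x\<^sup>2 + (y - 1)\<^sup>2) * v = 3 * v - 2 * (v * y)"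
      by (simp_all add: algebra_simps power2_eq_square)
    then have vy: "v = y" using 1 2 by simp
    then have "u\<^sup>2 = x\<^sup>2" using 1 pos by simp
    then show ?thesis using vy by (simp add: u_def v_def x_def y_def power2_eq_iff abs_eq_iff)
  qed
  have Re0: "Re z = 0" if z: "z \<in> hyp_plane" and s: "s = 1 \<or> s = - 1" and t: "t = 1 \<or> t = - 1" "t \<noteq> s"
    and hz: "Re (h z) = s * Re z" and h1: "Re (h (1 + \<i>)) = t" for z s t
  proof -
    have H1: "1 + \<i> \<in> hyp_plane" by (simp add: hyp_plane_def)
    have "hdelta (h z) (h (1 + \<i>)) = hdelta z (1 + \<i>)" by (rule iso[OF z H1])
    then have "(s * Re z - t)\<^sup>2 = (Re z - 1)\<^sup>2"
      using pw[OF z] pw[OF H1] hz h1 z by (simp add: hdelta_def cmod_power2 hyp_plane_def)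
    then show ?thesis using s t by (auto simp: power2_eq_square algebra_simps)
  qed
  have eqs: "h z = z \<longleftrightarrow> Re (h z) = Re z" "h z = - cnj z \<longleftrightarrow> Re (h z) = - Re z" if "z \<in> hyp_plane" for z
    using pw[OF that] by (auto simp: complex_eq_iff)
  have "Re (h (1 + \<i>)) = 1 \<or> Re (h (1 + \<i>)) = - 1"
    using pw[of "1 + \<i>"] by (auto simp: hyp_plane_def)
  then show ?thesis
  proof
    assume 1: "Re (h (1 + \<i>)) = 1"
    have "h z = z" if z: "z \<in> hyp_plane" for z
      using Re0[OF z, of "- 1" 1] 1 pw[OF z] eqs(1)[OF z] by (auto simp: abs_eq_iff)
    then show ?thesis by blast
  next
    assume 1: "Re (h (1 + \<i>)) = - 1"
    have "h z = - cnj z" if z: "z \<in> hyp_plane" for z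
      using Re0[OF z, of 1 "- 1"] 1 pw[OF z] eqs(2)[OF z] by (auto simp: abs_eq_iff)
    then show ?thesis by blast
  qed
qed

lemma isometry_lifts:
  assumes "f \<in> carrier hyp_isom"
  shows "\<exists>b A. lifts b f A"
proof -
  have f: "f z \<in> hyp_plane" if "z \<in> hyp_plane" for z
    using assms that Bij_imp_funcset[of f hyp_plane] by (auto simp: hyp_isom_def)
  have iso: "hdelta (f z) (f w) = hdelta z w" if "z \<in> hyp_plane" "w \<in> hyp_plane" for z w
    using assms that hyp_dist_eq_iff[of "f z" "f w" z w] f by (simp add: hyp_isom_def)
  have H: "\<i> \<in> hyp_plane" "2 * \<i> \<in> hyp_plane" by (simp_all add: hyp_plane_def)
  have "hdelta \<i> (2 * \<i>) = 1 / 2" by (simp add: hdelta_def norm_mult cmod_power2)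
  then have "hdelta (f \<i>) (f (2 * \<i>)) = 1 / 2" using iso[OF H] by simp
  then obtain A where A: "real2 A" "det2 A = 1" "mob A (f \<i>) = \<i>" "mob A (f (2 * \<i>)) = 2 * \<i>"
    using two_point_normalization[OF f[OF H(1)] f[OF H(2)]] by blast
  have undo: "mob (adj2 A) (mob A (f z)) = f z" if "z \<in> hyp_plane" for z
    using mob_mob[OF mob_denominator_nonzero[of A "f z"], of "adj2 A"] A f[OF that]
    by (simp add: hyp_plane_def adj2_mult_self)
  have "(\<forall>z\<in>hyp_plane. mob A (f z) = z) \<or> (\<forall>z\<in>hyp_plane. mob A (f z) = - cnj z)"
    by (rule hdelta_fixes_two_points) (use A f iso H mob_in_hyp_plane hdelta_mob in auto)
  then show ?thesis
  proof
    assume "\<forall>z\<in>hyp_plane. mob A (f z) = z"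
    then have "lifts True f (adj2 A)" using undo A by (simp add: lifts_def real2_adj2)
    then show ?thesis by blast
  next
    assume *: "\<forall>z\<in>hyp_plane. mob A (f z) = - cnj z"
    \<comment> \<open>\<open>D\<close> is a lift of the reflection in the imaginary axis: applied to
      \<open>cnj z\<close> it gives \<open>- cnj z\<close>.\<close>
    define D where "D = M2 \<i> 0 0 (- \<i>)"
    have D: "imag2 D" "det2 D = 1" "mob D z = - z" for z by (simp_all add: D_def imag2_def det2_def mob_def)
    have "f z = mob (adj2 A * D) (cnj z)" if "z \<in> hyp_plane" for z
    proof -
      have "f z = mob (adj2 A) (mob D (cnj z))" using * undo that D(3) by auto
      then show ?thesis using mob_mob[of D "cnj z"] by (simp add: D_def)
    qed
    then have "lifts False f (adj2 A * D)" using A D by (simp add: lifts_def real2_adj2 real2_imag2_mult)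
    then show ?thesis by blast
  qed
qed

lemma mob_has_field_derivative:
  assumes "det2 A = 1" "m21 A * z + m22 A \<noteq> 0"
  shows "(mob A has_field_derivative 1 / (m21 A * z + m22 A)\<^sup>2) (at z)"
proof -
  have "((\<lambda>z. (m11 A * z + m12 A) / (m21 A * z + m22 A)) has_field_derivative 1 / (m21 A * z + m22 A)\<^sup>2) (at z)"
    apply (rule derivative_eq_intros HOL.refl assms(2))+
    using assms by (simp add: det2_def power2_eq_square field_simps)
  then show ?thesis unfolding mob_def[abs_def] .
qed

lemma open_hyp_plane: "open hyp_plane"
  unfolding hyp_plane_def by (rule open_halfspace_Im_gt)

text \<open>The real derivative is multiplication by a nonzero \<open>d\<close>, preceded by
  conjugation in the reversing case, so its Jacobian is plus or minus
  \<open>(cmod d)\<^sup>2\<close>.\<close>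

lemma lifts_orientation:
  assumes "lifts b f A"
  shows "if b then orientation_preserving f else orientation_reversing f"
proof -
  have A: "det2 A = 1" "real2 A \<or> imag2 A" using assms(1) by (auto simp: lifts_def split: if_splits)
  show ?thesis
  proof (cases b)
    case True
    have "\<exists>D. (f has_derivative D) (at z) \<and> jacobian D > 0" if z: "z \<in> hyp_plane" for z
    proof -
      have nz: "m21 A * z + m22 A \<noteq> 0" using mob_denominator_nonzero[OF A(2,1)] z by (simp add: hyp_plane_def)
      define d where "d = 1 / (m21 A * z + m22 A)\<^sup>2"
      have "(mob A has_derivative (*) d) (at z)"
        using mob_has_field_derivative[OF A(1) nz] by (simp add: has_field_derivative_def d_def)
      then have "(f has_derivative (*) d) (at z)"
        by (rule has_derivative_transform_within_open[OF _ open_hyp_plane z])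
          (use assms True in \<open>simp add: lifts_def\<close>)
      moreover have "jacobian ((*) d) = (cmod d)\<^sup>2"
        unfolding cmod_power2 by (simp add: jacobian_def power2_eq_square)
      moreover have "d \<noteq> 0" using nz by (simp add: d_def)
      ultimately show ?thesis by (intro exI[of _ "(*) d"]) simp
    qed
    then show ?thesis using True by (simp add: orientation_preserving_def)
  next
    case False
    have "\<exists>D. (f has_derivative D) (at z) \<and> jacobian D < 0" if z: "z \<in> hyp_plane" for z
    proof -
      have nz: "m21 A * cnj z + m22 A \<noteq> 0" using mob_denominator_nonzero[OF A(2,1)] z by (simp add: hyp_plane_def)
      define d where "d = 1 / (m21 A * cnj z + m22 A)\<^sup>2"
      have "(mob A has_derivative (*) d) (at (cnj z))"
        using mob_has_field_derivative[OF A(1) nz] by (simp add: has_field_derivative_def d_def)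
      then have "((\<lambda>z. mob A (cnj z)) has_derivative (\<lambda>h. d * cnj h)) (at z)"
        by (intro has_derivative_compose[of cnj cnj z UNIV "mob A"] bounded_linear_imp_has_derivative bounded_linear_cnj)
      then have "(f has_derivative (\<lambda>h. d * cnj h)) (at z)"
        by (rule has_derivative_transform_within_open[OF _ open_hyp_plane z])
          (use assms False in \<open>simp add: lifts_def\<close>)
      moreover have "jacobian (\<lambda>h. d * cnj h) = - (cmod d)\<^sup>2"
        unfolding cmod_power2 by (simp add: jacobian_def power2_eq_square)
      moreover have "d \<noteq> 0" using nz by (simp add: d_def)
      ultimately show ?thesis by (intro exI[of _ "\<lambda>h. d * cnj h"]) simp
    qed
    then show ?thesis using False by (simp add: orientation_reversing_def)
  qed
qed

lemma orientation_exclusive: "\<not> (orientation_preserving f \<and> orientation_reversing f)"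
proof
  assume "orientation_preserving f \<and> orientation_reversing f"
  moreover have "\<i> \<in> hyp_plane" by (simp add: hyp_plane_def)
  ultimately obtain D D' where "(f has_derivative D) (at \<i>)" "jacobian D > 0"
    "(f has_derivative D') (at \<i>)" "jacobian D' < 0"
    unfolding orientation_preserving_def orientation_reversing_def by blast
  then show False using has_derivative_unique by (metis not_less_iff_gr_or_eq)
qed

section \<open>Congruence subgroups\<close>

definition over2 :: "complex set \<Rightarrow> m2 set" where
  "over2 A = {B. m11 B \<in> A \<and> m12 B \<in> A \<and> m21 B \<in> A \<and> m22 B \<in> A}"

lemma over2_closed:
  assumes "csubring A"
  shows "1 \<in> over2 A" "0 \<in> over2 A" "B \<in> over2 A \<Longrightarrow> C \<in> over2 A \<Longrightarrow> B * C \<in> over2 A"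
    "B \<in> over2 A \<Longrightarrow> C \<in> over2 A \<Longrightarrow> B + C \<in> over2 A"
    "B \<in> over2 A \<Longrightarrow> - B \<in> over2 A" "B \<in> over2 A \<Longrightarrow> adj2 B \<in> over2 A"
  using assms by (auto simp: over2_def csubring_1 csubring_0 csubring_mult csubring_add csubring_uminus)

lemma over2_power: "csubring A \<Longrightarrow> B \<in> over2 A \<Longrightarrow> B ^ n \<in> over2 A"
  by (induction n) (auto simp: over2_closed)

lemma over2_ideal:
  assumes A: "csubring A" "fin_ideal A I"
  shows "B \<in> over2 A \<Longrightarrow> K \<in> over2 I \<Longrightarrow> B * K \<in> over2 I" "B \<in> over2 A \<Longrightarrow> K \<in> over2 I \<Longrightarrow> K * B \<in> over2 I"
    "0 \<in> over2 I" "K \<in> over2 I \<Longrightarrow> L \<in> over2 I \<Longrightarrow> K + L \<in> over2 I" "K \<in> over2 I \<Longrightarrow> - K \<in> over2 I"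
    "K \<in> over2 I \<Longrightarrow> L \<in> over2 I \<Longrightarrow> K - L \<in> over2 I" "K \<in> over2 I \<Longrightarrow> adj2 K \<in> over2 I"
proof -
  have r: "x * a \<in> I" if "a \<in> A" "x \<in> I" for x a
    using fin_ideal_props(4)[OF A(2) that] by (simp add: mult.commute)
  note rules = over2_def r fin_ideal_props(2-4,6,7)[OF A(2)]
  show "B \<in> over2 A \<Longrightarrow> K \<in> over2 I \<Longrightarrow> B * K \<in> over2 I" by (simp add: rules)
  show "B \<in> over2 A \<Longrightarrow> K \<in> over2 I \<Longrightarrow> K * B \<in> over2 I" by (simp add: rules)
  show "0 \<in> over2 I" "K \<in> over2 I \<Longrightarrow> L \<in> over2 I \<Longrightarrow> K + L \<in> over2 I" "K \<in> over2 I \<Longrightarrow> - K \<in> over2 I"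
    "K \<in> over2 I \<Longrightarrow> L \<in> over2 I \<Longrightarrow> K - L \<in> over2 I" "K \<in> over2 I \<Longrightarrow> adj2 K \<in> over2 I"
    by (simp_all add: rules)
qed

lemma congruent_one_mult:
  assumes A: "csubring A" "fin_ideal A I" and "B \<in> over2 A" "B - 1 \<in> over2 I" "C - 1 \<in> over2 I"
  shows "B * C - 1 \<in> over2 I"
proof -
  have "B * C - 1 = B * (C - 1) + (B - 1)" by (simp add: algebra_simps)
  then show ?thesis using assms over2_ideal[OF A] by metis
qed

lemma congruent_one_power:
  assumes "csubring A" "fin_ideal A I" and "B \<in> over2 A" "B - 1 \<in> over2 I"
  shows "B ^ n - 1 \<in> over2 I"
  using assms by (induction n) (auto simp: over2_ideal(3) intro: congruent_one_mult)

text \<open>For \<open>S = 1 + D + ... + D ^ (q - 1)\<close> one has \<open>(D - 1) * S = 0\<close>,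
  so it suffices that \<open>det2 S\<close> is nonzero. Modulo \<open>I\<close>, \<open>S\<close> is
  the scalar \<open>q\<close>, and its determinant \<open>q * q\<close> is a unit because
  \<open>I\<close> contains the prime \<open>p\<close> different from \<open>q\<close>.\<close>

lemma prime_torsion_congruence:
  assumes A: "csubring A" "fin_ideal A I" and D: "D \<in> over2 A" "D - 1 \<in> over2 I" "D ^ q = 1"
    and p: "prime p" "of_nat p \<in> I" and q: "prime q" "p \<noteq> q"
  shows "D = 1"
proof -
  define S where "S = (\<Sum>i<q. D ^ i)"
  have "D * S + 1 = S + D ^ q"
    using sum.lessThan_Suc_shift[of "\<lambda>i. D ^ i" q] by (simp add: S_def sum_distrib_left)
  then have "(D - 1) * S = 0" using D(3) by (simp add: algebra_simps)
  then have "(D - 1) * sc (det2 S) = 0" unfolding mult_adj2[symmetric] by (simp flip: mult.assoc)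
  then have *: "det2 S = 0 \<or> D = 1" by (auto simp: m2_eq_iff)
  have Sq: "(\<Sum>i<n. D ^ i) - sc (of_nat n) \<in> over2 I" for n
  proof (induction n)
    case (Suc n)
    have "(\<Sum>i<Suc n. D ^ i) - sc (of_nat (Suc n)) = ((\<Sum>i<n. D ^ i) - sc (of_nat n)) + (D ^ n - 1)"
      by (simp add: sc_add)
    then show ?case using Suc congruent_one_power[OF A D(1,2)] over2_ideal[OF A] by metis
  qed (simp add: over2_ideal[OF A])
  have SA: "(\<Sum>i<n. D ^ i) \<in> over2 A" for n
    by (induction n) (auto simp: over2_closed[OF A(1)] over2_power[OF A(1) D(1)])
  have "det2 S \<noteq> 0"
  proof
    assume 0: "det2 S = 0"
    let ?q = "of_nat q :: complex"
    have e: "m11 S - ?q \<in> I" "m12 S \<in> I" "m22 S - ?q \<in> I"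
      using Sq[of q] by (simp_all add: over2_def S_def)
    have SA': "m21 S \<in> A" "m22 S \<in> A" using SA[of q] by (simp_all add: over2_def S_def)
    have qA: "of_nat n \<in> A" for n by (induction n) (auto simp: csubring_0[OF A(1)] csubring_1[OF A(1)] csubring_add[OF A(1)])
    have "?q * ?q = - (m22 S * (m11 S - ?q) + ?q * (m22 S - ?q)) + m21 S * m12 S + det2 S"
      by (simp add: det2_def algebra_simps)
    moreover have "- (m22 S * (m11 S - ?q) + ?q * (m22 S - ?q)) + m21 S * m12 S \<in> I"
      by (intro fin_ideal_props(6,7)[OF A(2)] fin_ideal_props(4)[OF A(2)] e SA' qA)
    ultimately have qq: "?q * ?q \<in> I" using 0 by simp
    have zA: "of_int k \<in> A" for k :: int
    proof -
      have "of_int k = (of_nat (nat k) - of_nat (nat (- k)) :: complex)" by (cases "k \<ge> 0") auto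
      then show ?thesis using csubring_diff[OF A(1)] qA by simp
    qed
    have "coprime (int p) (int q * int q)" using p(1) q by (simp add: primes_coprime)
    then have "gcd (int p) (int q * int q) = 1" by (simp add: coprime_iff_gcd_eq_1)
    then obtain u v where uv: "u * int p + v * (int q * int q) = 1" using bezout_int by metis
    have "of_int u * of_nat p + of_int v * (?q * ?q) = 1"
      using arg_cong[OF uv, of "of_int :: int \<Rightarrow> complex"] by simp
    moreover have "of_int u * of_nat p + of_int v * (?q * ?q) \<in> I"
      by (intro fin_ideal_props(7)[OF A(2)] fin_ideal_props(4)[OF A(2)] zA p qq)
    ultimately show False using fin_ideal_props(5)[OF A(2)] by simp
  qed
  then show ?thesis using * by blast
qed

text \<open>Prime factors are removed from the exponent one at a time. Each of them differs from
  \<open>p\<close> or from \<open>q\<close>, so one of the two ideals applies.\<close>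

lemma torsion_congruence_trivial:
  assumes A: "csubring A" "fin_ideal A I" "fin_ideal A J" and D: "D \<in> over2 A" "D - 1 \<in> over2 I" "D - 1 \<in> over2 J"
    and p: "prime p" "of_nat p \<in> I" and q: "prime q" "of_nat q \<in> J" "p \<noteq> q" and n: "D ^ n = 1" "n > 0"
  shows "D = 1"
  using n
proof (induction n rule: less_induct)
  case (less n)
  show ?case
  proof (cases "n = 1")
    case True
    then show ?thesis using less by simp
  next
    case False
    then obtain l where l: "prime l" "l dvd n" using prime_factor_nat by blast
    then obtain m where m: "n = m * l" by (auto simp: dvd_def mult.commute)
    have "(D ^ m) ^ l = 1" using less.prems by (simp add: m power_mult)
    then have "D ^ m = 1"
      using prime_torsion_congruence[OF A(1,2) over2_power[OF A(1) D(1)] congruent_one_power[OF A(1,2) D(1,2)] _ p l(1)]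
        prime_torsion_congruence[OF A(1,3) over2_power[OF A(1) D(1)] congruent_one_power[OF A(1,3) D(1,3)] _ q(1,2) l(1)]
        q(3) by blast
    moreover have "m < n" "m > 0" using less.prems(2) l(1) prime_gt_1_nat by (auto simp: m)
    ultimately show ?thesis using less.IH by blast
  qed
qed

lemma pm1_uminus: "pm1 (- B) \<longleftrightarrow> pm1 B"
  by (metis minus_minus)

lemma square_one_pm1:
  assumes "det2 B = 1" "B * B = 1"
  shows "pm1 B"
proof -
  have "B = B * (B * adj2 B)" using assms(1) by (simp add: mult_adj2)
  also have "\<dots> = adj2 B" using assms(2) by (simp flip: mult.assoc)
  finally have "B = adj2 B" .
  from arg_cong[OF this, of m11] arg_cong[OF this, of m12] arg_cong[OF this, of m21]
  have e: "m11 B = m22 B" "m12 B = 0" "m21 B = 0" by simp_all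
  then have "m22 B * m22 B = 1" using assms(1) by (simp add: det2_def)
  then have "m22 B = 1 \<or> m22 B = - 1" by (metis power2_eq_1_iff power2_eq_square)
  then show ?thesis using e by (auto simp: m2_eq_iff)
qed

text \<open>The sign may differ between the two ideals; passing to squares later removes this
  ambiguity.\<close>

definition pm_cong :: "complex set \<Rightarrow> m2 \<Rightarrow> bool" where
  "pm_cong I B \<longleftrightarrow> B - 1 \<in> over2 I \<or> B + 1 \<in> over2 I"

lemma pm_cong_uminus: "csubring A \<Longrightarrow> fin_ideal A I \<Longrightarrow> pm_cong I B \<Longrightarrow> pm_cong I (- B)"
  using over2_ideal(5)[of A I "B - 1"] over2_ideal(5)[of A I "B + 1"] by (auto simp: pm_cong_def)

lemma pm_cong_mult:
  assumes A: "csubring A" "fin_ideal A I" and B: "B \<in> over2 A" and c: "pm_cong I B" "pm_cong I C"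
  shows "pm_cong I (B * C)"
proof -
  have e: "B * C - 1 = B * (C - 1) + (B - 1)" "B * C + 1 = B * (C + 1) - (B - 1)"
    "B * C + 1 = B * (C - 1) + (B + 1)" "B * C - 1 = B * (C + 1) - (B + 1)"
    by (simp_all add: algebra_simps)
  show ?thesis
    using c B over2_ideal[OF A] unfolding pm_cong_def by (metis e)
qed

lemma pm_cong_adj2: "csubring A \<Longrightarrow> fin_ideal A I \<Longrightarrow> pm_cong I B \<Longrightarrow> pm_cong I (adj2 B)"
proof -
  assume A: "csubring A" "fin_ideal A I" "pm_cong I B"
  have "adj2 B - 1 = adj2 (B - 1)" "adj2 B + 1 = adj2 (B + 1)" by (simp_all add: m2_eq_iff)
  then show ?thesis using A over2_ideal(7)[OF A(1,2)] unfolding pm_cong_def by metis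
qed

lemma pm_cong_conj:
  assumes A: "csubring A" "fin_ideal A I" and C: "C \<in> over2 A" "det2 C = 1" and c: "pm_cong I B"
  shows "pm_cong I (C * B * adj2 C)"
proof -
  have "C * B * adj2 C - 1 = C * (B - 1) * adj2 C" "C * B * adj2 C + 1 = C * (B + 1) * adj2 C"
    using C(2) by (simp_all add: algebra_simps mult_adj2)
  then show ?thesis using c over2_ideal[OF A] over2_closed(6)[OF A(1)] C unfolding pm_cong_def by metis
qed

text \<open>A form of Selberg's lemma for representations up to sign that need not be faithful:
  \<open>N\<close> contains the whole projective kernel, so its torsion can be controlled only up to
  that kernel.\<close>

lemma selberg_projective:
  fixes G (structure) and \<rho> :: "'a \<Rightarrow> m2"
  assumes G: "group G" and fr: "finitely_residual A"
    and over: "\<And>g. g \<in> carrier G \<Longrightarrow> \<rho> g \<in> over2 A" and det: "\<And>g. g \<in> carrier G \<Longrightarrow> det2 (\<rho> g) = 1"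
    and mult: "\<And>g h. g \<in> carrier G \<Longrightarrow> h \<in> carrier G \<Longrightarrow> \<rho> (g \<otimes> h) = \<rho> g * \<rho> h \<or> \<rho> (g \<otimes> h) = - (\<rho> g * \<rho> h)"
  shows "\<exists>N. N \<lhd> G \<and> finite (rcosets N) \<and>
    (\<forall>g\<in>N. \<forall>n>0. g [^] (n::nat) = \<one> \<longrightarrow> pm1 (\<rho> g)) \<and> (\<forall>g\<in>carrier G. pm1 (\<rho> g) \<longrightarrow> g \<in> N)"
proof -
  interpret group G by (rule G)
  have A: "csubring A" using fr by (simp add: finitely_residual_def)
  obtain n where n: "\<And>p. p > n \<Longrightarrow> prime p \<Longrightarrow> \<exists>I. fin_ideal A I \<and> of_nat p \<in> I"
    using fr csubring_1[OF A] unfolding finitely_residual_def by (metis DiffI singletonD zero_neq_one)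
  obtain p where p: "prime p" "p > n" using bigger_prime by blast
  obtain q where q: "prime q" "q > p" using bigger_prime by blast
  obtain I where I: "fin_ideal A I" "of_nat p \<in> I" using n p by blast
  obtain J where J: "fin_ideal A J" "of_nat q \<in> J" using n[of q] p q by auto
  define N where "N = {g \<in> carrier G. pm_cong I (\<rho> g) \<and> pm_cong J (\<rho> g)}"
  have pmc: "pm_cong I B" "pm_cong J B" if "pm1 B" for B
    using that over2_ideal(3)[OF A I(1)] over2_ideal(3)[OF A J(1)] by (auto simp: pm_cong_def)
  have one: "pm1 (\<rho> \<one>)"
  proof -
    have "\<rho> \<one> = \<rho> \<one> * \<rho> \<one> \<or> \<rho> \<one> = - (\<rho> \<one> * \<rho> \<one>)" using mult[of \<one> \<one>] by simp
    then have "\<rho> \<one> * adj2 (\<rho> \<one>) = \<rho> \<one> * (\<rho> \<one> * adj2 (\<rho> \<one>)) \<or>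
        \<rho> \<one> * adj2 (\<rho> \<one>) = - (\<rho> \<one> * (\<rho> \<one> * adj2 (\<rho> \<one>)))" by (metis minus_mult_left mult.assoc)
    then have "\<rho> \<one> = 1 \<or> - \<rho> \<one> = 1" using det[of \<one>] by (auto simp: mult_adj2)
    then show ?thesis by (metis minus_minus)
  qed
  have inv: "\<rho> (inv g) = adj2 (\<rho> g) \<or> \<rho> (inv g) = - adj2 (\<rho> g)" if g: "g \<in> carrier G" for g
  proof -
    have "pm1 (\<rho> (inv g) * \<rho> g)" using mult[of "inv g" g] g one pm1_uminus by (metis l_inv inv_closed)
    moreover have "\<rho> (inv g) = \<rho> (inv g) * \<rho> g * adj2 (\<rho> g)" using det[OF g] by (simp add: mult.assoc mult_adj2)
    ultimately show ?thesis by (metis mult_1 minus_mult_left)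
  qed
  have Nmult: "g \<otimes> h \<in> N" if "g \<in> N" "h \<in> N" for g h
  proof -
    have gh: "g \<in> carrier G" "h \<in> carrier G" using that by (auto simp: N_def)
    have "pm_cong I (\<rho> g * \<rho> h)" "pm_cong J (\<rho> g * \<rho> h)"
      using that over by (auto simp: N_def intro: pm_cong_mult[OF A I(1)] pm_cong_mult[OF A J(1)])
    then have "pm_cong I (\<rho> (g \<otimes> h))" "pm_cong J (\<rho> (g \<otimes> h))"
      using mult[OF gh] pm_cong_uminus[OF A I(1)] pm_cong_uminus[OF A J(1)] by metis+
    then show ?thesis using gh by (simp add: N_def)
  qed
  have Ninv: "inv g \<in> N" if "g \<in> N" for g
  proof -
    have g: "g \<in> carrier G" using that by (auto simp: N_def)
    have "pm_cong I (adj2 (\<rho> g))" "pm_cong J (adj2 (\<rho> g))"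
      using that pm_cong_adj2[OF A I(1)] pm_cong_adj2[OF A J(1)] by (auto simp: N_def)
    then have "pm_cong I (\<rho> (inv g))" "pm_cong J (\<rho> (inv g))"
      using inv[OF g] pm_cong_uminus[OF A I(1)] pm_cong_uminus[OF A J(1)] by metis+
    then show ?thesis using g by (simp add: N_def)
  qed
  have sub: "subgroup N G"
    using Nmult Ninv one pmc by unfold_locales (auto simp: N_def)
  have Nconj: "x \<otimes> h \<otimes> inv x \<in> N" if x: "x \<in> carrier G" and h: "h \<in> N" for x h
  proof -
    have hG: "h \<in> carrier G" using h by (auto simp: N_def)
    have "\<rho> (x \<otimes> h \<otimes> inv x) = \<rho> x * \<rho> h * adj2 (\<rho> x) \<or> \<rho> (x \<otimes> h \<otimes> inv x) = - (\<rho> x * \<rho> h * adj2 (\<rho> x))"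
      using mult[of "x \<otimes> h" "inv x"] mult[of x h] inv[OF x] x hG by auto
    moreover have "pm_cong I (\<rho> x * \<rho> h * adj2 (\<rho> x))" "pm_cong J (\<rho> x * \<rho> h * adj2 (\<rho> x))"
      using h pm_cong_conj[OF A I(1) over[OF x] det[OF x]] pm_cong_conj[OF A J(1) over[OF x] det[OF x]]
      by (auto simp: N_def)
    ultimately have "pm_cong I (\<rho> (x \<otimes> h \<otimes> inv x))" "pm_cong J (\<rho> (x \<otimes> h \<otimes> inv x))"
      using pm_cong_uminus[OF A I(1)] pm_cong_uminus[OF A J(1)] by metis+
    then show ?thesis using x hG by (simp add: N_def)
  qed
  have normal: "N \<lhd> G" using sub Nconj by (simp add: normal_inv_iff)
  have rep: "\<exists>T r. finite T \<and> (\<forall>a\<in>A. r a \<in> T \<and> a - r a \<in> K)" if K: "fin_ideal A K" for K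
  proof -
    obtain T where T: "finite T" "\<forall>a\<in>A. \<exists>t\<in>T. a - t \<in> K" using K unfolding fin_ideal_def by blast
    then obtain r where "\<forall>a\<in>A. r a \<in> T \<and> a - r a \<in> K" by metis
    then show ?thesis using T(1) by blast
  qed
  obtain T r where T: "finite T" and r: "\<And>a. a \<in> A \<Longrightarrow> r a \<in> T \<and> a - r a \<in> I" using rep[OF I(1)] by blast
  obtain T' r' where T': "finite T'" and r': "\<And>a. a \<in> A \<Longrightarrow> r' a \<in> T' \<and> a - r' a \<in> J" using rep[OF J(1)] by blast
  \<comment> \<open>The residue representatives of the entries take finitely many values, and
    elements that agree in them modulo both ideals lie in one coset of \<open>N\<close>.\<close>
  define code where "code s B = (s (m11 B), s (m12 B), s (m21 B), s (m22 B))" for s :: "complex \<Rightarrow> complex" and B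
  define F where "F g = (code r (\<rho> g), code r' (\<rho> g))" for g
  have "finite (F ` carrier G)"
  proof (rule finite_subset)
    show "F ` carrier G \<subseteq> (T \<times> T \<times> T \<times> T) \<times> (T' \<times> T' \<times> T' \<times> T')"
      using over r r' by (auto simp: F_def code_def over2_def)
  qed (use T T' in simp)
  have same: "B - C \<in> over2 K"
    if K: "fin_ideal A K" and s: "\<And>a. a \<in> A \<Longrightarrow> a - s a \<in> K" and BC: "B \<in> over2 A" "C \<in> over2 A" "code s B = code s C"
    for K s B C
  proof -
    have "x - y \<in> K" if "x \<in> A" "y \<in> A" "s x = s y" for x y
      using fin_ideal_props(3)[OF K s[OF that(1)] s[OF that(2)]] that(3) by simp
    then show ?thesis using BC by (auto simp: over2_def code_def)
  qed
  have close: "pm_cong K (B * adj2 C)" if K: "fin_ideal A K" and BC: "B - C \<in> over2 K" "C \<in> over2 A" "det2 C = 1" for K B C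
  proof -
    have "B * adj2 C - 1 = (B - C) * adj2 C" using BC(3) by (simp add: left_diff_distrib mult_adj2)
    then show ?thesis unfolding pm_cong_def using over2_ideal(2)[OF A K _ BC(1)] over2_closed(6)[OF A BC(2)] by metis
  qed
  have coset: "N #> g = N #> h" if g: "g \<in> carrier G" and h: "h \<in> carrier G" and eq: "F g = F h" for g h
  proof -
    have c: "code r (\<rho> g) = code r (\<rho> h)" "code r' (\<rho> g) = code r' (\<rho> h)" using eq by (simp_all add: F_def)
    have "\<rho> g - \<rho> h \<in> over2 I" by (rule same[OF I(1) _ over[OF g] over[OF h] c(1)]) (simp add: r)
    moreover have "\<rho> g - \<rho> h \<in> over2 J" by (rule same[OF J(1) _ over[OF g] over[OF h] c(2)]) (simp add: r')
    ultimately have "pm_cong I (\<rho> g * adj2 (\<rho> h))" "pm_cong J (\<rho> g * adj2 (\<rho> h))"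
      using close[OF I(1) _ over[OF h] det[OF h]] close[OF J(1) _ over[OF h] det[OF h]] by simp_all
    moreover have "\<rho> (g \<otimes> inv h) = \<rho> g * adj2 (\<rho> h) \<or> \<rho> (g \<otimes> inv h) = - (\<rho> g * adj2 (\<rho> h))"
      using mult[of g "inv h"] inv[OF h] g h by auto
    ultimately have "pm_cong I (\<rho> (g \<otimes> inv h))" "pm_cong J (\<rho> (g \<otimes> inv h))"
      using pm_cong_uminus[OF A I(1)] pm_cong_uminus[OF A J(1)] by metis+
    then have "g \<otimes> inv h \<in> N" using g h by (simp add: N_def)
    moreover have "g = (g \<otimes> inv h) \<otimes> h" using g h by (simp add: m_assoc)
    ultimately have "g \<in> N #> h" unfolding r_coset_def by blast
    then show ?thesis using repr_independence[OF _ h sub] by metis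
  qed
  have "finite ((\<lambda>g. N #> g) ` carrier G)"
  proof (rule finite_subset)
    show "(\<lambda>g. N #> g) ` carrier G \<subseteq> (\<lambda>y. N #> (SOME h. h \<in> carrier G \<and> F h = y)) ` (F ` carrier G)"
    proof
      fix Y assume "Y \<in> (\<lambda>g. N #> g) ` carrier G"
      then obtain g where g: "g \<in> carrier G" "Y = N #> g" by auto
      define h where "h = (SOME h. h \<in> carrier G \<and> F h = F g)"
      have "h \<in> carrier G \<and> F h = F g" unfolding h_def by (rule someI[of _ g]) (simp add: g)
      then have "Y = N #> h" using coset[OF g(1), of h] g(2) by simp
      then show "Y \<in> (\<lambda>y. N #> (SOME h. h \<in> carrier G \<and> F h = y)) ` (F ` carrier G)" unfolding h_def using g(1) by blast
    qed
  qed (use \<open>finite (F ` carrier G)\<close> in simp)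
  moreover have "rcosets N = (\<lambda>g. N #> g) ` carrier G" by (auto simp: RCOSETS_def)
  ultimately have fin: "finite (rcosets N)" by simp
  have tors: "pm1 (\<rho> g)" if g: "g \<in> N" and n: "n > 0" "g [^] n = \<one>" for g and n :: nat
  proof -
    have gG: "g \<in> carrier G" using g by (simp add: N_def)
    have pow: "\<rho> (g [^] m) = \<rho> g ^ m \<or> \<rho> (g [^] m) = - (\<rho> g ^ m)" for m :: nat
    proof (induction m)
      case 0
      then show ?case using one by simp
    next
      case (Suc m)
      then show ?case using mult[of "g [^] m" g] gG by (auto simp: power_Suc2 simp del: power_Suc)
    qed
    have "pm1 (\<rho> g ^ n)" using pow[of n] n(2) one pm1_uminus by metis
    \<comment> \<open>Squaring removes the sign of \<open>\<rho> g ^ n\<close> and the signs of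
      \<open>\<rho> g\<close> modulo both ideals at once, so
      \<open>torsion_congruence_trivial\<close> applies to the square.\<close>
    then have "(\<rho> g * \<rho> g) ^ n = 1"
      using pm1_square[of "\<rho> g ^ n"] by (metis power2_eq_square power_mult mult.commute)
    moreover have "\<rho> g * \<rho> g - 1 \<in> over2 K" if K: "fin_ideal A K" "pm_cong K (\<rho> g)" for K
    proof -
      have "\<rho> g * \<rho> g - 1 = \<rho> g * (\<rho> g - 1) + (\<rho> g - 1)" "\<rho> g * \<rho> g - 1 = \<rho> g * (\<rho> g + 1) - (\<rho> g + 1)"
        by (simp_all add: algebra_simps)
      then show ?thesis using K(2) over2_ideal[OF A K(1)] over[OF gG] unfolding pm_cong_def by metis
    qed
    ultimately have "\<rho> g * \<rho> g = 1"
      using torsion_congruence_trivial[OF A I(1) J(1) over2_closed(3)[OF A over[OF gG] over[OF gG]] _ _ p(1) I(2) q(1) J(2)]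
        g I(1) J(1) n(1) q(2) by (auto simp: N_def)
    then show ?thesis using square_one_pm1 det[OF gG] by blast
  qed
  have "\<forall>g\<in>carrier G. pm1 (\<rho> g) \<longrightarrow> g \<in> N" using pmc by (auto simp: N_def)
  then show ?thesis using normal fin tors by blast
qed

section \<open>Deformation of a presented group\<close>

lemma word_value_Nil [simp]: "word_value G \<phi> [] = \<one>\<^bsub>G\<^esub>"
  and word_value_Cons [simp]: "word_value G \<phi> ((x, b) # w) =
    (if b then \<phi> x else inv\<^bsub>G\<^esub> \<phi> x) \<otimes>\<^bsub>G\<^esub> word_value G \<phi> w"
  by (simp_all add: word_value_def)

definition inv_word :: "'x word \<Rightarrow> 'x word" where
  "inv_word w = rev (map (\<lambda>(x, b). (x, \<not> b)) w)"

lemma inv_word_in_lists: "w \<in> lists (X \<times> UNIV) \<Longrightarrow> inv_word w \<in> lists (X \<times> UNIV)"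
  by (auto simp: inv_word_def in_lists_conv_set)

lemma word_power_in_lists: "w \<in> lists A \<Longrightarrow> word_power w n \<in> lists A"
  by (induction n) (simp_all add: word_power_def)

lemma ev_inv_word: "ev M (inv_word w) = adj2 (ev M w)"
  by (induction w) (auto simp: inv_word_def adj2_mult)

context group
begin

lemma word_value_closed:
  "w \<in> lists (X \<times> UNIV) \<Longrightarrow> \<phi> ` X \<subseteq> carrier G \<Longrightarrow> word_value G \<phi> w \<in> carrier G"
  by (induction w rule: lists.induct) auto

lemma word_value_append:
  assumes "u \<in> lists (X \<times> UNIV)" "v \<in> lists (X \<times> UNIV)" "\<phi> ` X \<subseteq> carrier G"
  shows "word_value G \<phi> (u @ v) = word_value G \<phi> u \<otimes> word_value G \<phi> v"
  using assms(1)
proof (induction u rule: lists.induct)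
  case Nil
  then show ?case using word_value_closed[OF assms(2,3)] by simp
next
  case (Cons l u)
  obtain x b where l: "l = (x, b)" "x \<in> X" using Cons by auto
  then have "\<phi> x \<in> carrier G" using assms(3) by auto
  then show ?case
    using Cons word_value_closed[OF _ assms(3)] assms(2) by (auto simp: l(1) m_assoc)
qed

lemma word_value_inv_word:
  assumes "w \<in> lists (X \<times> UNIV)" "\<phi> ` X \<subseteq> carrier G"
  shows "word_value G \<phi> (inv_word w) = inv (word_value G \<phi> w)"
  using assms(1)
proof (induction w rule: lists.induct)
  case (Cons l w)
  obtain x b where l: "l = (x, b)" "x \<in> X" using Cons by auto
  have x: "\<phi> x \<in> carrier G" using assms(2) l by auto
  have "inv_word (l # w) = inv_word w @ [(x, \<not> b)]" by (simp add: inv_word_def l)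
  moreover have "[(x, \<not> b)] \<in> lists (X \<times> UNIV)" using l by simp
  ultimately have "word_value G \<phi> (inv_word (l # w)) = inv (word_value G \<phi> w) \<otimes> word_value G \<phi> [(x, \<not> b)]"
    using word_value_append[OF inv_word_in_lists[OF Cons(2)] _ assms(2)] Cons.IH by simp
  then show ?case using x word_value_closed[OF Cons(2) assms(2)] by (auto simp: l(1) inv_mult_group)
qed (simp add: inv_word_def)

lemma word_value_power:
  assumes "w \<in> lists (X \<times> UNIV)" "\<phi> ` X \<subseteq> carrier G"
  shows "word_value G \<phi> (word_power w n) = word_value G \<phi> w [^] n"
proof (induction n)
  case (Suc n)
  have "word_power w (Suc n) = w @ word_power w n" by (simp add: word_power_def)
  then show ?case
    using Suc word_value_append[OF assms(1) word_power_in_lists[OF assms(1)] assms(2)]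
      nat_pow_Suc2[OF word_value_closed[OF assms]] by simp
qed (simp add: word_power_def)

lemma generate_word_value:
  assumes "g \<in> generate G (\<phi> ` X)" "\<phi> ` X \<subseteq> carrier G"
  shows "\<exists>w\<in>lists (X \<times> UNIV). word_value G \<phi> w = g"
  using assms(1)
proof (induction rule: generate.induct)
  case one
  show ?case by (rule bexI[of _ "[]"]) simp_all
next
  case (incl h)
  then obtain x where "x \<in> X" "h = \<phi> x" by auto
  then show ?case using assms(2) by (intro bexI[of _ "[(x, True)]"]) auto
next
  case (inv h)
  then obtain x where "x \<in> X" "h = \<phi> x" by auto
  then show ?case using assms(2) by (intro bexI[of _ "[(x, False)]"]) auto
next
  case (eng h1 h2)
  then show ?case using word_value_append[OF _ _ assms(2)] by (metis append_in_lists_conv)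
qed

text \<open>Faithfulness is asked for only at time 0 and triviality of \<open>w0\<close> only at
  time 1. A torsion element of \<open>N\<close> is represented by one word, a power of which is
  trivial all along the path; so \<open>torsion_rigidity\<close> carries \<plusminus>1 from the end
  back to the start.\<close>

lemma deformation_criterion:
  fixes X :: "'x set" and M :: "real \<Rightarrow> 'x \<Rightarrow> m2"
  assumes pres: "presentation G X R \<phi>" and fin: "finite X"
    and det: "\<And>t x. t \<in> {0..1} \<Longrightarrow> x \<in> X \<Longrightarrow> det2 (M t x) = 1"
    and cont: "\<And>x. x \<in> X \<Longrightarrow> continuous_on {0..1} (\<lambda>t. m11 (M t x)) \<and> continuous_on {0..1} (\<lambda>t. m12 (M t x)) \<and>
      continuous_on {0..1} (\<lambda>t. m21 (M t x)) \<and> continuous_on {0..1} (\<lambda>t. m22 (M t x))"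
    and rel: "\<And>t r. t \<in> {0..1} \<Longrightarrow> r \<in> R \<Longrightarrow> pm1 (ev (M t) r)"
    and faithful: "\<And>w. w \<in> lists (X \<times> UNIV) \<Longrightarrow> pm1 (ev (M 0) w) \<Longrightarrow> word_value G \<phi> w = \<one>"
    and w0: "w0 \<in> lists (X \<times> UNIV)" "pm1 (ev (M 1) w0)"
  shows "\<exists>N. N \<lhd> G \<and> finite (rcosets N) \<and> (\<forall>g\<in>N. \<forall>n>0. g [^] (n::nat) = \<one> \<longrightarrow> g = \<one>) \<and>
    word_value G \<phi> w0 \<in> N"
proof -
  have \<phi>: "\<phi> ` X \<subseteq> carrier G" and gen: "generate G (\<phi> ` X) = carrier G"
    and triv: "\<And>w. w \<in> lists (X \<times> UNIV) \<Longrightarrow> word_value G \<phi> w = \<one> \<longleftrightarrow> word_eq X R w []"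
    using pres by (auto simp: presentation_def)
  have kernel: "pm1 (ev (M t) w)"
    if t: "t \<in> {0..1}" and w: "w \<in> lists (X \<times> UNIV)" "word_value G \<phi> w = \<one>" for t w
    using word_eq_ev[of X R w "[]" "M t"] triv[OF w(1)] w(2) det[OF t] rel[OF t] by simp
  have det_ev: "det2 (ev (M t) w) = 1" if "t \<in> {0..1}" "w \<in> lists (X \<times> UNIV)" for t w
    using det2_ev[OF that(2)] det that(1) by blast
  \<comment> \<open>The assignments are homomorphisms only up to sign, so \<open>\<rho>\<close>
    evaluates one chosen word per element; any other word changes at most the sign.\<close>
  define W where "W g = (SOME w. w \<in> lists (X \<times> UNIV) \<and> word_value G \<phi> w = g)" for g
  have W: "W g \<in> lists (X \<times> UNIV)" "word_value G \<phi> (W g) = g" if "g \<in> carrier G" for g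
  proof -
    have "\<exists>w. w \<in> lists (X \<times> UNIV) \<and> word_value G \<phi> w = g"
      using generate_word_value[OF _ \<phi>] gen that by blast
    then have "W g \<in> lists (X \<times> UNIV) \<and> word_value G \<phi> (W g) = g" unfolding W_def by (rule someI_ex)
    then show "W g \<in> lists (X \<times> UNIV)" "word_value G \<phi> (W g) = g" by blast+
  qed
  define \<rho> where "\<rho> g = ev (M 1) (W g)" for g
  have \<rho>_word: "\<rho> (word_value G \<phi> w) = ev (M 1) w \<or> \<rho> (word_value G \<phi> w) = - ev (M 1) w"
    if w: "w \<in> lists (X \<times> UNIV)" for w
  proof -
    let ?g = "word_value G \<phi> w"
    have g: "?g \<in> carrier G" by (rule word_value_closed[OF w \<phi>])
    have "word_value G \<phi> (W ?g @ inv_word w) = \<one>"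
      using word_value_append[OF W(1)[OF g] inv_word_in_lists[OF w] \<phi>] word_value_inv_word[OF w \<phi>] W(2)[OF g] g by simp
    then have "pm1 (\<rho> ?g * adj2 (ev (M 1) w))"
      using kernel[of 1 "W ?g @ inv_word w"] W(1)[OF g] inv_word_in_lists[OF w] by (simp add: \<rho>_def ev_inv_word)
    moreover have "\<rho> ?g = \<rho> ?g * adj2 (ev (M 1) w) * ev (M 1) w"
      using det_ev[of 1 w] w by (simp add: mult.assoc adj2_mult_self)
    ultimately show ?thesis by (metis mult_1 minus_mult_left)
  qed
  \<comment> \<open>Finitely many generators give finitely many entries, and inverses add no
    denominators, being adjugates.\<close>
  define S where "S = (\<Union>x\<in>X. {m11 (M 1 x), m12 (M 1 x), m21 (M 1 x), m22 (M 1 x)})"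
  obtain A where A: "finitely_residual A" "S \<subseteq> A" using finitely_residual_exists[of S] fin by (auto simp: S_def)
  have subA: "csubring A" using A(1) by (simp add: finitely_residual_def)
  have ev_over: "ev (M 1) w \<in> over2 A" if "w \<in> lists (X \<times> UNIV)" for w
    using that
  proof (induction w rule: lists.induct)
    case (Cons l w)
    obtain x b where l: "l = (x, b)" "x \<in> X" using Cons by auto
    have "M 1 x \<in> over2 A" using A(2) l(2) by (auto simp: over2_def S_def)
    then show ?case using Cons.IH over2_closed(3,6)[OF subA] by (simp add: l(1))
  qed (simp add: over2_closed[OF subA])
  have "\<exists>N. N \<lhd> G \<and> finite (rcosets N) \<and>
    (\<forall>g\<in>N. \<forall>n>0. g [^] (n::nat) = \<one> \<longrightarrow> pm1 (\<rho> g)) \<and> (\<forall>g\<in>carrier G. pm1 (\<rho> g) \<longrightarrow> g \<in> N)"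
  proof (rule selberg_projective[OF group_axioms A(1)])
    show "\<rho> g \<in> over2 A" "det2 (\<rho> g) = 1" if "g \<in> carrier G" for g
      using ev_over det_ev[of 1] W(1)[OF that] by (auto simp: \<rho>_def)
    show "\<rho> (g \<otimes> h) = \<rho> g * \<rho> h \<or> \<rho> (g \<otimes> h) = - (\<rho> g * \<rho> h)" if "g \<in> carrier G" "h \<in> carrier G" for g h
      using \<rho>_word[of "W g @ W h"] word_value_append[of "W g" X "W h" \<phi>] W that \<phi> by (simp add: \<rho>_def)
  qed
  then obtain N where N: "N \<lhd> G" "finite (rcosets N)"
    "\<And>g n. g \<in> N \<Longrightarrow> n > 0 \<Longrightarrow> g [^] (n::nat) = \<one> \<Longrightarrow> pm1 (\<rho> g)"
    "\<And>g. g \<in> carrier G \<Longrightarrow> pm1 (\<rho> g) \<Longrightarrow> g \<in> N" by blast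
  have "g = \<one>" if g: "g \<in> N" and n: "n > 0" "g [^] n = \<one>" for g and n :: nat
  proof -
    have gG: "g \<in> carrier G" using subgroup.subset[OF normal_imp_subgroup[OF N(1)]] g by (rule subsetD)
    note W = W[OF gG]
    have "word_value G \<phi> (word_power (W g) n) = \<one>" using word_value_power[OF W(1) \<phi>] W(2) n(2) by simp
    then have tors: "pm1 (ev (M t) (W g) ^ n)" if "t \<in> {0..1}" for t
      using kernel[OF that word_power_in_lists[OF W(1)]] by (simp add: ev_word_power)
    have "pm1 (ev (M 0) (W g))"
    proof (rule torsion_rigidity[where A = "\<lambda>t. ev (M t) (W g)", OF _ _ tors n(1)])
      show "continuous_on {0..1} (\<lambda>t. tr2 (ev (M t) (W g)))"
        using ev_continuous[OF W(1) cont] unfolding tr2_def by (auto intro: continuous_on_add)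
      show "pm1 (ev (M 1) (W g))" using N(3)[OF g n] by (simp add: \<rho>_def)
    qed (use det_ev W(1) in auto)
    then show ?thesis using faithful[OF W(1)] W(2) by simp
  qed
  moreover have "word_value G \<phi> w0 \<in> N"
    using N(4)[OF word_value_closed[OF w0(1) \<phi>]] \<rho>_word[OF w0(1)] w0(2) pm1_uminus by metis
  ultimately show ?thesis using N(1,2) by blast
qed

end

text \<open>Equality of truth values is the multiplication of the group of order two with identity
  \<open>True\<close>. This is the orientation character read off a word, \<open>True\<close>
  meaning that orientation is preserved.\<close>

definition word_sign :: "('x \<Rightarrow> bool) \<Rightarrow> 'x word \<Rightarrow> bool" where
  "word_sign s w = foldr (\<lambda>(x, _) b. s x = b) w True"

lemma word_sign_simps [simp]:
  "word_sign s [] = True" "word_sign s ((x, b) # w) = (s x = word_sign s w)"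
  "word_sign s (u @ v) = (word_sign s u = word_sign s v)"
proof -
  show "word_sign s (u @ v) = (word_sign s u = word_sign s v)"
    by (induction u) (auto simp: word_sign_def)
qed (simp_all add: word_sign_def)

lemma one_hyp_isom: "\<one>\<^bsub>hyp_isom\<lparr>carrier := \<Gamma>\<rparr>\<^esub> = (\<lambda>z\<in>hyp_plane. z)"
  and mult_hyp_isom: "f \<in> carrier hyp_isom \<Longrightarrow> g \<in> carrier hyp_isom \<Longrightarrow>
    f \<otimes>\<^bsub>hyp_isom\<lparr>carrier := \<Gamma>\<rparr>\<^esub> g = compose hyp_plane f g"
  by (simp_all add: hyp_isom_def BijGroup_def)

lemma inv_hyp_isom:
  assumes "subgroup \<Gamma> hyp_isom" "f \<in> \<Gamma>"
  shows "inv\<^bsub>hyp_isom\<lparr>carrier := \<Gamma>\<rparr>\<^esub> f = restrict (inv_into hyp_plane f) hyp_plane"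
proof -
  have f: "f \<in> carrier hyp_isom" using subgroup.subset[OF assms(1)] assms(2) by (rule subsetD)
  have eq: "(BijGroup hyp_plane)\<lparr>carrier := carrier hyp_isom\<rparr> = hyp_isom" by (simp add: hyp_isom_def)
  have "inv\<^bsub>hyp_isom\<lparr>carrier := \<Gamma>\<rparr>\<^esub> f = inv\<^bsub>hyp_isom\<^esub> f"
    using group.m_inv_consistent[OF group_hyp_isom assms] .
  also have "\<dots> = inv\<^bsub>BijGroup hyp_plane\<^esub> f"
    using group.m_inv_consistent[OF group_BijGroup subgroup_hyp_isom f] by (simp only: eq)
  also have "\<dots> = restrict (inv_into hyp_plane f) hyp_plane"
    using f by (intro inv_BijGroup) (simp add: hyp_isom_def)
  finally show ?thesis .
qed

lemma lifts_word_value: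
  assumes \<Gamma>: "subgroup \<Gamma> hyp_isom" and \<phi>: "\<phi> ` X \<subseteq> \<Gamma>" and M: "\<And>x. x \<in> X \<Longrightarrow> lifts (s x) (\<phi> x) (M x)"
    and w: "w \<in> lists (X \<times> UNIV)"
  shows "lifts (word_sign s w) (word_value (hyp_isom\<lparr>carrier := \<Gamma>\<rparr>) \<phi> w) (ev M w)"
  using w
proof (induction w rule: lists.induct)
  case Nil
  show ?case unfolding word_value_Nil one_hyp_isom ev_Nil word_sign_simps(1) by (rule lifts_one)
next
  case (Cons l w)
  let ?G = "hyp_isom\<lparr>carrier := \<Gamma>\<rparr>"
  interpret G: group ?G using subgroup.subgroup_is_group[OF \<Gamma> group_hyp_isom] .
  obtain x b where l: "l = (x, b)" "x \<in> X" using Cons by auto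
  have iso: "f \<in> carrier hyp_isom" if "f \<in> \<Gamma>" for f using subgroup.subset[OF \<Gamma>] that by (rule subsetD)
  have wv: "word_value ?G \<phi> w \<in> \<Gamma>" using G.word_value_closed[OF Cons(2)] \<phi> by simp
  have x: "\<phi> x \<in> \<Gamma>" using \<phi> l by auto
  then have xB: "\<phi> x \<in> Bij hyp_plane" using iso by (auto simp: hyp_isom_def)
  let ?f = "if b then \<phi> x else inv\<^bsub>?G\<^esub> \<phi> x"
  have "?f \<in> \<Gamma>" using G.inv_closed[of "\<phi> x"] x by simp
  then have "word_value ?G \<phi> (l # w) = compose hyp_plane ?f (word_value ?G \<phi> w)"
    unfolding l(1) word_value_Cons using mult_hyp_isom[OF iso iso] wv by simp
  moreover have "lifts (s x) ?f (if b then M x else adj2 (M x))"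
    using M[OF l(2)] lifts_inverse[OF _ xB] inv_hyp_isom[OF \<Gamma> x] by simp
  moreover have "word_value ?G \<phi> w \<in> hyp_plane \<rightarrow> hyp_plane"
    using iso[OF wv] Bij_imp_funcset by (auto simp: hyp_isom_def)
  ultimately show ?case using lifts_compose[OF _ Cons.IH] by (simp add: l(1))
qed

lemma lifts_pm1:
  assumes "lifts b f A" "pm1 A" "f \<in> carrier hyp_isom"
  shows "f = (\<lambda>z\<in>hyp_plane. z)"
proof -
  have b: b
  proof (rule ccontr)
    assume "\<not> b"
    then have "imag2 A" using assms(1) by (simp add: lifts_def)
    then show False using assms(2) by (auto simp: imag2_def)
  qed
  have "mob A z = z" for z using assms(2) by (auto simp: mob_def)
  then have "f z = z" if "z \<in> hyp_plane" for z using assms(1) b that by (simp add: lifts_def)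
  moreover have "f \<in> extensional hyp_plane" using assms(3) by (auto simp: hyp_isom_def Bij_def)
  ultimately show ?thesis by (auto simp: extensional_def)
qed

section \<open>Matrix-valued Laurent polynomials and paths\<close>

text \<open>The value at 0 is left free. Functions of this class are continuous along paths avoiding
  0 and have finitely many nonzero zeros once they are nonzero somewhere off 0; the deformations use
  just these two facts.\<close>

definition laurent :: "(complex \<Rightarrow> complex) \<Rightarrow> bool" where
  "laurent f \<longleftrightarrow> (\<exists>p n. \<forall>z. z \<noteq> 0 \<longrightarrow> z ^ n * f z = poly p z)"

lemma laurent_const [simp]: "laurent (\<lambda>z. c)"
  unfolding laurent_def by (rule exI[of _ "[:c:]"], rule exI[of _ 0]) simp

lemma laurent_ident [simp]: "laurent (\<lambda>z. z)"
  unfolding laurent_def by (rule exI[of _ "[:0, 1:]"], rule exI[of _ 0]) simp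

lemma laurent_inverse [simp]: "laurent inverse"
  unfolding laurent_def by (rule exI[of _ "[:1:]"], rule exI[of _ 1]) simp

lemma laurent_mult:
  assumes "laurent f" "laurent g"
  shows "laurent (\<lambda>z. f z * g z)"
proof -
  obtain p n q m where p: "\<And>z. z \<noteq> 0 \<Longrightarrow> z ^ n * f z = poly p z" and q: "\<And>z. z \<noteq> 0 \<Longrightarrow> z ^ m * g z = poly q z"
    using assms unfolding laurent_def by blast
  have "z ^ (n + m) * (f z * g z) = poly (p * q) z" if "z \<noteq> 0" for z
  proof -
    have "z ^ (n + m) * (f z * g z) = (z ^ n * f z) * (z ^ m * g z)" by (simp add: power_add ac_simps)
    then show ?thesis using p q that by simp
  qed
  then show ?thesis unfolding laurent_def by blast
qed

lemma laurent_add: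
  assumes "laurent f" "laurent g"
  shows "laurent (\<lambda>z. f z + g z)"
proof -
  obtain p n q m where p: "\<And>z. z \<noteq> 0 \<Longrightarrow> z ^ n * f z = poly p z" and q: "\<And>z. z \<noteq> 0 \<Longrightarrow> z ^ m * g z = poly q z"
    using assms unfolding laurent_def by blast
  have "z ^ (n + m) * (f z + g z) = poly (monom 1 m * p + monom 1 n * q) z" if "z \<noteq> 0" for z
  proof -
    have "z ^ (n + m) * (f z + g z) = z ^ m * (z ^ n * f z) + z ^ n * (z ^ m * g z)"
      by (simp add: power_add algebra_simps)
    then show ?thesis using p q that by (simp add: poly_monom)
  qed
  then show ?thesis unfolding laurent_def by blast
qed

lemma laurent_uminus: "laurent f \<Longrightarrow> laurent (\<lambda>z. - f z)"
  using laurent_mult[OF laurent_const[of "- 1"]] by simp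

lemma laurent_diff: "laurent f \<Longrightarrow> laurent g \<Longrightarrow> laurent (\<lambda>z. f z - g z)"
  using laurent_add[OF _ laurent_uminus, of f g] by simp

lemmas laurent_intros = laurent_const laurent_ident laurent_inverse laurent_mult laurent_add laurent_uminus laurent_diff

lemma laurent_finite_zeros:
  assumes "laurent f" "z0 \<noteq> 0" "f z0 \<noteq> 0"
  shows "finite {z. z \<noteq> 0 \<and> f z = 0}"
proof -
  obtain p n where p: "\<And>z. z \<noteq> 0 \<Longrightarrow> z ^ n * f z = poly p z" using assms unfolding laurent_def by blast
  have "poly p z0 \<noteq> 0" using p[OF assms(2)] assms(2,3) by (metis no_zero_divisors power_eq_0_iff)
  then have "finite {z. poly p z = 0}" by (intro poly_roots_finite) auto
  moreover have "{z. z \<noteq> 0 \<and> f z = 0} \<subseteq> {z. poly p z = 0}"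
    using p by (auto simp flip: p)
  ultimately show ?thesis by (rule rev_finite_subset)
qed

lemma laurent_continuous_on:
  assumes "laurent f" "continuous_on S \<gamma>" "\<And>t. t \<in> S \<Longrightarrow> \<gamma> t \<noteq> 0"
  shows "continuous_on S (\<lambda>t. f (\<gamma> t))"
proof -
  obtain p n where p: "\<And>z. z \<noteq> 0 \<Longrightarrow> z ^ n * f z = poly p z" using assms unfolding laurent_def by blast
  have "f (\<gamma> t) = poly p (\<gamma> t) / \<gamma> t ^ n" if "t \<in> S" for t
    using p[OF assms(3)[OF that]] assms(3)[OF that] by (simp add: field_simps)
  moreover have "continuous_on S (\<lambda>t. poly p (\<gamma> t) / \<gamma> t ^ n)"
    using assms(2,3) by (intro continuous_intros) auto
  ultimately show ?thesis by (simp cong: continuous_on_cong)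
qed

definition laurent2 :: "(complex \<Rightarrow> m2) \<Rightarrow> bool" where
  "laurent2 A \<longleftrightarrow> laurent (\<lambda>z. m11 (A z)) \<and> laurent (\<lambda>z. m12 (A z)) \<and>
    laurent (\<lambda>z. m21 (A z)) \<and> laurent (\<lambda>z. m22 (A z))"

lemma laurent2_const [simp]: "laurent2 (\<lambda>z. K)"
  and laurent2_sc: "laurent f \<Longrightarrow> laurent2 (\<lambda>z. sc (f z))"
  and laurent2_mult: "laurent2 A \<Longrightarrow> laurent2 B \<Longrightarrow> laurent2 (\<lambda>z. A z * B z)"
  and laurent2_add: "laurent2 A \<Longrightarrow> laurent2 B \<Longrightarrow> laurent2 (\<lambda>z. A z + B z)"
  and laurent2_adj2: "laurent2 A \<Longrightarrow> laurent2 (\<lambda>z. adj2 (A z))"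
  and laurent_tr2: "laurent2 A \<Longrightarrow> laurent (\<lambda>z. tr2 (A z))"
  by (simp_all add: laurent2_def tr2_def laurent_intros)

lemma laurent2_prod_list:
  "(\<And>i. i \<in> set is \<Longrightarrow> laurent2 (\<lambda>z. A z i)) \<Longrightarrow> laurent2 (\<lambda>z. prod_list (map (A z) is))"
  by (induction "is") (auto intro: laurent2_mult)

text \<open>The equation is \<open>a * z\<^sup>2 - c * z + b = 0\<close>. Since \<open>c\<close> is
  nonzero, at least one of \<open>c + s\<close> and \<open>c - s\<close> is, which gives a nonzero
  root.\<close>

lemma laurent_value_exists:
  fixes a b c :: complex
  assumes "a \<noteq> 0 \<or> b \<noteq> 0" "c \<noteq> 0"
  shows "\<exists>z. z \<noteq> 0 \<and> a * z + b * inverse z = c"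
proof (cases "a = 0")
  case True
  then show ?thesis using assms by (intro exI[of _ "b / c"]) simp
next
  case False
  define s where "s = csqrt (c\<^sup>2 - 4 * a * b)"
  have s: "s * s = c * c - 4 * a * b" unfolding s_def using power2_csqrt by (metis power2_eq_square)
  have *: "a * z + b * inverse z = c" if "z \<noteq> 0" "2 * a * z = c + r" "r * r = c * c - 4 * a * b" for z r
  proof -
    have "4 * a * (a * z * z - c * z + b) = (2 * a * z) * (2 * a * z) - 2 * c * (2 * a * z) + 4 * a * b"
      by (simp add: algebra_simps)
    also have "\<dots> = 0" unfolding that(2) using that(3) by (simp add: algebra_simps)
    finally have "a * z * z - c * z + b = 0" using False by simp
    then show ?thesis using that(1) by (simp add: field_simps)
  qed
  show ?thesis
  proof (cases "c + s = 0")
    case True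
    then have "c - s \<noteq> 0" using assms(2) by (auto simp: add_eq_0_iff)
    then show ?thesis using *[of "(c - s) / (2 * a)" "- s"] s False by (intro exI[of _ "(c - s) / (2 * a)"]) simp
  next
    case False
    then show ?thesis using *[of "(c + s) / (2 * a)" s] s \<open>a \<noteq> 0\<close> by (intro exI[of _ "(c + s) / (2 * a)"]) simp
  qed
qed

text \<open>The start \<open>z0\<close> may itself lie in \<open>Z\<close>. An arc is taken instead
  of a mere path because injectivity keeps it from returning to \<open>z0\<close>.\<close>

lemma path_avoiding_finite:
  fixes Z :: "complex set"
  assumes "finite Z" "z1 \<notin> Z"
  shows "\<exists>\<gamma> :: real \<Rightarrow> complex. continuous_on {0..1} \<gamma> \<and> \<gamma> 0 = z0 \<and> \<gamma> 1 = z1 \<and> (\<forall>t\<in>{0<..1}. \<gamma> t \<notin> Z)"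
proof (cases "z0 = z1")
  case True
  then show ?thesis using assms(2) by (intro exI[of _ "\<lambda>_. z1"]) simp
next
  case False
  have "path_connected (- (Z - {z0}))"
    by (rule path_connected_complement_countable) (simp_all add: countable_finite assms(1))
  then obtain g where g: "arc g" "path_image g \<subseteq> - (Z - {z0})" "pathstart g = z0" "pathfinish g = z1"
    using False assms(2) unfolding path_connected_arcwise by (elim ballE[of _ _ z0] ballE[of _ _ z1]) auto
  have inj: "inj_on g {0..1}" and cont: "continuous_on {0..1} g" using g(1) by (auto simp: arc_def path_def)
  show ?thesis
  proof (intro exI[of _ g] conjI ballI)
    fix t :: real assume t: "t \<in> {0<..1}"
    then have "g t \<noteq> z0" using inj_onD[OF inj, of t 0] g(3) by (auto simp: pathstart_def)
    moreover have "g t \<in> path_image g" using t by (auto simp: path_image_def)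
    ultimately show "g t \<notin> Z" using g(2) by auto
  qed (use cont g(3,4) in \<open>auto simp: pathstart_def pathfinish_def\<close>)
qed

text \<open>\<open>f\<close> may vanish at 0. The interval \<open>{0<..1}\<close> is contractible,
  so a continuous root exists there, and it extends by 0 since its modulus is
  \<open>sqrt (cmod (f t))\<close>. A global sign adjusts the value at 0.\<close>

lemma continuous_sqrt_from:
  fixes f :: "real \<Rightarrow> complex"
  assumes cont: "continuous_on {0..1} f" and nz: "\<And>t. t \<in> {0<..1} \<Longrightarrow> f t \<noteq> 0" and c: "c\<^sup>2 = f 0"
  shows "\<exists>g. continuous_on {0..1} g \<and> (\<forall>t\<in>{0..1}. (g t)\<^sup>2 = f t) \<and> g 0 = c"
proof -
  have "\<exists>g. continuous_on {0..1} g \<and> (\<forall>t\<in>{0..1}. (g t)\<^sup>2 = f t)"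
  proof (cases "f 0 = 0")
    case False
    then have "f t \<noteq> 0" if "t \<in> {0..1}" for t using nz that by (cases "t = 0") auto
    then show ?thesis
      using continuous_sqrt_on_contractible[OF cont convex_imp_contractible[OF convex_real_interval(5)]] by metis
  next
    case True
    have "continuous_on {0<..1} f" by (rule continuous_on_subset[OF cont]) auto
    moreover have "contractible ({0<..1} :: real set)" by (intro convex_imp_contractible convex_real_interval)
    ultimately obtain g where g: "continuous_on {0<..1} g" "\<And>t. t \<in> {0<..1} \<Longrightarrow> f t = (g t)\<^sup>2"
      using continuous_sqrt_on_contractible[of "{0<..1}" f] nz by blast
    define h where "h t = (if t = 0 then 0 else g t)" for t
    have h2: "(h t)\<^sup>2 = f t" if "t \<in> {0..1}" for t using that g(2)[of t] True by (auto simp: h_def)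
    have "continuous (at t within {0..1}) h" if t: "t \<in> {0..1}" for t
    proof (cases "t = 0")
      case True
      have "(f \<longlongrightarrow> f 0) (at 0 within {0..1})"
        using cont by (auto simp: continuous_on_def)
      then have "((\<lambda>t. sqrt (cmod (f t))) \<longlongrightarrow> sqrt (cmod (f 0))) (at 0 within {0..1})"
        by (intro tendsto_intros)
      then have "((\<lambda>t. sqrt (cmod (f t))) \<longlongrightarrow> 0) (at 0 within {0..1})" using \<open>f 0 = 0\<close> by simp
      moreover have "\<forall>\<^sub>F t in at 0 within {0..1}. sqrt (cmod (f t)) = cmod (h t)"
        unfolding eventually_at_filter using h2
        by (intro always_eventually) (metis norm_ge_zero norm_power real_sqrt_abs2 real_sqrt_pow2 real_sqrt_power)
      ultimately have "((\<lambda>t. cmod (h t)) \<longlongrightarrow> 0) (at 0 within {0..1})"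
        using tendsto_cong by force
      then have "(h \<longlongrightarrow> 0) (at 0 within {0..1})" by (rule tendsto_norm_zero_cancel)
      then show ?thesis unfolding True by (simp add: continuous_within h_def)
    next
      case False
      then have t0: "t \<in> {0<..1}" using t by auto
      have "continuous_on {0<..1} h"
        using g(1) by (rule continuous_on_eq) (auto simp: h_def)
      then have "continuous (at t within {0<..1}) h" using t0 by (simp add: continuous_on_eq_continuous_within)
      moreover have "at t within {0..1} = at t within {0<..1}"
        by (rule at_within_nhd[of t "{0<..}"]) (use t0 in auto)
      ultimately show ?thesis by (simp add: continuous_within)
    qed
    then have "continuous_on {0..1} h" by (simp add: continuous_on_eq_continuous_within)
    then show ?thesis using h2 by blast
  qed
  then obtain g where g: "continuous_on {0..1} g" "\<And>t. t \<in> {0..1} \<Longrightarrow> (g t)\<^sup>2 = f t" by blast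
  have "(g 0)\<^sup>2 = c\<^sup>2" using g(2)[of 0] c by simp
  then have "g 0 = c \<or> g 0 = - c" by (simp add: power2_eq_iff)
  then show ?thesis
  proof
    assume "g 0 = c" then show ?thesis using g by blast
  next
    assume "g 0 = - c"
    then show ?thesis using g by (intro exI[of _ "\<lambda>t. - g t"]) (auto intro: continuous_on_minus)
  qed
qed

section \<open>Lifts of NEC groups\<close>

definition satisfies :: "nat list \<Rightarrow> nat list list \<Rightarrow> (nec_gen \<Rightarrow> m2) \<Rightarrow> bool" where
  "satisfies ms Cs T \<longleftrightarrow>
    (\<forall>i<length ms. pm1 (T (X_gen i) ^ (ms ! i))) \<and>
    (\<forall>i<length Cs. \<forall>j\<le>length (Cs ! i). pm1 (T (C_gen i j) ^ 2)) \<and>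
    (\<forall>i<length Cs. \<forall>j<length (Cs ! i). pm1 ((T (C_gen i j) * T (C_gen i (Suc j))) ^ (Cs ! i ! j))) \<and>
    (\<forall>i<length Cs. pm1 (T (E_gen i) * T (C_gen i 0) * adj2 (T (E_gen i)) * adj2 (T (C_gen i (length (Cs ! i)))))) \<and>
    pm1 (prod_list (map (\<lambda>i. T (X_gen i)) [0..<length ms]) * prod_list (map (\<lambda>i. T (E_gen i)) [0..<length Cs]))"

lemma satisfies_iff: "(\<forall>r\<in>nec_relators ms Cs. pm1 (ev T r)) \<longleftrightarrow> satisfies ms Cs T"
proof -
  have l: "ev T (map (\<lambda>i. (c i, True)) is) = prod_list (map (\<lambda>i. T (c i)) is)" for c :: "nat \<Rightarrow> nec_gen" and "is"
    by (induction "is") simp_all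
  have c: "(\<forall>r\<in>{f i |i. P i}. Q r) \<longleftrightarrow> (\<forall>i. P i \<longrightarrow> Q (f i))"
    "(\<forall>r\<in>{g i j |i j. P' i j}. Q r) \<longleftrightarrow> (\<forall>i j. P' i j \<longrightarrow> Q (g i j))"
    for f :: "nat \<Rightarrow> nec_gen word" and g :: "nat \<Rightarrow> nat \<Rightarrow> nec_gen word" and P P' Q
    by auto
  show ?thesis
    unfolding nec_relators_def satisfies_def ball_Un c
    by (simp add: ev_word_power l mult.assoc imp_conjL)
qed

lemma finite_nec_gens: "finite (nec_gens ms Cs)"
proof -
  have "nec_gens ms Cs = X_gen ` {..<length ms} \<union> E_gen ` {..<length Cs} \<union>
      (\<Union>i\<in>{..<length Cs}. C_gen i ` {..length (Cs ! i)})"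
    by (auto simp: nec_gens_def)
  then show ?thesis by simp
qed

lemma gen_in_nec_gens [simp]:
  "X_gen i \<in> nec_gens ms Cs \<longleftrightarrow> i < length ms" "E_gen i \<in> nec_gens ms Cs \<longleftrightarrow> i < length Cs"
  "C_gen i j \<in> nec_gens ms Cs \<longleftrightarrow> i < length Cs \<and> j \<le> length (Cs ! i)"
  by (auto simp: nec_gens_def)

definition dg :: "complex \<Rightarrow> m2" where "dg z = M2 z 0 0 (inverse z)"

lemma dg_sel [simp]: "m11 (dg z) = z" "m12 (dg z) = 0" "m21 (dg z) = 0" "m22 (dg z) = inverse z"
  by (simp_all add: dg_def)

lemma prod_list_dg: "prod_list (map (\<lambda>i. dg (f i)) is) = dg (prod_list (map f is))"
  by (induction "is") (simp_all add: m2_eq_iff)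

lemma prod_list_absorb:
  fixes a :: complex
  assumes "i1 < k" "i2 < k" "i1 \<noteq> i2" "a \<noteq> 0"
  shows "prod_list (map (\<lambda>i. if i = i1 then a else if i = i2 then inverse a else 1) [0..<k]) = 1"
proof -
  let ?f = "\<lambda>i. if i = i1 then a else if i = i2 then inverse a else 1"
  have "prod_list (map ?f [0..<k]) = (\<Prod>i\<in>{0..<k}. ?f i)"
    by (subst prod.distinct_set_conv_list[symmetric]) auto
  also have "\<dots> = (\<Prod>i\<in>{i1, i2}. ?f i)"
    by (rule prod.mono_neutral_right) (use assms in auto)
  also have "\<dots> = 1" using assms by simp
  finally show ?thesis .
qed

text \<open>Matrices and signs of the generators are chosen once, so that both cases deform the same
  faithful lift.\<close>

locale nec_lift =
  fixes \<Gamma> :: "(complex \<Rightarrow> complex) set" and ms :: "nat list" and Cs :: "nat list list"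
    and \<phi> :: "nec_gen \<Rightarrow> complex \<Rightarrow> complex" and M :: "nec_gen \<Rightarrow> m2" and s :: "nec_gen \<Rightarrow> bool"
  assumes sub: "subgroup \<Gamma> hyp_isom"
    and pres: "presentation (hyp_isom\<lparr>carrier := \<Gamma>\<rparr>) (nec_gens ms Cs) (nec_relators ms Cs) \<phi>"
    and Cs2: "\<forall>C\<in>set Cs. \<forall>n\<in>set C. n \<ge> 2"
    and lift: "\<And>x. x \<in> nec_gens ms Cs \<Longrightarrow> lifts (s x) (\<phi> x) (M x)"
    and sE: "\<And>i. i < length Cs \<Longrightarrow> s (E_gen i)"
    and sC: "\<And>i j. i < length Cs \<Longrightarrow> j \<le> length (Cs ! i) \<Longrightarrow> \<not> s (C_gen i j)"
begin

abbreviation "G \<equiv> hyp_isom\<lparr>carrier := \<Gamma>\<rparr>"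
abbreviation "words \<equiv> lists (nec_gens ms Cs \<times> (UNIV :: bool set))"

lemma group_G: "group G"
  using subgroup.subgroup_is_group[OF sub group_hyp_isom] .

lemma \<phi>_closed: "\<phi> ` nec_gens ms Cs \<subseteq> \<Gamma>"
  using pres by (simp add: presentation_def)

lemma lift_word: "w \<in> words \<Longrightarrow> lifts (word_sign s w) (word_value G \<phi> w) (ev M w)"
  by (rule lifts_word_value[OF sub \<phi>_closed lift])

lemma trivial_iff: "w \<in> words \<Longrightarrow> word_value G \<phi> w = \<one>\<^bsub>G\<^esub> \<longleftrightarrow> word_eq (nec_gens ms Cs) (nec_relators ms Cs) w []"
  using pres by (simp add: presentation_def)

lemma word_value_iso: "w \<in> words \<Longrightarrow> word_value G \<phi> w \<in> carrier hyp_isom"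
  using group.word_value_closed[OF group_G, of w "nec_gens ms Cs" \<phi>] \<phi>_closed subgroup.subset[OF sub] by auto

lemma faithful: "w \<in> words \<Longrightarrow> pm1 (ev M w) \<Longrightarrow> word_value G \<phi> w = \<one>\<^bsub>G\<^esub>"
  unfolding one_hyp_isom using lifts_pm1[OF lift_word _ word_value_iso] by blast

lemma det_M: "x \<in> nec_gens ms Cs \<Longrightarrow> det2 (M x) = 1"
  using lift by (auto simp: lifts_def)

lemma relator_in_words: "r \<in> nec_relators ms Cs \<Longrightarrow> r \<in> words"
  using pres by (auto simp: presentation_def)

lemma satisfies_M: "satisfies ms Cs M"
proof -
  have "pm1 (ev M r)" if r: "r \<in> nec_relators ms Cs" for r
  proof -
    have "word_eq (nec_gens ms Cs) (nec_relators ms Cs) ([] @ r @ []) ([] @ [])" by (rule word_eq.relator[OF r])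
    then have "word_value G \<phi> r = \<one>\<^bsub>G\<^esub>" using trivial_iff[OF relator_in_words[OF r]] by simp
    then have "lifts (word_sign s r) (\<lambda>z\<in>hyp_plane. z) (ev M r)"
      using lift_word[OF relator_in_words[OF r]] unfolding one_hyp_isom by simp
    then show ?thesis using lifts_identity by fastforce
  qed
  then show ?thesis using satisfies_iff by blast
qed

text \<open>By faithfulness, a word with matrix \<plusminus>1 follows from the relators and is
  trivial under every assignment that satisfies them. So a crude assignment unrelated to the
  geometry can prove that an element of the group is nontrivial.\<close>

lemma separate:
  assumes "w \<in> words" "satisfies ms Cs T" "\<And>x. x \<in> nec_gens ms Cs \<Longrightarrow> det2 (T x) = 1" "\<not> pm1 (ev T w)"
  shows "\<not> pm1 (ev M w)"
proof
  assume "pm1 (ev M w)"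
  then have "word_eq (nec_gens ms Cs) (nec_relators ms Cs) w []" using faithful trivial_iff assms(1) by blast
  then show False
    using word_eq_ev[of _ _ w "[]" T] assms(2-4) satisfies_iff by fastforce
qed

text \<open>The square is \<plusminus>1. With square 1 and determinant 1 the matrix would be
  \<plusminus>1, hence real, but a reflection lifts to an imaginary matrix. So reflections become
  half-turns.\<close>

lemma reflection_matrix:
  assumes "i < length Cs" "j \<le> length (Cs ! i)"
  shows "M (C_gen i j) * M (C_gen i j) = - 1" "tr2 (M (C_gen i j)) = 0" "adj2 (M (C_gen i j)) = - M (C_gen i j)"
proof -
  let ?C = "M (C_gen i j)"
  have det: "det2 ?C = 1" using det_M assms by simp
  have im: "imag2 ?C" using lift[of "C_gen i j"] sC[OF assms] assms by (simp add: lifts_def)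
  have "\<not> pm1 ?C" using im by (auto simp: imag2_def)
  moreover have "pm1 (?C ^ 2)" using satisfies_M assms by (simp add: satisfies_def)
  ultimately show sq: "?C * ?C = - 1" using square_one_pm1[OF det] by (auto simp: power2_eq_square)
  have "?C = ?C * (?C * adj2 ?C)" using det by (simp add: mult_adj2)
  also have "\<dots> = - adj2 ?C" using sq by (simp flip: mult.assoc)
  finally have "?C = - adj2 ?C" .
  then show ad: "adj2 ?C = - ?C" by (metis minus_minus)
  have "sc (tr2 ?C) = 0" using add_adj2[of ?C] ad by simp
  then show "tr2 ?C = 0" by simp
qed

lemma deform_conclusion:
  fixes Mt :: "real \<Rightarrow> nec_gen \<Rightarrow> m2"
  assumes start: "\<And>x. x \<in> nec_gens ms Cs \<Longrightarrow> Mt 0 x = M x"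
    and det: "\<And>t x. t \<in> {0..1} \<Longrightarrow> x \<in> nec_gens ms Cs \<Longrightarrow> det2 (Mt t x) = 1"
    and cont: "\<And>x. x \<in> nec_gens ms Cs \<Longrightarrow> continuous_on {0..1} (\<lambda>t. m11 (Mt t x)) \<and> continuous_on {0..1} (\<lambda>t. m12 (Mt t x)) \<and>
      continuous_on {0..1} (\<lambda>t. m21 (Mt t x)) \<and> continuous_on {0..1} (\<lambda>t. m22 (Mt t x))"
    and resp: "\<And>t. t \<in> {0..1} \<Longrightarrow> satisfies ms Cs (Mt t)"
    and w0: "w0 \<in> words" "\<not> word_sign s w0" "pm1 (ev (Mt 1) w0)"
  shows "\<exists>N. N \<lhd> G \<and> finite (rcosets\<^bsub>G\<^esub> N) \<and> torsion_free (hyp_isom\<lparr>carrier := N\<rparr>) \<and>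
    (\<exists>f\<in>N. orientation_reversing f)"
proof -
  interpret G: group G by (rule group_G)
  have "\<exists>N. N \<lhd> G \<and> finite (rcosets\<^bsub>G\<^esub> N) \<and> (\<forall>g\<in>N. \<forall>n>0. g [^]\<^bsub>G\<^esub> (n::nat) = \<one>\<^bsub>G\<^esub> \<longrightarrow> g = \<one>\<^bsub>G\<^esub>) \<and>
      word_value G \<phi> w0 \<in> N"
  proof (rule G.deformation_criterion[OF pres finite_nec_gens det cont _ _ w0(1,3)])
    show "pm1 (ev (Mt t) r)" if "t \<in> {0..1}" "r \<in> nec_relators ms Cs" for t r
      using resp[OF that(1)] that(2) satisfies_iff by blast
    show "word_value G \<phi> w = \<one>\<^bsub>G\<^esub>" if "w \<in> words" "pm1 (ev (Mt 0) w)" for w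
    proof -
      have "ev (Mt 0) w = ev M w" by (rule ev_cong) (use that(1) start in \<open>auto simp: in_lists_conv_set\<close>)
      then show ?thesis using faithful that by simp
    qed
  qed auto
  then obtain N where N: "N \<lhd> G" "finite (rcosets\<^bsub>G\<^esub> N)" "word_value G \<phi> w0 \<in> N"
    and tf: "\<And>g n. g \<in> N \<Longrightarrow> n > 0 \<Longrightarrow> g [^]\<^bsub>G\<^esub> (n::nat) = \<one>\<^bsub>G\<^esub> \<Longrightarrow> g = \<one>\<^bsub>G\<^esub>" by blast
  have "g [^]\<^bsub>hyp_isom\<lparr>carrier := N\<rparr>\<^esub> n = g [^]\<^bsub>G\<^esub> n" for g and n :: nat
    by (simp add: nat_pow_def)
  then have "torsion_free (hyp_isom\<lparr>carrier := N\<rparr>)"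
    using tf by (auto simp: torsion_free_def)
  moreover have "orientation_reversing (word_value G \<phi> w0)"
    using lifts_orientation[OF lift_word[OF w0(1)]] w0(2) by simp
  ultimately show ?thesis using N by blast
qed

end

section \<open>Two empty period cycles\<close>

definition cont2 :: "real set \<Rightarrow> (real \<Rightarrow> m2) \<Rightarrow> bool" where
  "cont2 S A \<longleftrightarrow> continuous_on S (\<lambda>t. m11 (A t)) \<and> continuous_on S (\<lambda>t. m12 (A t)) \<and>
    continuous_on S (\<lambda>t. m21 (A t)) \<and> continuous_on S (\<lambda>t. m22 (A t))"

lemma cont2_const [simp]: "cont2 S (\<lambda>t. K)"
  and cont2_sc: "continuous_on S f \<Longrightarrow> cont2 S (\<lambda>t. sc (f t))"
  and cont2_mult: "cont2 S A \<Longrightarrow> cont2 S B \<Longrightarrow> cont2 S (\<lambda>t. A t * B t)"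
  and cont2_diff: "cont2 S A \<Longrightarrow> cont2 S B \<Longrightarrow> cont2 S (\<lambda>t. A t - B t)"
  and cont2_tr2: "cont2 S A \<Longrightarrow> continuous_on S (\<lambda>t. tr2 (A t))"
  by (auto simp: cont2_def tr2_def intro!: continuous_intros)

lemma laurent2_cont2:
  assumes "laurent2 A" "continuous_on S \<gamma>" "\<And>t. t \<in> S \<Longrightarrow> \<gamma> t \<noteq> 0"
  shows "cont2 S (\<lambda>t. A (\<gamma> t))"
proof -
  have *: "laurent f \<Longrightarrow> continuous_on S (\<lambda>t. f (\<gamma> t))" for f
    by (rule laurent_continuous_on[OF _ assms(2,3)])
  show ?thesis
    using assms(1) *[of "\<lambda>z. m11 (A z)"] *[of "\<lambda>z. m12 (A z)"] *[of "\<lambda>z. m21 (A z)"] *[of "\<lambda>z. m22 (A z)"]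
    by (simp add: laurent2_def cont2_def)
qed

lemma det2_half_turn:
  assumes "C * C = - 1" "tr2 C = 0"
  shows "det2 C = 1"
proof -
  have "- 1 = - sc (det2 C)" using cayley_hamilton2[of C] assms by simp
  then have "sc (det2 C) = sc 1" by simp
  then show ?thesis by (simp only: sc_inj)
qed

lemma half_turn_square: "det2 C = 1 \<Longrightarrow> tr2 C = 0 \<Longrightarrow> C * C = - 1"
  using cayley_hamilton2[of C] by simp

text \<open>The torus through the half-turn \<open>C = tor C \<i>\<close>.\<close>

definition tor :: "m2 \<Rightarrow> complex \<Rightarrow> m2" where
  "tor C z = sc ((z + inverse z) / 2) + sc ((z - inverse z) / (2 * \<i>)) * C"

lemma det2_sc_add: "det2 (sc p + sc q * C) = p\<^sup>2 + p * q * tr2 C + q\<^sup>2 * det2 C"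
  by (simp add: det2_def tr2_def power2_eq_square algebra_simps)

lemma det2_diff_sc: "det2 (A - sc u) = det2 A - u * tr2 A + u * u"
  by (simp add: det2_def tr2_def algebra_simps)

lemma sc_affine_commute: "A * (sc c * (A - sc d)) = (sc c * (A - sc d)) * A"
  by (simp add: m2_eq_iff algebra_simps)

lemma tor_coeffs: "z \<noteq> 0 \<Longrightarrow> ((z + inverse z) / 2)\<^sup>2 + ((z - inverse z) / (2 * \<i>))\<^sup>2 = 1"
  by (simp add: power2_eq_square field_simps)

lemma det2_tor: "C * C = - 1 \<Longrightarrow> tr2 C = 0 \<Longrightarrow> z \<noteq> 0 \<Longrightarrow> det2 (tor C z) = 1"
  unfolding tor_def det2_sc_add using det2_half_turn tor_coeffs by simp

lemma tor_commute: "tor C z * C = C * tor C z"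
  by (simp add: tor_def m2_eq_iff algebra_simps)

lemma tor_i: "tor C \<i> = C"
  by (simp add: tor_def m2_eq_iff)

lemma tor_1: "tor C 1 = 1"
  by (simp add: tor_def m2_eq_iff)

lemma sc_pair_mult:
  "(sc a + sc b * C) * (sc c + sc d * C) = sc (a * c) + sc (a * d + b * c) * C + sc (b * d) * (C * C)"
  by (simp add: m2_eq_iff algebra_simps)

lemma double_eq_sc: "X + X = sc t \<Longrightarrow> X = sc (t / 2)"
  by (auto simp: m2_eq_iff mult.commute[of _ "2 :: complex"])

text \<open>For \<open>z = exp (\<i> * \<theta>)\<close>, \<open>tor C z\<close> is
  \<open>cos \<theta> + sin \<theta> * C\<close>, and \<open>C\<close> squares to
  \<open>- 1\<close>, so these are the addition formulas.\<close>

lemma tor_mult: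
  assumes "C * C = - 1" "z \<noteq> 0" "w \<noteq> 0"
  shows "tor C z * tor C w = tor C (z * w)"
proof -
  let ?p = "\<lambda>z. (z + inverse z) / 2" and ?q = "\<lambda>z. (z - inverse z) / (2 * \<i>)"
  have "tor C z * tor C w = sc (?p z * ?p w) + sc (?p z * ?q w + ?q z * ?p w) * C + sc (?q z * ?q w) * (C * C)"
    unfolding tor_def by (rule sc_pair_mult)
  also have "\<dots> = sc (?p z * ?p w - ?q z * ?q w) + sc (?p z * ?q w + ?q z * ?p w) * C"
    unfolding assms(1) by (simp add: sc_diff)
  also have "?p z * ?p w - ?q z * ?q w = ?p (z * w)" using assms(2,3) by (simp add: field_simps)
  also have "?p z * ?q w + ?q z * ?p w = ?q (z * w)" using assms(2,3) by (simp add: field_simps)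
  finally show ?thesis by (simp add: tor_def)
qed

lemma tor_power: "C * C = - 1 \<Longrightarrow> z \<noteq> 0 \<Longrightarrow> tor C z ^ n = tor C (z ^ n)"
  by (induction n) (simp_all add: tor_1 tor_mult)

lemma laurent_tor_coeffs: "laurent (\<lambda>z. (z + inverse z) / 2)" "laurent (\<lambda>z. (z - inverse z) / (2 * \<i>))"
  unfolding divide_inverse by (intro laurent_intros)+

lemma laurent2_tor: "laurent2 (tor C)"
  unfolding tor_def[abs_def] by (intro laurent2_add laurent2_mult laurent2_sc laurent_tor_coeffs laurent2_const)

text \<open>Polarization of the fact that a trace-free matrix has scalar square.\<close>

lemma anticommutator_sc:
  assumes "tr2 A = 0" "tr2 B = 0"
  shows "A * B + B * A = sc (tr2 (A * B))"
proof -
  have "m22 A = - m11 A" "m22 B = - m11 B" using assms by (simp_all add: tr2_def add_eq_0_iff)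
  then show ?thesis by (simp add: m2_eq_iff tr2_def algebra_simps)
qed

text \<open>The trace-free part \<open>E'\<close> commutes with \<open>C\<close>, yet its
  anticommutator with \<open>C\<close> is scalar. Hence \<open>E' * C\<close> is scalar and
  \<open>E'\<close> a multiple of \<open>C\<close>. The determinant puts the two coefficients on the
  conic that \<open>tor\<close> parametrizes.\<close>

lemma centralizer_half_turn:
  assumes C: "C * C = - 1" "tr2 C = 0" and E: "E * C = C * E" "det2 E = 1"
  obtains z where "z \<noteq> 0" "E = tor C z"
proof -
  define p where "p = tr2 E / 2"
  define E' where "E' = E - sc p"
  have tE: "tr2 E' = 0" by (simp add: E'_def p_def)
  have "E' * C = C * E'" by (simp add: E'_def algebra_simps E sc_commute)
  then have "E' * C + E' * C = sc (tr2 (E' * C))" using anticommutator_sc[OF tE C(2)] by simp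
  then have EC: "E' * C = sc (tr2 (E' * C) / 2)" by (rule double_eq_sc)
  define q where "q = - tr2 (E' * C) / 2"
  have "E' * (C * C) = sc (- q) * C" using EC by (simp add: q_def flip: mult.assoc)
  then have "E' = sc q * C" using C(1) by (simp add: sc_uminus)
  then have Epq: "E = sc p + sc q * C" by (simp add: E'_def algebra_simps)
  then have 1: "p\<^sup>2 + q\<^sup>2 = 1" using E(2) det2_half_turn[OF C] C(2) by (simp add: det2_sc_add)
  define z where "z = p + \<i> * q"
  have "z * (p - \<i> * q) = 1" using 1 by (simp add: z_def algebra_simps power2_eq_square)
  then have "z \<noteq> 0" and iz: "inverse z = p - \<i> * q" by (auto intro: inverse_unique)
  moreover have "(z + inverse z) / 2 = p" "(z - inverse z) / (2 * \<i>) = q" unfolding iz by (simp_all add: z_def)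
  then have "E = tor C z" unfolding tor_def Epq by simp
  ultimately show thesis using that by blast
qed

lemma prod_list_det2: "(\<And>i. i \<in> set is \<Longrightarrow> det2 (f i) = 1) \<Longrightarrow> det2 (prod_list (map f is)) = 1"
  by (induction "is") auto

text \<open>The numbers \<open>cis (pi / (2 * (m + 1)))\<close> are pairwise distinct, so one of
  them avoids the degenerate parameters.\<close>

lemma infinitely_many_roots_of_i:
  assumes "finite Z"
  shows "\<exists>z m. z \<notin> Z \<and> z \<noteq> 0 \<and> z ^ m = \<i>"
proof -
  define f where "f m = cis (pi / (2 * real (Suc m)))" for m
  have "inj f"
  proof (rule injI)
    fix a b assume "f a = f b"
    then have c: "cos (pi / (2 * real (Suc a))) = cos (pi / (2 * real (Suc b)))"
      by (simp add: f_def complex_eq_iff)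
    have b: "0 \<le> pi / (2 * real (Suc m))" "pi / (2 * real (Suc m)) \<le> pi" for m
      using divide_left_mono[of 1 "2 * real (Suc m)" pi] by simp_all
    have "pi / (2 * real (Suc a)) = pi / (2 * real (Suc b))" by (rule cos_inj_pi[OF b b c])
    then show "a = b" by (simp add: frac_eq_eq)
  qed
  then have "infinite (range f)" by (rule range_inj_infinite)
  then have "\<not> range f \<subseteq> Z" using assms infinite_super by metis
  then obtain m where m: "f m \<notin> Z" by auto
  have "f m ^ Suc m = cis (real (Suc m) * (pi / (2 * real (Suc m))))" unfolding f_def by (rule Complex.DeMoivre)
  moreover have "real (Suc m) * (pi / (2 * real (Suc m))) = pi / 2" by (simp del: of_nat_Suc)
  ultimately have "f m ^ Suc m = \<i>" by (simp only: cis_pi_half)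
  moreover have "f m \<noteq> 0" by (simp add: f_def)
  ultimately show ?thesis using m by blast
qed

lemma word_sign_power_even: "word_sign s w \<Longrightarrow> word_sign s (word_power w n)"
  by (induction n) (simp_all add: word_power_def)

lemma satisfiesD:
  assumes "satisfies ms Cs T"
  shows "i < length ms \<Longrightarrow> pm1 (T (X_gen i) ^ (ms ! i))"
    and "i < length Cs \<Longrightarrow> j \<le> length (Cs ! i) \<Longrightarrow> pm1 (T (C_gen i j) ^ 2)"
    and "i < length Cs \<Longrightarrow> j < length (Cs ! i) \<Longrightarrow> pm1 ((T (C_gen i j) * T (C_gen i (Suc j))) ^ (Cs ! i ! j))"
    and "i < length Cs \<Longrightarrow> pm1 (T (E_gen i) * T (C_gen i 0) * adj2 (T (E_gen i)) * adj2 (T (C_gen i (length (Cs ! i)))))"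
    and "pm1 (prod_list (map (\<lambda>i. T (X_gen i)) [0..<length ms]) * prod_list (map (\<lambda>i. T (E_gen i)) [0..<length Cs]))"
  using assms by (simp_all add: satisfies_def)

context nec_lift
begin

lemma E_square_nontrivial:
  assumes "i1 < length Cs" "i2 < length Cs" "i1 \<noteq> i2"
  shows "\<not> pm1 (M (E_gen i1) * M (E_gen i1))"
proof -
  \<comment> \<open>The two diagonal matrices cancel in the long relation. In place of 2, any
    nonzero number that is not a fourth root of unity would serve.\<close>
  define T where "T x = (case x of E_gen i \<Rightarrow> dg (if i = i1 then 2 else if i = i2 then inverse 2 else 1) | _ \<Rightarrow> 1)" for x
  have d: "det2 (T x) = 1" for x by (cases x) (simp_all add: T_def det2_def)
  have "satisfies ms Cs T"
    unfolding satisfies_def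
  proof (intro conjI allI impI)
    have "prod_list (map (\<lambda>i. 1 :: m2) is) = 1" for "is" :: "nat list" by (induction "is") simp_all
    moreover have "dg 1 = 1" by (simp add: m2_eq_iff)
    ultimately show "pm1 (prod_list (map (\<lambda>i. T (X_gen i)) [0..<length ms]) * prod_list (map (\<lambda>i. T (E_gen i)) [0..<length Cs]))"
      using prod_list_absorb[OF assms, of 2] by (simp add: T_def prod_list_dg)
    show "pm1 (T (E_gen i) * T (C_gen i 0) * adj2 (T (E_gen i)) * adj2 (T (C_gen i (length (Cs ! i)))))" for i
      using d[of "E_gen i"] by (simp add: T_def mult_adj2)
  qed (simp_all add: T_def)
  moreover have "[(E_gen i1, True), (E_gen i1, True)] \<in> words" using assms by simp
  moreover have "\<not> pm1 (ev T [(E_gen i1, True), (E_gen i1, True)])"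
    by (simp add: T_def m2_eq_iff)
  ultimately have "\<not> pm1 (ev M [(E_gen i1, True), (E_gen i1, True)])" using separate d by blast
  then show ?thesis by simp
qed

text \<open>The relation only says that \<open>E\<close> and \<open>C\<close> commute up to sign.
  Anticommuting would give \<open>E\<close> trace 0 and hence square \<open>- 1\<close>, which
  \<open>E_square_nontrivial\<close> excludes.\<close>

lemma empty_cycle_torus:
  assumes "i1 < length Cs" "i2 < length Cs" "i1 \<noteq> i2" "Cs ! i1 = []"
  obtains z where "z \<noteq> 0" "M (E_gen i1) = tor (M (C_gen i1 0)) z"
proof -
  let ?C = "M (C_gen i1 0)" and ?E = "M (E_gen i1)"
  note C = reflection_matrix[OF assms(1), of 0, simplified]
  have E: "det2 ?E = 1" using det_M assms by simp
  have "pm1 (?E * ?C * adj2 ?E * adj2 ?C)" using satisfies_M assms(1,4) unfolding satisfies_def by force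
  then have "?E * ?C * adj2 ?E * adj2 ?C * ?C = ?C \<or> ?E * ?C * adj2 ?E * adj2 ?C * ?C = - ?C" by auto
  then have "?E * ?C * adj2 ?E = ?C \<or> ?E * ?C * adj2 ?E = - ?C"
    using det_M[of "C_gen i1 0"] assms(1) by (simp add: mult.assoc adj2_mult_self)
  then have "?E * ?C * adj2 ?E * ?E = ?C * ?E \<or> ?E * ?C * adj2 ?E * ?E = - (?C * ?E)" by auto
  then have "?E * ?C = ?C * ?E \<or> ?E * ?C = - (?C * ?E)"
    using E by (simp add: mult.assoc adj2_mult_self)
  moreover have "?E * ?C \<noteq> - (?C * ?E)"
  proof
    assume anti: "?E * ?C = - (?C * ?E)"
    have "tr2 (?E * ?C * ?C) = tr2 (?C * (?E * ?C))" by (metis tr2_commute)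
    moreover have "tr2 (?E * ?C * ?C) = - tr2 (?C * ?E * ?C)" unfolding anti by simp
    ultimately have "tr2 (?E * ?C * ?C) = 0" by (simp add: mult.assoc)
    then have "tr2 ?E = 0" using C(1) by (simp add: mult.assoc)
    then have "?E * ?E = - 1" by (rule half_turn_square[OF E])
    then show False using E_square_nontrivial[OF assms(1-3)] by simp
  qed
  ultimately have "?E * ?C = ?C * ?E" by blast
  then show thesis using centralizer_half_turn[OF C(1,2) _ E] that by blast
qed

lemma two_empty_cycles:
  assumes i: "i1 < length Cs" "i2 < length Cs" "i1 \<noteq> i2" and empty: "Cs ! i1 = []" "Cs ! i2 = []"
  shows "\<exists>N. N \<lhd> G \<and> finite (rcosets\<^bsub>G\<^esub> N) \<and> torsion_free (hyp_isom\<lparr>carrier := N\<rparr>) \<and>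
    (\<exists>f\<in>N. orientation_reversing f)"
proof -
  define C1 C2 E1 where "C1 = M (C_gen i1 0)" and "C2 = M (C_gen i2 0)" and "E1 = M (E_gen i1)"
  note C1 = reflection_matrix[OF i(1), of 0, folded C1_def, simplified]
  note C2 = reflection_matrix[OF i(2), of 0, folded C2_def, simplified]
  obtain z0 where z0: "z0 \<noteq> 0" "M (E_gen i2) = tor C2 z0"
    using empty_cycle_torus[OF i(2,1) i(3)[symmetric] empty(2)] unfolding C2_def by blast
  obtain y where y: "y \<noteq> 0" "E1 = tor C1 y"
    using empty_cycle_torus[OF i empty(1)] unfolding C1_def E1_def by blast
  define p1 q1 where "p1 = (y + inverse y) / 2" and "q1 = (y - inverse y) / (2 * \<i>)"
  have E1: "E1 = sc p1 + sc q1 * C1" and pq: "p1\<^sup>2 + q1\<^sup>2 = 1"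
    using y tor_coeffs[OF y(1)] by (simp_all add: tor_def p1_def q1_def)
  have trE1: "tr2 E1 = 2 * p1" using C1(2) by (simp add: E1)
  \<comment> \<open>\<open>C1\<close> will be recovered from \<open>E1\<close> by division by
    \<open>q1\<close>; the second cycle enters here, through
    \<open>E_square_nontrivial\<close>.\<close>
  have q1: "q1 \<noteq> 0"
  proof
    assume "q1 = 0"
    then have "E1 * E1 = sc (p1\<^sup>2)" by (simp add: E1 power2_eq_square sc_mult)
    then have "E1 * E1 = 1" using pq \<open>q1 = 0\<close> by simp
    then show False using E_square_nontrivial[OF i] by (simp add: E1_def)
  qed
  let ?k = "length Cs"
  define PX where "PX = prod_list (map (\<lambda>i. M (X_gen i)) [0..<length ms])"
  define Ef where "Ef z i = (if i = i2 then tor C2 z else M (E_gen i))" for z i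
  \<comment> \<open>Cutting the long product at \<open>i1\<close> treats both orders of
    \<open>i1\<close> and \<open>i2\<close> alike: the moving factor sits in \<open>pre\<close> or
    in \<open>post\<close>.\<close>
  define pre post where "pre z = PX * prod_list (map (Ef z) [0..<i1])"
    and "post z = prod_list (map (Ef z) [Suc i1..<?k])" for z
  have detEf: "det2 (Ef z j) = 1" if "z \<noteq> 0" "j < ?k" for z j
    using that det2_tor[OF C2(1,2)] det_M by (simp add: Ef_def)
  have det_pp: "det2 (pre z) = 1" "det2 (post z) = 1" if "z \<noteq> 0" for z
  proof -
    have "det2 PX = 1" unfolding PX_def by (rule prod_list_det2) (simp add: det_M)
    then show "det2 (pre z) = 1" "det2 (post z) = 1"
      using detEf[OF that] i(1) by (auto simp: pre_def post_def intro!: prod_list_det2)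
  qed
  have upt: "[0..<?k] = [0..<i1] @ i1 # [Suc i1..<?k]"
    using i(1) by (metis append_Cons append_Nil le0 less_imp_le_nat upt_add_eq_append upt_conv_Cons le_add_diff_inverse)
  define \<epsilon> where "\<epsilon> = pre z0 * E1 * post z0"
  have Ef0: "Ef z0 = (\<lambda>i. M (E_gen i))" using z0(2) by (auto simp: Ef_def)
  have \<epsilon>: "pm1 \<epsilon>"
  proof -
    have "pm1 (PX * prod_list (map (Ef z0) [0..<?k]))"
      using satisfies_M unfolding satisfies_def PX_def Ef0 by blast
    moreover have "Ef z0 i1 = E1" by (simp add: Ef0 E1_def)
    ultimately show ?thesis unfolding upt \<epsilon>_def pre_def post_def by (simp add: mult.assoc)
  qed
  define E1f where "E1f z = adj2 (pre z) * \<epsilon> * adj2 (post z)" for z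
  have E1f0: "E1f z0 = E1"
  proof -
    have "E1f z0 = (adj2 (pre z0) * pre z0) * E1 * (post z0 * adj2 (post z0))"
      by (simp add: E1f_def \<epsilon>_def mult.assoc)
    then show ?thesis using det_pp[OF z0(1)] by (simp add: adj2_mult_self mult_adj2)
  qed
  have E1f_prod: "pre z * (E1f z * post z) = \<epsilon>" if "z \<noteq> 0" for z
  proof -
    have "pre z * (E1f z * post z) = (pre z * adj2 (pre z)) * \<epsilon> * (adj2 (post z) * post z)"
      by (simp add: E1f_def mult.assoc)
    then show ?thesis using det_pp[OF that] by (simp add: adj2_mult_self mult_adj2)
  qed
  have det_E1f: "det2 (E1f z) = 1" if "z \<noteq> 0" for z
    using det_pp[OF that] \<epsilon> by (auto simp: E1f_def)
  have lEf: "laurent2 (\<lambda>z. Ef z j)" for j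
    using laurent2_tor[of C2] by (cases "j = i2") (simp_all add: Ef_def)
  have "laurent2 pre" "laurent2 post"
    unfolding pre_def[abs_def] post_def[abs_def]
    by (rule laurent2_mult[OF laurent2_const laurent2_prod_list[OF lEf]], rule laurent2_prod_list[OF lEf])
  then have lE1f: "laurent2 E1f"
    unfolding E1f_def[abs_def] by (rule laurent2_mult[OF laurent2_mult[OF laurent2_adj2 laurent2_const] laurent2_adj2])
  \<comment> \<open>The determinant of the trace-free part of \<open>E1f z\<close>, which can be
    scaled to a half-turn exactly when this is nonzero.\<close>
  define D where "D z = 1 - (tr2 (E1f z) / 2) * (tr2 (E1f z) / 2)" for z
  have lD: "laurent D" unfolding D_def[abs_def] divide_inverse by (intro laurent_intros laurent_tr2 lE1f)
  have D0: "D z0 = q1\<^sup>2" using pq by (simp add: D_def E1f0 trE1 power2_eq_square algebra_simps)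
  define Z where "Z = insert 0 {z. z \<noteq> 0 \<and> D z = 0}"
  have "finite Z" unfolding Z_def using laurent_finite_zeros[OF lD z0(1)] D0 q1 by simp
  then obtain z1 m where z1: "z1 \<notin> Z" "z1 ^ m = \<i>" using infinitely_many_roots_of_i by blast
  obtain \<gamma> :: "real \<Rightarrow> complex" where \<gamma>: "continuous_on {0..1} \<gamma>" "\<gamma> 0 = z0" "\<gamma> 1 = z1" "\<And>t. t \<in> {0<..1} \<Longrightarrow> \<gamma> t \<notin> Z"
    using path_avoiding_finite[OF \<open>finite Z\<close> z1(1), of z0] by blast
  have nz: "\<gamma> t \<noteq> 0" "D (\<gamma> t) \<noteq> 0" if "t \<in> {0..1}" for t
  proof -
    have "\<gamma> t \<noteq> 0 \<and> D (\<gamma> t) \<noteq> 0"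
    proof (cases "t = 0")
      case True
      then show ?thesis using \<gamma>(2) z0(1) D0 q1 by simp
    next
      case False
      then show ?thesis using that \<gamma>(4)[of t] by (auto simp: Z_def)
    qed
    then show "\<gamma> t \<noteq> 0" "D (\<gamma> t) \<noteq> 0" by simp_all
  qed
  have D_cont: "continuous_on {0..1} (\<lambda>t. D (\<gamma> t))" by (rule laurent_continuous_on[OF lD \<gamma>(1) nz(1)])
  have D_nz: "D (\<gamma> t) \<noteq> 0" if "t \<in> {0<..1}" for t using nz(2)[of t] that by simp
  have D_start: "q1\<^sup>2 = D (\<gamma> 0)" using D0 \<gamma>(2) by simp
  \<comment> \<open>The branch with value \<open>q1\<close> at time 0 makes \<open>C1t\<close> start
    at \<open>C1\<close>.\<close>
  obtain S :: "real \<Rightarrow> complex" where S: "continuous_on {0..1} S" "\<And>t. t \<in> {0..1} \<Longrightarrow> (S t)\<^sup>2 = D (\<gamma> t)" "S 0 = q1"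
    using continuous_sqrt_from[OF D_cont D_nz D_start] by blast
  have Snz: "S t \<noteq> 0" if "t \<in> {0..1}" for t using S(2)[OF that] nz(2)[OF that] by auto
  define C1t where "C1t t = sc (inverse (S t)) * (E1f (\<gamma> t) - sc (tr2 (E1f (\<gamma> t)) / 2))" for t
  have C1t0: "C1t 0 = C1"
  proof -
    have "E1 - sc p1 = sc q1 * C1" by (simp add: E1)
    then have "C1t 0 = sc (inverse q1 * q1) * C1"
      unfolding C1t_def S(3) \<gamma>(2) E1f0 trE1 by (simp add: sc_mult mult.assoc)
    then show ?thesis using q1 by simp
  qed
  have C1t_tr: "tr2 (C1t t) = 0" for t by (simp add: C1t_def)
  have C1t_det: "det2 (C1t t) = 1" if t: "t \<in> {0..1}" for t
  proof -
    define A where "A = E1f (\<gamma> t)"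
    have "det2 (A - sc (tr2 A / 2)) = det2 A - (tr2 A / 2) * (tr2 A / 2)"
      unfolding det2_diff_sc by simp
    also have "\<dots> = (S t)\<^sup>2" using S(2)[OF t] det_E1f[OF nz(1)[OF t]] by (simp add: A_def D_def)
    finally have "det2 (A - sc (tr2 A / 2)) = (S t)\<^sup>2" .
    moreover have "(inverse (S t))\<^sup>2 * (S t)\<^sup>2 = 1" using Snz[OF t] by (simp flip: power_mult_distrib)
    ultimately show ?thesis unfolding C1t_def A_def[symmetric] det2_simps by (simp only:)
  qed
  have C1t_comm: "E1f (\<gamma> t) * C1t t = C1t t * E1f (\<gamma> t)" for t
    using sc_affine_commute[of "E1f (\<gamma> t)" "inverse (S t)" "tr2 (E1f (\<gamma> t)) / 2"] by (simp only: C1t_def)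
  define Mt where "Mt t x = (if x = E_gen i1 then E1f (\<gamma> t) else if x = E_gen i2 then tor C2 (\<gamma> t)
    else if x = C_gen i1 0 then C1t t else M x)" for t x
  have commute_relator: "E * C * adj2 E * adj2 C = 1" if "E * C = C * E" "det2 E = 1" "det2 C = 1" for E C
  proof -
    have "E * C * adj2 E = C * (E * adj2 E)" by (simp only: that(1) mult.assoc[symmetric])
    then show ?thesis using that(2,3) by (simp add: mult_adj2)
  qed
  \<comment> \<open>At the end \<open>tor C2 z1 ^ m = tor C2 \<i> = C2\<close>, so the word
    evaluates to \<open>C2 * C2 = - 1\<close>. Only its last letter reverses orientation, whatever
    \<open>m\<close> is.\<close>
  define w0 where "w0 = word_power [(E_gen i2, True)] m @ [(C_gen i2 0, True)]"
  show ?thesis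
  proof (rule deform_conclusion[of Mt w0])
    show "Mt 0 x = M x" if "x \<in> nec_gens ms Cs" for x
      using \<gamma>(2) E1f0 z0(2) C1t0 by (auto simp: Mt_def E1_def C1_def)
    show "det2 (Mt t x) = 1" if "t \<in> {0..1}" "x \<in> nec_gens ms Cs" for t x
      using det_E1f det2_tor[OF C2(1,2)] nz(1)[OF that(1)] C1t_det[OF that(1)] det_M[OF that(2)] by (simp add: Mt_def)
    have "cont2 {0..1} (\<lambda>t. E1f (\<gamma> t))" "cont2 {0..1} (\<lambda>t. tor C2 (\<gamma> t))"
      using laurent2_cont2[OF lE1f \<gamma>(1)] laurent2_cont2[OF laurent2_tor \<gamma>(1)] nz(1) by auto
    moreover from this have "cont2 {0..1} C1t"
      unfolding C1t_def[abs_def] using S(1) Snz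
      by (intro cont2_mult cont2_sc cont2_diff continuous_intros cont2_tr2) auto
    ultimately have cont: "cont2 {0..1} (\<lambda>t. Mt t x)" for x
      by (cases "x = E_gen i1"; cases "x = E_gen i2"; cases "x = C_gen i1 0") (simp_all add: Mt_def)
    show "continuous_on {0..1} (\<lambda>t. m11 (Mt t x)) \<and> continuous_on {0..1} (\<lambda>t. m12 (Mt t x)) \<and>
      continuous_on {0..1} (\<lambda>t. m21 (Mt t x)) \<and> continuous_on {0..1} (\<lambda>t. m22 (Mt t x))" for x
      using cont[of x] unfolding cont2_def .
    show "satisfies ms Cs (Mt t)" if t: "t \<in> {0..1}" for t
      unfolding satisfies_def
    proof (intro conjI allI impI)
      show "pm1 (Mt t (X_gen i) ^ (ms ! i))" if "i < length ms" for i
        using satisfiesD(1)[OF satisfies_M that] by (simp add: Mt_def)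
      show "pm1 (Mt t (C_gen i j) ^ 2)" if "i < length Cs" "j \<le> length (Cs ! i)" for i j
        using satisfiesD(2)[OF satisfies_M that] half_turn_square[OF C1t_det[OF t] C1t_tr]
        by (simp add: Mt_def power2_eq_square)
      show "pm1 ((Mt t (C_gen i j) * Mt t (C_gen i (Suc j))) ^ (Cs ! i ! j))" if "i < length Cs" "j < length (Cs ! i)" for i j
      proof -
        have "i \<noteq> i1" using that empty by auto
        then show ?thesis using satisfiesD(3)[OF satisfies_M that] by (simp add: Mt_def)
      qed
      show "pm1 (Mt t (E_gen i) * Mt t (C_gen i 0) * adj2 (Mt t (E_gen i)) * adj2 (Mt t (C_gen i (length (Cs ! i)))))"
        if "i < length Cs" for i
      proof -
        consider "i = i1" | "i = i2" | "i \<noteq> i1" "i \<noteq> i2" by blast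
        then show ?thesis
        proof cases
          case 1
          then show ?thesis
            using commute_relator[OF C1t_comm det_E1f[OF nz(1)[OF t]] C1t_det[OF t]] empty by (simp add: Mt_def)
        next
          case 2
          then show ?thesis
            using commute_relator[OF tor_commute det2_tor[OF C2(1,2) nz(1)[OF t]] det2_half_turn[OF C2(1,2)]] empty i(3)
            by (simp add: Mt_def C2_def)
        next
          case 3
          then show ?thesis using satisfiesD(4)[OF satisfies_M that] by (simp add: Mt_def)
        qed
      qed
      have mE: "map (\<lambda>i. Mt t (E_gen i)) [0..<i1] = map (Ef (\<gamma> t)) [0..<i1]"
        "map (\<lambda>i. Mt t (E_gen i)) [Suc i1..<?k] = map (Ef (\<gamma> t)) [Suc i1..<?k]"
        by (auto simp: Mt_def Ef_def)
      have mE1: "Mt t (E_gen i1) = E1f (\<gamma> t)" by (simp add: Mt_def)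
      have mX: "map (\<lambda>i. Mt t (X_gen i)) [0..<length ms] = map (\<lambda>i. M (X_gen i)) [0..<length ms]"
        by (simp add: Mt_def)
      have "prod_list (map (\<lambda>i. Mt t (X_gen i)) [0..<length ms]) * prod_list (map (\<lambda>i. Mt t (E_gen i)) [0..<?k])
          = pre (\<gamma> t) * (E1f (\<gamma> t) * post (\<gamma> t))"
        unfolding upt map_append list.map mE mE1 mX prod_list.append prod_list.Cons pre_def post_def PX_def
        by (simp only: mult.assoc)
      then show "pm1 (prod_list (map (\<lambda>i. Mt t (X_gen i)) [0..<length ms]) * prod_list (map (\<lambda>i. Mt t (E_gen i)) [0..<?k]))"
        unfolding E1f_prod[OF nz(1)[OF t]] using \<epsilon> by simp
    qed
    show "w0 \<in> words" using i(2) by (simp add: w0_def word_power_in_lists)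
    show "\<not> word_sign s w0"
      using sE[OF i(2)] sC[OF i(2), of 0] word_sign_power_even[of s "[(E_gen i2, True)]" m] by (simp add: w0_def)
    have "ev (Mt 1) w0 = tor C2 z1 ^ m * C2"
      using i(3) \<gamma>(3) by (simp add: w0_def ev_word_power Mt_def C2_def)
    also have "\<dots> = - 1" using z1 tor_power[OF C2(1)] by (auto simp: Z_def tor_i C2(1))
    finally show "pm1 (ev (Mt 1) w0)" by simp
  qed
qed

end

section \<open>A period cycle with three links\<close>

text \<open>The half-turn \<open>X\<close> is split into its component along the half-turn \<open>C\<close> and one anticommuting
  with \<open>C\<close>; \<open>rot C X z\<close> turns the latter by \<open>tor C z\<close>, so \<open>rot C X\<close> keeps the trace against \<open>C\<close>.\<close>

definition rot_coeff :: "m2 \<Rightarrow> m2 \<Rightarrow> complex" where "rot_coeff C X = - tr2 (C * X) / 2"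
definition rot_normal :: "m2 \<Rightarrow> m2 \<Rightarrow> m2" where "rot_normal C X = X - sc (rot_coeff C X) * C"
definition rot :: "m2 \<Rightarrow> m2 \<Rightarrow> complex \<Rightarrow> m2" where
  "rot C X z = sc (rot_coeff C X) * C + tor C z * rot_normal C X"

lemma rot_1: "rot C X 1 = X"
  by (simp add: rot_def rot_normal_def tor_1)

lemma laurent2_rot: "laurent2 (rot C X)"
  unfolding rot_def[abs_def] by (intro laurent2_add laurent2_mult laurent2_tor laurent2_const)

text \<open>Besides a constant, the trace against a rotating half-turn involves only
  \<open>z\<close> and \<open>inverse z\<close>. Prescribing it is therefore a quadratic equation
  for \<open>z\<close>.\<close>

lemma tr2_mult_rot:
  "tr2 (Z * rot C X z) = rot_coeff C X * tr2 (Z * C) +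
    ((z + inverse z) / 2 * tr2 (Z * rot_normal C X) + (z - inverse z) / (2 * \<i>) * tr2 (Z * C * rot_normal C X))"
proof -
  have *: "tr2 (Z * (sc a * C + (sc p + sc q * C) * Y)) = a * tr2 (Z * C) + (p * tr2 (Z * Y) + q * tr2 (Z * C * Y))" for a p q Y
    by (simp add: tr2_def algebra_simps)
  show ?thesis unfolding rot_def tor_def by (rule *)
qed

context
  fixes C X :: m2
  assumes C: "C * C = - 1" "tr2 C = 0" and X: "X * X = - 1" "tr2 X = 0"
begin

lemma rot_normal_tr: "tr2 (rot_normal C X) = 0" "tr2 (C * rot_normal C X) = 0"
proof -
  show "tr2 (rot_normal C X) = 0" using C(2) X(2) by (simp add: rot_normal_def)
  have "C * rot_normal C X = C * X - sc (rot_coeff C X) * (C * C)"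
    unfolding rot_normal_def right_diff_distrib by (metis mult.assoc sc_commute)
  then show "tr2 (C * rot_normal C X) = 0" unfolding C(1) by (simp add: rot_coeff_def)
qed

lemma rot_normal_anticommute: "rot_normal C X * C = - (C * rot_normal C X)"
  using anticommutator_sc[OF C(2) rot_normal_tr(1)] rot_normal_tr(2) by (simp add: add_eq_0_iff)

lemma rot_normal_square: "rot_normal C X * rot_normal C X = sc ((rot_coeff C X)\<^sup>2 - 1)"
proof -
  let ?a = "rot_coeff C X"
  have "C * X + X * C = sc (- 2 * ?a)" using anticommutator_sc[OF C(2) X(2)] by (simp add: rot_coeff_def)
  then have XC: "X * C = sc (- 2 * ?a) - C * X" by (simp add: algebra_simps)
  have "rot_normal C X * rot_normal C X = X * X - sc ?a * (X * C + C * X) + sc (?a * ?a) * (C * C)"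
    by (simp add: rot_normal_def m2_eq_iff algebra_simps)
  also have "\<dots> = sc ((?a)\<^sup>2 - 1)"
    unfolding XC C(1) X(1) by (simp add: sc_diff power2_eq_square sc_mult[symmetric] sc_uminus[symmetric] flip: sc_add)
  finally show ?thesis .
qed

lemma rot_tr: "tr2 (rot C X z) = 0"
  using tr2_mult_rot[of 1 C X z] C(2) rot_normal_tr by simp

lemma rot_tr_axis: "tr2 (C * rot C X z) = tr2 (C * X)"
  using tr2_mult_rot[of C C X z] C(1) rot_normal_tr by (simp add: rot_coeff_def)

text \<open>The normal part \<open>Y\<close> anticommutes with \<open>C\<close>, so moving it past
  \<open>tor C z\<close> inverts the torus element. Hence \<open>tor C z * Y\<close> has the same
  square as \<open>Y\<close> and still anticommutes with \<open>C\<close>.\<close>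

lemma rot_square:
  assumes z: "z \<noteq> 0"
  shows "rot C X z * rot C X z = - 1"
proof -
  let ?a = "rot_coeff C X" and ?Y = "rot_normal C X" and ?E = "tor C z"
  let ?p = "(z + inverse z) / 2" and ?q = "(z - inverse z) / (2 * \<i>)"
  have YE: "?Y * ?E = (sc ?p - sc ?q * C) * ?Y"
  proof -
    have "Y * (sc p + sc q * C) = sc p * Y + sc q * (Y * C)" for Y p q by (simp add: m2_eq_iff algebra_simps)
    then have "?Y * ?E = sc ?p * ?Y + sc ?q * (?Y * C)" unfolding tor_def .
    then show ?thesis unfolding rot_normal_anticommute by (simp add: left_diff_distrib mult.assoc)
  qed
  have EE: "?E * (sc ?p - sc ?q * C) = 1"
  proof -
    have "?E * (sc ?p + sc (- ?q) * C) = sc (?p * ?p) + sc (?p * - ?q + ?q * ?p) * C + sc (?q * - ?q) * (C * C)"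
      unfolding tor_def by (rule sc_pair_mult)
    also have "\<dots> = sc (?p\<^sup>2 + ?q\<^sup>2)" unfolding C(1) by (simp add: sc_add power2_eq_square sc_uminus)
    finally show ?thesis using tor_coeffs[OF z] by (simp add: sc_uminus)
  qed
  have "?E * ?Y * (?E * ?Y) = ?E * (?Y * ?E) * ?Y" by (simp add: mult.assoc)
  also have "\<dots> = (?E * (sc ?p - sc ?q * C)) * (?Y * ?Y)" unfolding YE by (simp add: mult.assoc)
  finally have 1: "?E * ?Y * (?E * ?Y) = sc (?a\<^sup>2 - 1)" unfolding EE rot_normal_square by simp
  have 2: "?E * ?Y * C = - (C * (?E * ?Y))"

  proof -
    have "?E * ?Y * C = - (?E * C * ?Y)" by (simp add: mult.assoc rot_normal_anticommute)
    then show ?thesis unfolding tor_commute by (simp add: mult.assoc)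
  qed
  have "rot C X z * rot C X z = sc (?a * ?a) * (C * C) + sc ?a * (C * (?E * ?Y) + ?E * ?Y * C) + ?E * ?Y * (?E * ?Y)"
  proof -
    have "(sc a * C + K) * (sc a * C + K) = sc (a * a) * (C * C) + sc a * (C * K + K * C) + K * K" for a K
      by (simp add: m2_eq_iff algebra_simps)
    then show ?thesis unfolding rot_def .
  qed
  then show ?thesis unfolding 1 2 C(1) by (simp add: sc_diff power2_eq_square)
qed

end

lemma sc_mult_eq_0: "sc c * B = 0 \<Longrightarrow> c \<noteq> 0 \<Longrightarrow> B = 0"
  by (simp add: m2_eq_iff)

text \<open>The Gram determinant of three trace-free matrices.\<close>

lemma triple_trace_square:
  assumes "tr2 A = 0" "tr2 B = 0" "tr2 C = 0"
  shows "(tr2 (A * B * C))\<^sup>2 = 4 * det2 A * det2 B * det2 C - tr2 (A * B) * tr2 (B * C) * tr2 (A * C)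
    - det2 C * (tr2 (A * B))\<^sup>2 - det2 A * (tr2 (B * C))\<^sup>2 - det2 B * (tr2 (A * C))\<^sup>2"
proof -
  have e: "m22 A = - m11 A" "m22 B = - m11 B" "m22 C = - m11 C"
    using assms by (simp_all add: tr2_def add_eq_0_iff)
  show ?thesis by (simp add: tr2_def det2_def e) algebra
qed

text \<open>The first part is the Gram identity. The second shows that the trace of \<open>Z\<close>
  against the rotating \<open>X\<close> really varies unless \<open>Z\<close> is
  \<plusminus>\<open>C\<close>: the trace-free matrices are spanned by \<open>C\<close>,
  \<open>X\<close> and the trace-free part \<open>N\<close> of \<open>C * X\<close>, and if
  \<open>g\<close> and \<open>h\<close> vanish, then \<open>Z - sc y * C\<close> is orthogonal to
  all three for the trace form.\<close>

lemma rot_trace_coeffs: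
  assumes C: "C * C = - 1" "tr2 C = 0" and X: "X * X = - 1" "tr2 X = 0" and Z: "Z * Z = - 1" "tr2 Z = 0"
  defines "g \<equiv> tr2 (Z * rot_normal C X)" and "h \<equiv> tr2 (Z * C * rot_normal C X)" and "y \<equiv> - tr2 (Z * C) / 2"
  shows "g\<^sup>2 + h\<^sup>2 = 4 * (1 - (rot_coeff C X)\<^sup>2) * (1 - y\<^sup>2)"
    and "(rot_coeff C X)\<^sup>2 \<noteq> 1 \<Longrightarrow> g = 0 \<Longrightarrow> h = 0 \<Longrightarrow> Z = C \<or> Z = - C"
proof -
  let ?a = "rot_coeff C X"
  have trs: "tr2 (C * X) = - 2 * ?a" "tr2 (Z * C) = - 2 * y" by (simp_all add: rot_coeff_def y_def)
  have g: "g = tr2 (Z * X) + 2 * ?a * y"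
  proof -
    have "Z * rot_normal C X = Z * X - sc ?a * (Z * C)"
      unfolding rot_normal_def right_diff_distrib by (metis mult.assoc sc_commute)
    then show ?thesis using trs by (simp add: g_def)
  qed
  have h: "h = tr2 (Z * C * X)"
  proof -
    have "Z * C * rot_normal C X = Z * C * X - sc ?a * (Z * (C * C))"
      unfolding rot_normal_def right_diff_distrib by (metis mult.assoc sc_commute)
    then show ?thesis using C(1) Z(2) by (simp add: h_def)
  qed
  have "h\<^sup>2 = 4 - tr2 (Z * C) * tr2 (C * X) * tr2 (Z * X) - (tr2 (Z * C))\<^sup>2 - (tr2 (C * X))\<^sup>2 - (tr2 (Z * X))\<^sup>2"
    unfolding h using triple_trace_square[OF Z(2) C(2) X(2)] det2_half_turn[OF C] det2_half_turn[OF X] det2_half_turn[OF Z] by simp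
  then show gh: "g\<^sup>2 + h\<^sup>2 = 4 * (1 - ?a\<^sup>2) * (1 - y\<^sup>2)"
    unfolding g trs by (simp add: power2_eq_square algebra_simps)
  show "Z = C \<or> Z = - C" if a: "?a\<^sup>2 \<noteq> 1" and 0: "g = 0" "h = 0"
  proof -
    have y2: "y\<^sup>2 = 1" using gh a 0 by simp
    define W where "W = Z - sc y * C"
    have W: "tr2 W = 0" using C(2) Z(2) by (simp add: W_def)
    have "tr2 (W * C) = 0"
    proof -
      have "W * C = Z * C - sc y * (C * C)" by (simp add: W_def left_diff_distrib mult.assoc)
      then show ?thesis unfolding C(1) by (simp add: trs)
    qed
    then have WC: "W * C = - (C * W)" using anticommutator_sc[OF W C(2)] by (simp add: add_eq_0_iff2)
    have "tr2 (W * X) = 0"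
    proof -
      have "W * X = Z * X - sc y * (C * X)" by (simp add: W_def left_diff_distrib mult.assoc)
      then show ?thesis using g 0(1) by (simp add: trs mult.commute mult.left_commute)
    qed
    then have WX: "W * X = - (X * W)" using anticommutator_sc[OF W X(2)] by (simp add: add_eq_0_iff2)
    define N where "N = C * X + sc ?a"
    have N: "tr2 N = 0" by (simp add: N_def trs)
    have "W * (C * X) = C * X * W"
    proof -
      have "W * (C * X) = - (C * (W * X))" using WC by (simp flip: mult.assoc)
      then show ?thesis unfolding WX by (simp add: mult.assoc)
    qed
    then have WN: "W * N = N * W" by (simp add: N_def distrib_left distrib_right sc_commute[of W])
    have "tr2 (W * N) = 0"
    proof -
      have "W * N = W * (C * X) + sc ?a * W" by (simp add: N_def distrib_left sc_commute[of W])
      also have "W * (C * X) = Z * C * X - sc y * ((C * C) * X)"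
        by (simp add: W_def left_diff_distrib mult.assoc)
      finally have "W * N = Z * C * X - sc y * ((C * C) * X) + sc ?a * W" .
      then show ?thesis unfolding C(1) using 0(2) h X(2) W by simp
    qed
    then have "W * N + W * N = sc 0" using anticommutator_sc[OF W N] WN by simp
    then have "W * N = sc (0 / 2)" by (rule double_eq_sc)
    then have WN0: "W * N = 0" by simp
    have NN: "N * N = sc (?a\<^sup>2 - 1)"
    proof -
      have "C * X * (C * X) = sc (- 2 * ?a) * (C * X) - 1"
        using cayley_hamilton2[of "C * X"] det2_half_turn[OF C] det2_half_turn[OF X] by (simp add: trs)
      moreover have "N * N = C * X * (C * X) + sc (2 * ?a) * (C * X) + sc (?a * ?a)"
      proof -
        have "(K + sc u) * (K + sc u) = K * K + sc (2 * u) * K + sc (u * u)" for K u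
          by (simp add: m2_eq_iff algebra_simps)
        then show ?thesis unfolding N_def .
      qed
      ultimately show ?thesis by (simp add: sc_diff power2_eq_square sc_uminus)
    qed
    have "sc (?a\<^sup>2 - 1) * W = W * N * N" unfolding mult.assoc NN by (rule sc_commute[symmetric])
    then have "sc (?a\<^sup>2 - 1) * W = 0" by (simp add: WN0)
    then have "W = 0" using a sc_mult_eq_0[of "?a\<^sup>2 - 1" W] by simp
    then have "Z = sc y * C" by (simp add: W_def)
    moreover have "y = 1 \<or> y = - 1" using y2 by (simp add: power2_eq_1_iff)
    ultimately show ?thesis by (auto simp: sc_uminus)
  qed
qed

section \<open>Powers determined by traces, and the choice of the end parameters\<close>

lemma power_trace_dependence: "\<exists>u v. \<forall>A. det2 A = 1 \<and> tr2 A = \<tau> \<longrightarrow> A ^ n = sc u * A + sc v"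
proof (induction n)
  case 0
  show ?case by (rule exI[of _ 0], rule exI[of _ 1]) simp
next
  case (Suc n)
  then obtain u v where uv: "\<And>A. det2 A = 1 \<and> tr2 A = \<tau> \<Longrightarrow> A ^ n = sc u * A + sc v" by blast
  have "A ^ Suc n = sc (u * \<tau> + v) * A + sc (- u)" if A: "det2 A = 1 \<and> tr2 A = \<tau>" for A
  proof -
    have "A ^ Suc n = sc u * (A * A) + sc v * A"
      using uv[OF A] by (simp add: power_Suc2 distrib_right mult.assoc del: power_Suc)
    also have "A * A = sc \<tau> * A - 1" using cayley_hamilton2[of A] A by simp
    also have "sc u * (sc \<tau> * A - 1) + sc v * A = sc (u * \<tau> + v) * A + sc (- u)"
      by (simp add: m2_eq_iff algebra_simps)
    finally show ?thesis .
  qed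
  then show ?case by blast
qed

text \<open>Both powers are the same linear polynomial, with coefficients \<open>u\<close> and
  \<open>v\<close>, in their base. As \<open>A\<close> is not scalar but its power is,
  \<open>u\<close> is 0, and the power of \<open>B\<close> is the same scalar. So a link relation
  persists as long as a trace does.\<close>

lemma torsion_transfer:
  assumes "det2 A = 1" "det2 B = 1" "tr2 A = tr2 B" "pm1 (A ^ n)" "\<not> pm1 A"
  shows "pm1 (B ^ n)"
proof -
  obtain u v where uv: "\<And>A'. det2 A' = 1 \<and> tr2 A' = tr2 A \<Longrightarrow> A' ^ n = sc u * A' + sc v"
    using power_trace_dependence[of "tr2 A" n] by blast
  obtain e where e: "A ^ n = sc e" using assms(4) by (metis sc_1 sc_uminus)
  have "u = 0"
  proof (rule ccontr)
    assume u: "u \<noteq> 0"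
    have "sc u * A = sc (e - v)" using uv[of A] assms(1) e by (simp add: sc_diff algebra_simps)
    then have "sc (inverse u) * (sc u * A) = sc (inverse u * (e - v))" by (simp add: sc_mult)
    then have A: "A = sc (inverse u * (e - v))" using u by (simp add: mult.assoc[symmetric] flip: sc_mult)
    define w where "w = inverse u * (e - v)"
    have "A = sc w" using A by (simp add: w_def)
    moreover from this have "w\<^sup>2 = 1" using assms(1) by simp
    then have "w = 1 \<or> w = - 1" by (simp add: power2_eq_1_iff)
    ultimately show False using assms(5) by (auto simp: sc_uminus)
  qed
  then have "A ^ n = sc v" "B ^ n = sc v" using uv[of A] uv[of B] assms by simp_all
  then show ?thesis using assms(4) by simp
qed

text \<open>\<open>W ^ n\<close> fixes the columns of \<open>W - sc z\<close> and of
  \<open>W - sc (inverse z)\<close>, and the difference of these two matrices is an invertible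
  scalar.\<close>

lemma root_of_unity_power:
  assumes "det2 W = 1" "tr2 W = z + inverse z" "z \<noteq> 0" "z ^ n = 1" "z\<^sup>2 \<noteq> 1"
  shows "W ^ n = 1"
proof -
  have i: "inverse z ^ n = 1" using assms(4) by (simp add: power_inverse)
  have "W ^ n * (W - sc z) = W - sc z"
    using eigen_power[OF eigen_split[OF assms(1,3)], of n] assms(2) i by simp
  moreover have "W ^ n * (W - sc (inverse z)) = W - sc (inverse z)"
    using eigen_power[OF eigen_split[OF assms(1), of "inverse z"], of n] assms(2-4) by (simp add: add.commute)
  ultimately have "W ^ n * (W - sc z) - W ^ n * (W - sc (inverse z)) = sc (inverse z - z)"
    by (simp add: sc_diff)
  then have "sc (inverse z - z) * (W ^ n - 1) = 0"
    by (simp add: algebra_simps sc_diff sc_commute)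
  moreover have "inverse z - z \<noteq> 0" using assms(3,5) by (auto simp: power2_eq_square field_simps)
  ultimately have "W ^ n - 1 = 0" using sc_mult_eq_0 by blast
  then show ?thesis by simp
qed

text \<open>The candidates are \<zeta> = \<open>cis (2 * pi / (2 * m + 3))\<close>. Odd order makes
  the trace nonzero, as \<open>laurent_value_exists\<close> requires, and order at least 3 gives
  \<open>\<zeta>\<^sup>2 \<noteq> 1\<close>. Infinitely many distinct traces come from infinitely
  many \<open>z\<close>, so one of these lies outside \<open>Z\<close>.\<close>

lemma odd_torsion_trace:
  fixes a b :: complex
  assumes "a \<noteq> 0 \<or> b \<noteq> 0" "finite Z"
  shows "\<exists>z \<zeta> n. z \<notin> Z \<and> z \<noteq> 0 \<and> odd n \<and> \<zeta> \<noteq> 0 \<and> \<zeta> ^ n = 1 \<and> \<zeta>\<^sup>2 \<noteq> 1 \<and>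
    a * z + b * inverse z = \<zeta> + inverse \<zeta>"
proof -
  define \<theta> where "\<theta> m = 2 * pi / real (2 * m + 3)" for m :: nat
  define \<zeta> where "\<zeta> m = cis (\<theta> m)" for m
  have th: "0 < \<theta> m" "\<theta> m \<le> pi" for m
  proof -
    show "0 < \<theta> m" by (simp add: \<theta>_def)
    have "2 * pi / real (2 * m + 3) \<le> 2 * pi / 2" by (rule divide_left_mono) auto
    then show "\<theta> m \<le> pi" by (simp add: \<theta>_def)
  qed
  have nz: "\<zeta> m \<noteq> 0" for m by (simp add: \<zeta>_def)
  have inv: "\<zeta> m + inverse (\<zeta> m) = of_real (2 * cos (\<theta> m))" for m
    by (simp add: \<zeta>_def complex_eq_iff)
  have pow: "\<zeta> m ^ (2 * m + 3) = 1" for m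
  proof -
    have "\<zeta> m ^ (2 * m + 3) = cis (real (2 * m + 3) * \<theta> m)" unfolding \<zeta>_def by (rule Complex.DeMoivre)
    also have "real (2 * m + 3) * \<theta> m = 2 * pi" by (simp add: \<theta>_def del: of_nat_add of_nat_mult)
    finally show ?thesis by simp
  qed
  have sq: "(\<zeta> m)\<^sup>2 \<noteq> 1" for m
  proof
    assume *: "(\<zeta> m)\<^sup>2 = 1"
    have "\<zeta> m ^ (2 * m + 3) = ((\<zeta> m)\<^sup>2) ^ (m + 1) * \<zeta> m"
      by (simp add: power_mult[symmetric] power_add[symmetric] flip: power_Suc2) (simp add: numeral_eq_Suc)
    then have "\<zeta> m = 1" using * pow by simp
    then have "cos (\<theta> m) = cos 0" by (simp add: \<zeta>_def complex_eq_iff)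
    then show False using cos_inj_pi[of "\<theta> m" 0] th[of m] by simp
  qed
  have s0: "\<zeta> m + inverse (\<zeta> m) \<noteq> 0" for m
  proof
    assume "\<zeta> m + inverse (\<zeta> m) = 0"
    then have "(\<zeta> m)\<^sup>2 = - 1" using nz[of m] by (simp add: power2_eq_square field_simps add_eq_0_iff)
    then have "(\<zeta> m ^ (2 * m + 3))\<^sup>2 = (- 1) ^ (2 * m + 3)" by (metis power_mult mult.commute)
    then show False unfolding pow by simp
  qed
  have "\<exists>z. z \<noteq> 0 \<and> a * z + b * inverse z = \<zeta> m + inverse (\<zeta> m)" for m
    by (rule laurent_value_exists[OF assms(1) s0])
  then obtain f where f: "\<And>m. f m \<noteq> 0 \<and> a * f m + b * inverse (f m) = \<zeta> m + inverse (\<zeta> m)" by metis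
  have "inj f"
  proof (rule injI)
    fix m l assume "f m = f l"
    then have "\<zeta> m + inverse (\<zeta> m) = \<zeta> l + inverse (\<zeta> l)" using f by metis
    then have c: "cos (\<theta> m) = cos (\<theta> l)" unfolding inv by (simp only: of_real_eq_iff)
    have "\<theta> m = \<theta> l" by (rule cos_inj_pi[OF less_imp_le[OF th(1)] th(2) less_imp_le[OF th(1)] th(2) c])
    then show "m = l" by (simp add: \<theta>_def frac_eq_eq)
  qed
  then have "infinite (range f)" by (rule range_inj_infinite)
  then have "\<not> range f \<subseteq> Z" using assms(2) infinite_super by metis
  then obtain m where "f m \<notin> Z" by auto
  then show ?thesis using f[of m] nz[of m] pow[of m] sq[of m]
    by (intro exI[of _ "f m"] exI[of _ "\<zeta> m"] exI[of _ "2 * m + 3"]) simp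
qed

text \<open>\<eta> is the root \<open>(K + S) / F\<close> of
  \<open>F * \<eta>\<^sup>2 - 2 * K * \<eta> + G = 0\<close>, where starting \<open>S\<close> at
  \<open>F 0 - K 0\<close> gives the value 1 at time 0. There the discriminant and \<open>G\<close>
  are allowed to vanish.\<close>

lemma quadratic_continuation:
  fixes F G K :: "real \<Rightarrow> complex"
  assumes cont: "continuous_on {0..1} F" "continuous_on {0..1} G" "continuous_on {0..1} K"
    and start: "F 0 + G 0 = 2 * K 0" "F 0 \<noteq> 0"
    and nz: "\<And>t. t \<in> {0<..1} \<Longrightarrow> F t * G t \<noteq> 0" "\<And>t. t \<in> {0<..1} \<Longrightarrow> (K t)\<^sup>2 - F t * G t \<noteq> 0"
  shows "\<exists>\<eta>. continuous_on {0..1} \<eta> \<and> \<eta> 0 = 1 \<and>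
    (\<forall>t\<in>{0..1}. \<eta> t \<noteq> 0 \<and> F t * \<eta> t + G t * inverse (\<eta> t) = 2 * K t)"
proof -
  have c: "continuous_on {0..1} (\<lambda>t. (K t)\<^sup>2 - F t * G t)" by (intro continuous_intros cont)
  have G0: "G 0 = 2 * K 0 - F 0" using start(1) by (simp add: algebra_simps)
  have s: "(F 0 - K 0)\<^sup>2 = (K 0)\<^sup>2 - F 0 * G 0" unfolding G0 by (simp add: power2_eq_square algebra_simps)
  obtain S :: "real \<Rightarrow> complex" where S: "continuous_on {0..1} S"
    "\<And>t. t \<in> {0..1} \<Longrightarrow> (S t)\<^sup>2 = (K t)\<^sup>2 - F t * G t" "S 0 = F 0 - K 0"
    using continuous_sqrt_from[OF c nz(2) s] by blast
  define \<eta> where "\<eta> t = (K t + S t) / F t" for t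
  have F: "F t \<noteq> 0" if "t \<in> {0..1}" for t using that nz(1)[of t] start(2) by (cases "t = 0") auto
  have eq: "F t * \<eta> t * \<eta> t - 2 * K t * \<eta> t + G t = 0" if t: "t \<in> {0..1}" for t
  proof -
    have Fe: "F t * \<eta> t = K t + S t" using F[OF t] by (simp add: \<eta>_def)
    have "F t * (F t * \<eta> t * \<eta> t - 2 * K t * \<eta> t + G t) = (F t * \<eta> t) * (F t * \<eta> t) - 2 * K t * (F t * \<eta> t) + F t * G t"
      by (simp add: algebra_simps)
    also have "\<dots> = (S t)\<^sup>2 - ((K t)\<^sup>2 - F t * G t)" unfolding Fe by (simp add: power2_eq_square algebra_simps)
    also have "\<dots> = 0" using S(2)[OF t] by simp
    finally show ?thesis using F[OF t] by simp
  qed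
  have \<eta>0: "\<eta> 0 = 1" using start(2) by (simp add: \<eta>_def S(3))
  have \<eta>nz: "\<eta> t \<noteq> 0" if t: "t \<in> {0..1}" for t
  proof (cases "t = 0")
    case True then show ?thesis using \<eta>0 by simp
  next
    case False
    then have "G t \<noteq> 0" using nz(1)[of t] t by auto
    then show ?thesis using eq[OF t] by auto
  qed
  have "F t * \<eta> t + G t * inverse (\<eta> t) = 2 * K t" if t: "t \<in> {0..1}" for t
  proof -
    have "(F t * \<eta> t + G t * inverse (\<eta> t) - 2 * K t) * \<eta> t = 0"
      using eq[OF t] \<eta>nz[OF t] by (simp add: algebra_simps)
    then show ?thesis using \<eta>nz[OF t] by simp
  qed
  moreover have "continuous_on {0..1} \<eta>" unfolding \<eta>_def[abs_def] using F by (intro continuous_intros cont S(1)) auto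
  ultimately show ?thesis using \<eta>0 \<eta>nz by blast
qed

lemma word_sign_power_odd: "\<not> word_sign s w \<Longrightarrow> word_sign s (word_power w n) = even n"
  by (induction n) (simp_all add: word_power_def)

text \<open>For nonzero \<open>w\<close> these are the half-turns that invert the diagonal torus. A
  product of two is diagonal up to sign, so relations of a cycle become equations between
  numbers.\<close>

definition antidg :: "complex \<Rightarrow> m2" where "antidg w = M2 0 w (- inverse w) 0"

lemma antidg_sel [simp]: "m11 (antidg w) = 0" "m12 (antidg w) = w" "m21 (antidg w) = - inverse w" "m22 (antidg w) = 0"
  by (simp_all add: antidg_def)

lemma antidg_mult: "antidg v * antidg w = - dg (v * inverse w)"
  by (simp add: m2_eq_iff)

lemma dg_mult: "dg v * dg w = dg (v * w)"
  by (simp add: m2_eq_iff)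

lemma dg_1: "dg 1 = 1" and dg_minus_1: "dg (- 1) = - 1"
  by (simp_all add: m2_eq_iff)

lemma dg_power: "dg v ^ n = dg (v ^ n)"
  by (induction n) (simp_all add: dg_1 dg_mult)

lemma pm1_power: "pm1 A \<Longrightarrow> pm1 (A ^ n)"
  by (induction n) auto

lemma power_uminus_pm1: "pm1 ((- A) ^ n) \<longleftrightarrow> pm1 (A ^ n :: m2)"
  by (metis power_minus_even power_minus_odd pm1_uminus)

lemma trig_laurent:
  "(z + v) / 2 * g + (z - v) / (2 * \<i>) * h = (g - \<i> * h) / 2 * z + (g + \<i> * h) / 2 * v"
proof -
  have "(z - v) / (2 * \<i>) = - \<i> * (z - v) / 2" by simp
  then show ?thesis by (simp add: field_simps)
qed

text \<open>Trace \<plusminus>2 together with finite order would make \<open>A\<close> equal to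
  \<plusminus>1. Minus half the trace is the form in which \<open>rot_coeff\<close> occurs.\<close>

lemma torsion_trace_neq:
  assumes "det2 A = 1" "pm1 (A ^ n)" "n > 0" "\<not> pm1 A"
  shows "(- tr2 A / 2)\<^sup>2 \<noteq> 1"
proof
  have "A ^ (2 * n) = 1" using assms(2) by (auto simp: mult.commute[of 2] power_mult power2_eq_square)
  moreover have "(- A) ^ (2 * n) = A ^ (2 * n)" by (simp add: power_mult)
  ultimately have A2: "A ^ (2 * n) = 1" "(- A) ^ (2 * n) = 1" by simp_all
  assume "(- tr2 A / 2)\<^sup>2 = 1"
  then have "- tr2 A / 2 = 1 \<or> - tr2 A / 2 = - 1" by (simp only: power2_eq_1_iff)
  then have "tr2 A = 2 \<or> tr2 (- A) = 2" by (auto simp: field_simps)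
  then have "A = 1 \<or> - A = 1"
    using unipotent_torsion[of A "2 * n"] unipotent_torsion[of "- A" "2 * n"] A2 assms(1,3) by auto
  then show False using assms(4) by (metis minus_minus)
qed

text \<open>If \<open>F 0 = 0\<close>, solving for the inverse of \<eta> exchanges the roles of
  \<open>F\<close> and \<open>G\<close>.\<close>

lemma quadratic_continuation_sym:
  fixes F G K :: "real \<Rightarrow> complex"
  assumes cont: "continuous_on {0..1} F" "continuous_on {0..1} G" "continuous_on {0..1} K"
    and start: "F 0 + G 0 = 2 * K 0" "F 0 \<noteq> 0 \<or> G 0 \<noteq> 0"
    and nz: "\<And>t. t \<in> {0<..1} \<Longrightarrow> F t * G t \<noteq> 0" "\<And>t. t \<in> {0<..1} \<Longrightarrow> (K t)\<^sup>2 - F t * G t \<noteq> 0"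
  shows "\<exists>\<eta>. continuous_on {0..1} \<eta> \<and> \<eta> 0 = 1 \<and>
    (\<forall>t\<in>{0..1}. \<eta> t \<noteq> 0 \<and> F t * \<eta> t + G t * inverse (\<eta> t) = 2 * K t)"
proof (cases "F 0 = 0")
  case False
  then show ?thesis using quadratic_continuation[OF cont start(1) _ nz] by blast
next
  case True
  then have G0: "G 0 \<noteq> 0" using start(2) by simp
  have s: "G 0 + F 0 = 2 * K 0" using start(1) by (simp add: add.commute)
  have nz': "G t * F t \<noteq> 0" "(K t)\<^sup>2 - G t * F t \<noteq> 0" if "t \<in> {0<..1}" for t
    using nz[OF that] by (simp_all add: mult.commute)
  obtain \<eta> :: "real \<Rightarrow> complex" where \<eta>: "continuous_on {0..1} \<eta>" "\<eta> 0 = 1"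
    "\<And>t. t \<in> {0..1} \<Longrightarrow> \<eta> t \<noteq> 0 \<and> G t * \<eta> t + F t * inverse (\<eta> t) = 2 * K t"
    using quadratic_continuation[OF cont(2,1,3) s G0 nz'] by blast
  have "continuous_on {0..1} (\<lambda>t. inverse (\<eta> t))" using \<eta>(1,3) by (intro continuous_intros) auto
  then show ?thesis using \<eta>(2,3) by (intro exI[of _ "\<lambda>t. inverse (\<eta> t)"]) (auto simp: add.commute)
qed

context nec_lift
begin

lemma link_period: "i < length Cs \<Longrightarrow> j < length (Cs ! i) \<Longrightarrow> Cs ! i ! j \<ge> 2"
  using Cs2 by (metis nth_mem)

lemma reflections_distinct:
  assumes i: "i < length Cs" "i2 < length Cs" "i \<noteq> i2"
    and l: "a \<le> l" "l < b" "b \<le> length (Cs ! i)"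
  shows "\<not> pm1 (M (C_gen i a) * M (C_gen i b))"
proof -
  define n where "n = Cs ! i ! l"
  have n: "n \<ge> 2" using link_period i(1) l by (simp add: n_def)
  \<comment> \<open>\<zeta> has order \<open>2 * n\<close>, which suits the link relation up to
    sign. Its square root \<eta> lets \<open>dg \<eta>\<close> conjugate \<open>antidg 1\<close> to
    \<open>antidg \<zeta>\<close> and so close the cycle.\<close>
  define \<zeta> \<eta> where "\<zeta> = cis (pi / n)" and "\<eta> = cis (pi / (2 * n))"
  have nz: "\<zeta> \<noteq> 0" "\<eta> \<noteq> 0" by (simp_all add: \<zeta>_def \<eta>_def)
  have \<eta>\<zeta>: "\<eta> * \<eta> = \<zeta>" unfolding \<zeta>_def \<eta>_def cis_mult by (rule arg_cong[of _ _ cis]) simp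
  have \<zeta>n: "\<zeta> ^ n = - 1"
  proof -
    have "\<zeta> ^ n = cis (real n * (pi / n))" unfolding \<zeta>_def by (rule Complex.DeMoivre)
    also have "real n * (pi / n) = pi" using n by simp
    finally show ?thesis by simp
  qed
  have Im: "Im \<zeta> \<noteq> 0"
  proof -
    have "pi / n < pi / 1" using n by (intro divide_strict_left_mono) auto
    then have "sin (pi / n) > 0" using n by (intro sin_gt_zero) auto
    then show ?thesis by (simp add: \<zeta>_def)
  qed
  \<comment> \<open>The value jumps only at the link \<open>l\<close>, which separates
    \<open>a\<close> from \<open>b\<close>; elsewhere in the cycle neighbours are equal, with
    product \<open>- 1\<close>. The cycle \<open>i2\<close> compensates \<open>dg \<eta>\<close> in
    the long relation.\<close>
  define T where "T x = (case x of X_gen k \<Rightarrow> 1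
    | E_gen k \<Rightarrow> dg (if k = i then \<eta> else if k = i2 then inverse \<eta> else 1)
    | C_gen k j \<Rightarrow> (if k = i then antidg (if j \<le> l then 1 else \<zeta>) else 1))" for x
  have d: "det2 (T x) = 1" for x using nz by (cases x) (simp_all add: T_def det2_def)
  have sq: "pm1 (antidg w * antidg w)" if "w \<noteq> 0" for w using that by (simp add: antidg_mult dg_1)
  have "satisfies ms Cs T"
    unfolding satisfies_def
  proof (intro conjI allI impI)
    have "prod_list (map (\<lambda>i. 1 :: m2) is) = 1" for "is" :: "nat list" by (induction "is") simp_all
    then show "pm1 (prod_list (map (\<lambda>i. T (X_gen i)) [0..<length ms]) * prod_list (map (\<lambda>i. T (E_gen i)) [0..<length Cs]))"
      using prod_list_absorb[OF i nz(2)] by (simp add: T_def prod_list_dg dg_1)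
    show "pm1 (T (X_gen k) ^ (ms ! k))" for k by (simp add: T_def)
    show "pm1 (T (C_gen k j) ^ 2)" for k j using sq nz(1) by (simp add: T_def power2_eq_square)
    show "pm1 ((T (C_gen k j) * T (C_gen k (Suc j))) ^ (Cs ! k ! j))" if "k < length Cs" "j < length (Cs ! k)" for k j
    proof -
      consider "k \<noteq> i" | "k = i" "j = l" | "k = i" "j \<noteq> l" by blast
      then show ?thesis
      proof cases
        case 1
        then show ?thesis by (simp add: T_def)
      next
        case 2
        then have "T (C_gen k j) * T (C_gen k (Suc j)) = - dg (inverse \<zeta>)" by (simp add: T_def antidg_mult)
        moreover have "dg (inverse \<zeta>) ^ n = - 1" unfolding dg_power power_inverse \<zeta>n by (simp add: dg_minus_1)
        ultimately show ?thesis using 2 power_uminus_pm1[of "dg (inverse \<zeta>)" n] by (simp add: n_def)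
      next
        case 3
        then have "(j \<le> l) = (Suc j \<le> l)" by auto
        then have "pm1 (T (C_gen k j) * T (C_gen k (Suc j)))" using 3 sq nz(1) by (simp add: T_def)
        then show ?thesis by (rule pm1_power)
      qed
    qed
    show "pm1 (T (E_gen k) * T (C_gen k 0) * adj2 (T (E_gen k)) * adj2 (T (C_gen k (length (Cs ! k)))))" for k
    proof (cases "k = i")
      case False
      then show ?thesis using d[of "E_gen k"] by (simp add: T_def mult_adj2)
    next
      case True
      have "dg \<eta> * antidg 1 * adj2 (dg \<eta>) = antidg \<zeta>" using nz by (simp add: m2_eq_iff flip: \<eta>\<zeta>)
      moreover have "det2 (antidg \<zeta>) = 1" using nz by (simp add: det2_def)
      ultimately show ?thesis using True l by (simp add: T_def mult_adj2)
    qed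
  qed
  moreover have "[(C_gen i a, True), (C_gen i b, True)] \<in> words" using i l by simp
  moreover have "\<not> pm1 (ev T [(C_gen i a, True), (C_gen i b, True)])"
    using l Im by (auto simp: T_def m2_eq_iff complex_eq_iff)
  ultimately have "\<not> pm1 (ev M [(C_gen i a, True), (C_gen i b, True)])" using separate d by blast
  then show ?thesis by simp
qed

lemma three_link_periods:
  assumes i: "i < length Cs" "i2 < length Cs" "i \<noteq> i2" and len: "length (Cs ! i) \<ge> 3"
  shows "\<exists>N. N \<lhd> G \<and> finite (rcosets\<^bsub>G\<^esub> N) \<and> torsion_free (hyp_isom\<lparr>carrier := N\<rparr>) \<and>
    (\<exists>f\<in>N. orientation_reversing f)"
proof -
  define C where "C j = M (C_gen i j)" for j
  have C: "C j * C j = - 1" "tr2 (C j) = 0" "det2 (C j) = 1" if "j \<le> 3" for j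
    using reflection_matrix[OF i(1), of j] det_M[of "C_gen i j"] that len i(1) by (simp_all add: C_def)
  have distinct: "\<not> pm1 (C a * C b)" if "a < b" "b \<le> 3" for a b
    using reflections_distinct[OF i, of a a b] that len by (simp add: C_def)
  have neq: "C b \<noteq> C a" "C b \<noteq> - C a" if "a < b" "b \<le> 3" for a b
    using distinct[OF that] C(1)[of a] that by auto
  have link: "pm1 ((C j * C (Suc j)) ^ (Cs ! i ! j))" "Cs ! i ! j > 0" if "j < 3" for j
    using satisfiesD(3)[OF satisfies_M i(1), of j] link_period[OF i(1), of j] that len by (auto simp: C_def)
  have link_tr: "(rot_coeff (C j) (C (Suc j)))\<^sup>2 \<noteq> 1" if "j < 3" for j
    using torsion_trace_neq[OF _ link[OF that]] distinct[of j "Suc j"] C(3) that by (simp add: rot_coeff_def)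
  have C0: "C 0 * C 0 = - 1" "tr2 (C 0) = 0" and C1: "C 1 * C 1 = - 1" "tr2 (C 1) = 0"
    and C2: "C 2 * C 2 = - 1" "tr2 (C 2) = 0" and C3: "C 3 * C 3 = - 1" "tr2 (C 3) = 0"
    by (rule C, simp)+

  define R1 where "R1 = rot (C 0) (C 1)"
  have R1: "R1 z * R1 z = - 1" "tr2 (R1 z) = 0" if "z \<noteq> 0" for z
    using rot_square[OF C0 C1 that] rot_tr[OF C0 C1] by (simp_all add: R1_def)
  have lR1: "laurent2 R1" unfolding R1_def by (rule laurent2_rot)
  define a c where "a = rot_coeff (C 0) (C 1)" and "c = rot_coeff (C 3) (C 2)"
  have a: "a\<^sup>2 \<noteq> 1" using link_tr[of 0] by (simp add: a_def)
  have c: "c\<^sup>2 \<noteq> 1"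
    using link_tr[of 2] tr2_commute[of "C 3" "C 2"] by (simp add: c_def rot_coeff_def numeral_3_eq_3)
  define b where "b = - tr2 (C 1 * C 2) / 2"

  define g h where "g = tr2 (C 3 * rot_normal (C 0) (C 1))" and "h = tr2 (C 3 * C 0 * rot_normal (C 0) (C 1))"
  have gh: "g \<noteq> 0 \<or> h \<noteq> 0"
    using rot_trace_coeffs(2)[OF C0 C1 C3, folded g_def h_def a_def] a neq[of 0 3] by auto
  \<comment> \<open>The coefficients of \<open>z\<close> and \<open>inverse z\<close> in the trace
    of \<open>C 3\<close> against \<open>R1 z\<close>. They do not both vanish, because
    \<open>C 3\<close> differs from \<plusminus>\<open>C 0\<close>.\<close>
  define \<mu> \<nu> where "\<mu> = (g - \<i> * h) / 2" and "\<nu> = (g + \<i> * h) / 2"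
  have \<mu>\<nu>: "\<mu> \<noteq> 0 \<or> \<nu> \<noteq> 0"
  proof (rule ccontr)
    assume "\<not> ?thesis"
    then have "g - \<i> * h = 0" "g + \<i> * h = 0" by (auto simp: \<mu>_def \<nu>_def)
    then have "g = 0" "\<i> * h = 0" by (auto simp: algebra_simps)
    then show False using gh by simp
  qed
  define y where "y z = - tr2 (R1 z * C 3) / 2" for z
  have y: "y z = - (a * tr2 (C 3 * C 0) + (\<mu> * z + \<nu> * inverse z)) / 2" for z
  proof -
    have "tr2 (C 3 * R1 z) = a * tr2 (C 3 * C 0) + ((z + inverse z) / 2 * g + (z - inverse z) / (2 * \<i>) * h)"
      unfolding R1_def a_def g_def h_def by (rule tr2_mult_rot)
    also have "(z + inverse z) / 2 * g + (z - inverse z) / (2 * \<i>) * h = \<mu> * z + \<nu> * inverse z"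
      unfolding \<mu>_def \<nu>_def by (rule trig_laurent)
    finally show ?thesis unfolding y_def tr2_commute[of "R1 z"] by simp
  qed
  have ly: "laurent y"
    unfolding y_def[abs_def] divide_inverse by (intro laurent_intros laurent_tr2 laurent2_mult lR1 laurent2_const)

  define g2 h2 where "g2 z = tr2 (R1 z * rot_normal (C 3) (C 2))"
    and "h2 z = tr2 (R1 z * C 3 * rot_normal (C 3) (C 2))" for z
  \<comment> \<open>For fixed \<open>z\<close>, the coefficients of \<open>w\<close> and
    \<open>inverse w\<close> in the trace of \<open>R1 z\<close> against the rotated
    \<open>C 2\<close>. This trace has to stay at \<open>- 2 * b\<close>, which will read
    \<open>F z * w + G' z * inverse w = 2 * K z\<close>.\<close>
  define F G' where "F z = (g2 z - \<i> * h2 z) / 2" and "G' z = (g2 z + \<i> * h2 z) / 2" for z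
  have FG: "F z * G' z = (1 - c\<^sup>2) * (1 - (y z)\<^sup>2)" if z: "z \<noteq> 0" for z
  proof -
    have "F z * G' z = ((g2 z)\<^sup>2 + (h2 z)\<^sup>2) / 4" by (simp add: F_def G'_def power2_eq_square field_simps)
    also have "(g2 z)\<^sup>2 + (h2 z)\<^sup>2 = 4 * (1 - c\<^sup>2) * (1 - (y z)\<^sup>2)"
      unfolding g2_def h2_def c_def y_def by (rule rot_trace_coeffs(1)[OF C3 C2 R1[OF z]])
    also have "4 * (1 - c\<^sup>2) * (1 - (y z)\<^sup>2) / 4 = (1 - c\<^sup>2) * (1 - (y z)\<^sup>2)"
      by (simp only: mult.assoc) simp
    finally show ?thesis .
  qed
  have lg2: "laurent g2" "laurent h2"
    unfolding g2_def[abs_def] h2_def[abs_def] by (intro laurent_tr2 laurent2_mult lR1 laurent2_const)+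
  have lF: "laurent F" "laurent G'"
    unfolding F_def[abs_def] G'_def[abs_def] divide_inverse by (intro laurent_intros lg2)+
  have second: "tr2 (R1 z * rot (C 3) (C 2) w) = - 2 * c * y z + (F z * w + G' z * inverse w)" for z w
  proof -
    have "tr2 (R1 z * rot (C 3) (C 2) w) = c * tr2 (R1 z * C 3) +
        ((w + inverse w) / 2 * g2 z + (w - inverse w) / (2 * \<i>) * h2 z)"
      unfolding c_def g2_def h2_def by (rule tr2_mult_rot)
    also have "(w + inverse w) / 2 * g2 z + (w - inverse w) / (2 * \<i>) * h2 z = F z * w + G' z * inverse w"
      unfolding F_def G'_def by (rule trig_laurent)
    finally show ?thesis by (simp add: y_def)
  qed
  define K where "K z = c * y z - b" for z
  have lK: "laurent K" unfolding K_def[abs_def] by (intro laurent_intros ly)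
  \<comment> \<open>A quarter of the discriminant of the quadratic equation for
    \<open>w\<close>.\<close>
  define D where "D z = K z * K z - F z * G' z" for z
  have lD: "laurent D" unfolding D_def[abs_def] by (intro laurent_intros lK lF)
  have lFG: "laurent (\<lambda>z. F z * G' z)" by (intro laurent_intros lF)

  \<comment> \<open>At a point where \<open>y\<close> is \<open>v\<close>, the two quantities are
    \<open>(1 - c\<^sup>2) * (1 - v\<^sup>2)\<close> and the monic polynomial \<open>?P\<close> at
    \<open>v\<close>, so a generic \<open>v\<close> avoids their zeros. It is a value of
    \<open>y\<close> because \<mu> and \<nu> do not both vanish; the last excluded number keeps the
    right side of the equation for \<open>z\<close> nonzero.\<close>
  obtain zg where zg: "zg \<noteq> 0" "F zg * G' zg \<noteq> 0" "D zg \<noteq> 0"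
  proof -
    let ?P = "[:b\<^sup>2 + c\<^sup>2 - 1, - 2 * b * c, 1:]"
    have "finite {v. poly ?P v = 0}" by (rule poly_roots_finite) simp
    then have "finite ({v. poly ?P v = 0} \<union> {1, - 1, - a * tr2 (C 3 * C 0) / 2})" by simp
    then obtain v where v: "poly ?P v \<noteq> 0" "v \<noteq> 1" "v \<noteq> - 1" "v \<noteq> - a * tr2 (C 3 * C 0) / 2"
      using ex_new_if_finite[OF infinite_UNIV_char_0] by blast
    have "- 2 * v - a * tr2 (C 3 * C 0) \<noteq> 0"
    proof
      assume "- 2 * v - a * tr2 (C 3 * C 0) = 0"
      then have "v = - a * tr2 (C 3 * C 0) / 2" by algebra
      with v(4) show False by contradiction
    qed
    then obtain z where z: "z \<noteq> 0" "\<mu> * z + \<nu> * inverse z = - 2 * v - a * tr2 (C 3 * C 0)"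
      using laurent_value_exists[OF \<mu>\<nu>] by blast
    have yz: "y z = v" unfolding y z(2) by simp
    have "v\<^sup>2 \<noteq> 1" using v(2,3) by (simp add: power2_eq_1_iff)
    then have "F z * G' z \<noteq> 0" using FG[OF z(1)] c yz by simp
    moreover have "D z = poly ?P v"
      unfolding D_def FG[OF z(1)] K_def yz by (simp add: power2_eq_square algebra_simps)
    ultimately show thesis using that z(1) v(1) by simp
  qed
  define Z where "Z = insert 0 ({z. z \<noteq> 0 \<and> F z * G' z = 0} \<union> {z. z \<noteq> 0 \<and> D z = 0})"
  have "finite Z"
    unfolding Z_def using laurent_finite_zeros[OF lFG zg(1,2)] laurent_finite_zeros[OF lD zg(1,3)] by simp

  \<comment> \<open>These are the coefficients of \<open>z\<close> and \<open>inverse z\<close> in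
    the trace of \<open>C 0 * R1 z * C 3\<close>: the extra factor \<open>C 0\<close> exchanges
    \<open>g\<close> and \<open>h\<close> up to sign.\<close>
  have "\<i> * \<mu> \<noteq> 0 \<or> - \<i> * \<nu> \<noteq> 0" using \<mu>\<nu> by simp
  from odd_torsion_trace[OF this \<open>finite Z\<close>]
  obtain z1 \<zeta> n where z1: "z1 \<notin> Z" "z1 \<noteq> 0" and n: "odd n" "\<zeta> \<noteq> 0" "\<zeta> ^ n = 1" "\<zeta>\<^sup>2 \<noteq> 1"
    and tr: "\<i> * \<mu> * z1 + - \<i> * \<nu> * inverse z1 = \<zeta> + inverse \<zeta>" by blast
  obtain \<gamma> :: "real \<Rightarrow> complex" where \<gamma>: "continuous_on {0..1} \<gamma>" "\<gamma> 0 = 1" "\<gamma> 1 = z1" "\<And>t. t \<in> {0<..1} \<Longrightarrow> \<gamma> t \<notin> Z"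
    using path_avoiding_finite[OF \<open>finite Z\<close> z1(1), of 1] by blast
  have \<gamma>0: "\<gamma> t \<noteq> 0" if "t \<in> {0..1}" for t
    using that \<gamma>(2) \<gamma>(4)[of t] by (cases "t = 0") (auto simp: Z_def)
  have R1_1: "R1 1 = C 1" by (simp add: R1_def rot_1)

  have \<gamma>cont: "continuous_on {0..1} (\<lambda>t. f (\<gamma> t))" if "laurent f" for f
    by (rule laurent_continuous_on[OF that \<gamma>(1) \<gamma>0])
  have start1: "F (\<gamma> 0) + G' (\<gamma> 0) = 2 * K (\<gamma> 0)"
    using second[of 1 1] by (simp add: \<gamma>(2) rot_1 R1_1 K_def b_def field_simps)
  \<comment> \<open>One of \<open>F\<close> and \<open>G'\<close> vanishes at the start if
    \<open>C 1 * C 3\<close> is parabolic. Both cannot, since \<open>C 1\<close> differs from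
    \<plusminus>\<open>C 3\<close>.\<close>
  have start2: "F (\<gamma> 0) \<noteq> 0 \<or> G' (\<gamma> 0) \<noteq> 0"
  proof (rule ccontr)
    assume "\<not> ?thesis"
    then have "g2 1 - \<i> * h2 1 = 0" "g2 1 + \<i> * h2 1 = 0" by (auto simp: F_def G'_def \<gamma>(2))
    then have "g2 1 = 0" "\<i> * h2 1 = 0" by (auto simp: algebra_simps)
    then have "C 1 = C 3 \<or> C 1 = - C 3"
      using rot_trace_coeffs(2)[OF C3 C2 C1] c by (simp add: g2_def h2_def c_def R1_1)
    then show False using neq[of 1 3] by auto
  qed
  have FGnz: "F (\<gamma> t) * G' (\<gamma> t) \<noteq> 0" if "t \<in> {0<..1}" for t
    using \<gamma>(4)[OF that] by (auto simp: Z_def)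
  have Dnz: "(K (\<gamma> t))\<^sup>2 - F (\<gamma> t) * G' (\<gamma> t) \<noteq> 0" if "t \<in> {0<..1}" for t
    using \<gamma>(4)[OF that] by (auto simp: Z_def D_def power2_eq_square)
  obtain \<eta> :: "real \<Rightarrow> complex" where \<eta>: "continuous_on {0..1} \<eta>" "\<eta> 0 = 1"
    "\<And>t. t \<in> {0..1} \<Longrightarrow> \<eta> t \<noteq> 0"
    "\<And>t. t \<in> {0..1} \<Longrightarrow> F (\<gamma> t) * \<eta> t + G' (\<gamma> t) * inverse (\<eta> t) = 2 * K (\<gamma> t)"
    using quadratic_continuation_sym[OF \<gamma>cont[OF lF(1)] \<gamma>cont[OF lF(2)] \<gamma>cont[OF lK] start1 start2 FGnz Dnz] by blast
  define R2 where "R2 t = rot (C 3) (C 2) (\<eta> t)" for t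
  have R2: "R2 t * R2 t = - 1" "tr2 (R2 t) = 0" if "t \<in> {0..1}" for t
    using rot_square[OF C3 C2 \<eta>(3)[OF that]] rot_tr[OF C3 C2] by (simp_all add: R2_def)

  have dC: "det2 (C j) = 1" if "j \<le> 3" for j using C(3)[OF that] .
  have dR1: "det2 (R1 (\<gamma> t)) = 1" if "t \<in> {0..1}" for t using det2_half_turn R1[OF \<gamma>0[OF that]] by blast
  have dR2: "det2 (R2 t) = 1" if "t \<in> {0..1}" for t using det2_half_turn R2[OF that] by blast
  \<comment> \<open>The outer links keep their traces because a rotation preserves the trace against
    its axis, the middle one by the choice of \<eta>; \<open>torsion_transfer\<close> then restores
    the relations.\<close>
  have link0: "pm1 ((C 0 * R1 (\<gamma> t)) ^ (Cs ! i ! 0))" if t: "t \<in> {0..1}" for t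
  proof (rule torsion_transfer[of "C 0 * C 1"])
    show "tr2 (C 0 * C 1) = tr2 (C 0 * R1 (\<gamma> t))" using rot_tr_axis[OF C0 C1] by (simp add: R1_def)
  qed (use dC dR1[OF t] link(1)[of 0] distinct[of 0 1] in simp_all)
  have link1: "pm1 ((R1 (\<gamma> t) * R2 t) ^ (Cs ! i ! 1))" if t: "t \<in> {0..1}" for t
  proof (rule torsion_transfer[of "C 1 * C 2"])
    show "tr2 (C 1 * C 2) = tr2 (R1 (\<gamma> t) * R2 t)"
      unfolding R2_def second \<eta>(4)[OF t] by (simp add: K_def b_def)
  qed (use dC dR1[OF t] dR2[OF t] link(1)[of 1] distinct[of 1 2] in \<open>simp_all add: numeral_2_eq_2\<close>)
  have link2: "pm1 ((R2 t * C 3) ^ (Cs ! i ! 2))" if t: "t \<in> {0..1}" for t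
  proof (rule torsion_transfer[of "C 2 * C 3"])
    show "tr2 (C 2 * C 3) = tr2 (R2 t * C 3)"
      using rot_tr_axis[OF C3 C2] unfolding R2_def tr2_commute[of _ "C 3"] by simp
  qed (use dC dR2[OF t] link(1)[of 2] distinct[of 2 3] in \<open>simp_all add: numeral_3_eq_3\<close>)

  define Mt where "Mt t x = (if x = C_gen i 1 then R1 (\<gamma> t) else if x = C_gen i 2 then R2 t else M x)" for t x
  have Mt_other: "Mt t x = M x" if "x \<noteq> C_gen i 1" "x \<noteq> C_gen i 2" for t x using that by (simp add: Mt_def)
  define w where "w = [(C_gen i 0, True), (C_gen i 1, True), (C_gen i 3, True)]"
  show ?thesis
  proof (rule deform_conclusion[of Mt "word_power w n"])
    show "Mt 0 x = M x" if "x \<in> nec_gens ms Cs" for x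
      by (simp add: Mt_def \<gamma>(2) R1_1 R2_def \<eta>(2) rot_1 C_def)
    show "det2 (Mt t x) = 1" if "t \<in> {0..1}" "x \<in> nec_gens ms Cs" for t x
      using dR1[OF that(1)] dR2[OF that(1)] det_M[OF that(2)] by (simp add: Mt_def)
    have "cont2 {0..1} (\<lambda>t. R1 (\<gamma> t))" by (rule laurent2_cont2[OF lR1 \<gamma>(1) \<gamma>0])
    moreover have "cont2 {0..1} R2" unfolding R2_def[abs_def] by (rule laurent2_cont2[OF laurent2_rot \<eta>(1,3)])
    ultimately have cont: "cont2 {0..1} (\<lambda>t. Mt t x)" for x
      by (cases "x = C_gen i 1"; cases "x = C_gen i 2") (simp_all add: Mt_def)
    show "continuous_on {0..1} (\<lambda>t. m11 (Mt t x)) \<and> continuous_on {0..1} (\<lambda>t. m12 (Mt t x)) \<and>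
      continuous_on {0..1} (\<lambda>t. m21 (Mt t x)) \<and> continuous_on {0..1} (\<lambda>t. m22 (Mt t x))" for x
      using cont[of x] unfolding cont2_def .
    show "satisfies ms Cs (Mt t)" if t: "t \<in> {0..1}" for t
      unfolding satisfies_def
    proof (intro conjI allI impI)
      show "pm1 (Mt t (X_gen k) ^ (ms ! k))" if "k < length ms" for k
        using satisfiesD(1)[OF satisfies_M that] by (simp add: Mt_def)
      show "pm1 (Mt t (C_gen k j) ^ 2)" if "k < length Cs" "j \<le> length (Cs ! k)" for k j
        using satisfiesD(2)[OF satisfies_M that] R1(1)[OF \<gamma>0[OF t]] R2(1)[OF t] by (simp add: Mt_def power2_eq_square)
      show "pm1 ((Mt t (C_gen k j) * Mt t (C_gen k (Suc j))) ^ (Cs ! k ! j))" if k: "k < length Cs" "j < length (Cs ! k)" for k j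
      proof -
        consider "k = i" "j = 0" | "k = i" "j = 1" | "k = i" "j = 2" | "k \<noteq> i \<or> j \<ge> 3" by linarith
        then show ?thesis
        proof cases
          case 1
          then show ?thesis using link0[OF t] by (simp add: Mt_def C_def)
        next
          case 2
          then show ?thesis using link1[OF t] by (simp add: Mt_def numeral_2_eq_2)
        next
          case 3
          then show ?thesis using link2[OF t] by (simp add: Mt_def C_def numeral_3_eq_3)
        next
          case 4
          then have "Mt t (C_gen k j) = M (C_gen k j)" "Mt t (C_gen k (Suc j)) = M (C_gen k (Suc j))"
            by (auto intro!: Mt_other)
          then show ?thesis using satisfiesD(3)[OF satisfies_M k] by simp
        qed
      qed
      show "pm1 (Mt t (E_gen k) * Mt t (C_gen k 0) * adj2 (Mt t (E_gen k)) * adj2 (Mt t (C_gen k (length (Cs ! k)))))"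
        if k: "k < length Cs" for k
      proof -
        \<comment> \<open>The last reflection of the cycle has index at least 3, so neither it nor
          \<open>C_gen i 0\<close> is moved.\<close>
        have "Mt t (E_gen k) = M (E_gen k)" "Mt t (C_gen k 0) = M (C_gen k 0)"
          "Mt t (C_gen k (length (Cs ! k))) = M (C_gen k (length (Cs ! k)))"
          using len by (auto intro!: Mt_other)
        then show ?thesis using satisfiesD(4)[OF satisfies_M k] by simp
      qed
      show "pm1 (prod_list (map (\<lambda>i. Mt t (X_gen i)) [0..<length ms]) * prod_list (map (\<lambda>i. Mt t (E_gen i)) [0..<length Cs]))"
        using satisfiesD(5)[OF satisfies_M] by (simp add: Mt_def)
    qed
    have w: "w \<in> words" using i(1) len by (simp add: w_def)
    then show "word_power w n \<in> words" by (rule word_power_in_lists)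
    have "\<not> word_sign s w" using sC[OF i(1)] len by (simp add: w_def)
    then show "\<not> word_sign s (word_power w n)" using word_sign_power_odd n(1) by blast
    define W where "W = C 0 * (R1 z1 * C 3)"
    have evw: "ev (Mt 1) w = W" by (simp add: w_def Mt_def W_def \<gamma>(3) C_def)
    have detW: "det2 W = 1" using dC dR1[of 1] by (simp add: W_def \<gamma>(3))
    have "tr2 W = tr2 (C 3 * C 0 * R1 z1)"
      unfolding W_def by (metis mult.assoc tr2_commute)
    also have "\<dots> = a * tr2 (C 3 * C 0 * C 0) + ((z1 + inverse z1) / 2 * tr2 (C 3 * C 0 * rot_normal (C 0) (C 1)) +
        (z1 - inverse z1) / (2 * \<i>) * tr2 (C 3 * C 0 * C 0 * rot_normal (C 0) (C 1)))"
      unfolding R1_def a_def by (rule tr2_mult_rot)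
    also have "C 3 * C 0 * C 0 = - C 3" using C0(1) by (simp add: mult.assoc)
    finally have "tr2 W = (z1 + inverse z1) / 2 * h - (z1 - inverse z1) / (2 * \<i>) * g"
      using C3(2) by (simp add: g_def h_def)
    also have "\<dots> = (h - \<i> * - g) / 2 * z1 + (h + \<i> * - g) / 2 * inverse z1"
      using trig_laurent[of z1 "inverse z1" h "- g"] by simp
    also have "(h - \<i> * - g) / 2 = \<i> * \<mu>" by (simp add: \<mu>_def field_simps)
    also have "(h + \<i> * - g) / 2 = - \<i> * \<nu>" by (simp add: \<nu>_def field_simps)
    finally have "W ^ n = 1" using root_of_unity_power[OF detW _ n(2,3,4)] tr by simp
    then show "pm1 (ev (Mt 1) (word_power w n))" by (simp add: ev_word_power evw)
  qed
qed

end

theorem theorem4p8: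
  fixes \<Gamma> :: "(complex \<Rightarrow> complex) set"
    and ms :: "nat list" and Cs :: "nat list list"
    and k0 k3 :: nat
  assumes "proper_NEC_group \<Gamma>"
    and "has_signature \<Gamma> ms Cs"
    and "k0 = card {i. i < length Cs \<and> Cs ! i = []}"
    and "k3 = card {i. i < length Cs \<and> length (Cs ! i) \<ge> 3}"
    and "k0 + k3 \<ge> 2"
  shows "\<exists>N. N \<lhd> hyp_isom\<lparr>carrier := \<Gamma>\<rparr> \<and>
           finite (rcosets\<^bsub>hyp_isom\<lparr>carrier := \<Gamma>\<rparr>\<^esub> N) \<and>
           torsion_free (hyp_isom\<lparr>carrier := N\<rparr>) \<and>
           (\<exists>f\<in>N. orientation_reversing f)"
proof -
  have sub: "subgroup \<Gamma> hyp_isom" using assms(1) by (simp add: proper_NEC_group_def NEC_group_def)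
  obtain \<phi> where pres: "presentation (hyp_isom\<lparr>carrier := \<Gamma>\<rparr>) (nec_gens ms Cs) (nec_relators ms Cs) \<phi>"
    and E: "\<And>i. i < length Cs \<Longrightarrow> orientation_preserving (\<phi> (E_gen i))"
    and R: "\<And>i j. i < length Cs \<Longrightarrow> j \<le> length (Cs ! i) \<Longrightarrow> reflection (\<phi> (C_gen i j))"
    using assms(2) unfolding has_signature_def by blast
  have periods: "\<forall>C\<in>set Cs. \<forall>n\<in>set C. n \<ge> 2" using assms(2) unfolding has_signature_def by blast
  have "\<forall>x. \<exists>p. x \<in> nec_gens ms Cs \<longrightarrow> lifts (fst p) (\<phi> x) (snd p)"
  proof
    fix x
    have "\<phi> x \<in> carrier hyp_isom" if "x \<in> nec_gens ms Cs"
      using pres that subgroup.subset[OF sub] unfolding presentation_def by auto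
    then show "\<exists>p. x \<in> nec_gens ms Cs \<longrightarrow> lifts (fst p) (\<phi> x) (snd p)"
      using isometry_lifts[of "\<phi> x"] by auto
  qed
  then obtain L where L: "\<And>x. x \<in> nec_gens ms Cs \<Longrightarrow> lifts (fst (L x)) (\<phi> x) (snd (L x))" by metis
  interpret nec_lift \<Gamma> ms Cs \<phi> "\<lambda>x. snd (L x)" "\<lambda>x. fst (L x)"
  proof (rule nec_lift.intro)
    show "fst (L (E_gen i))" if "i < length Cs" for i
      using lifts_orientation[OF L[of "E_gen i"]] that E[OF that] orientation_exclusive by (auto split: if_splits)
    show "\<not> fst (L (C_gen i j))" if "i < length Cs" "j \<le> length (Cs ! i)" for i j
      using lifts_orientation[OF L[of "C_gen i j"]] that R[OF that] orientation_exclusive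
      by (auto simp: reflection_def split: if_splits)
  qed (use sub pres periods L in auto)
  let ?A = "{i. i < length Cs \<and> Cs ! i = []}" and ?B = "{i. i < length Cs \<and> length (Cs ! i) \<ge> 3}"
  have fin: "finite ?A" "finite ?B" by auto
  have disj: "?A \<inter> ?B = {}" by auto
  \<comment> \<open>A cycle with three or more links can be paired with any other cycle counted by
    \<open>k0 + k3\<close>; if there is none, both cycles are empty.\<close>
  show ?thesis
  proof (cases "?B = {}")
    case True
    then have "k3 = 0" unfolding assms(4) by (simp only: card.empty)
    then have "card ?A \<ge> 2" using assms(3,5) by simp
    then obtain i1 i2 where "i1 \<in> ?A" "i2 \<in> ?A" "i1 \<noteq> i2"
      by (metis (no_types, lifting) card_2_iff' obtain_subset_with_card_n subsetD)
    then show ?thesis using two_empty_cycles[of i1 i2] by auto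
  next
    case False
    then obtain i where i: "i \<in> ?B" by blast
    have "card (?A \<union> ?B) \<ge> 2" using assms(3-5) card_Un_disjoint[OF fin disj] by simp
    then have "?A \<union> ?B \<noteq> {i}" using card_1_singleton_iff[of "?A \<union> ?B"] by fastforce
    then obtain i2 where "i2 \<in> ?A \<union> ?B" "i2 \<noteq> i" using i by blast
    then show ?thesis using three_link_periods[of i i2] i by auto
  qed
qed

end
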